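(* Let $M$ be an abelian monoid. Then $M$ is a direct limit of finite direct sums of monoids of the form $(\mathbb{Z}/n\mathbb{Z})\sqcup\{0\}$ (for positive integers $n$) if and only if the following two conditions hold: (a) $M$ is a strongly periodic conical refinement monoid. (b) For all idempotents $e\leq f$ in $M$, the homomorphism $G_M[e]\to G_M[f]$ given by $x\mapsto x+f$ is injective, and $G_M[e]+f=\{x+f \mid x\in G_M[e]\}$ is a pure subgroup of $G_M[f]$.
   Context: All monoids are abelian, written additively with identity $0$; monoid homomorphisms preserve $0$. Direct limits are directed colimits (over nonempty directed partially ordered sets) in the category of abelian monoids. For a group $G$ (written additively), $G\sqcup\{0\}$ denotes the monoid obtained by adjoining to $G$ a new identity element $0$ (so the zero $0_G$ of $G$ is no longer the identity of the monoid). A monoid $M$ is conical if $x+y=0$ implies $x=y=0$. $M$ is a refinement monoid if whenever $x_1+x_2=y_1+y_2$ in $M$, there are $z_{ij}\in M$ ($i,j\in\{1,2\}$) with $x_i=z_{i1}+z_{i2}$ and $y_j=z_{1j}+z_{2j}$ for all $i,j$. $M$ is strongly periodic if for every $x\in M$ there is a positive integer $m$ with $(m+1)x=x$. The algebraic preorder on $M$ is: $x\leq y$ iff $x+z=y$ for some $z\in M$. An idempotent of $M$ is an element $e$ with $2e=e$. For an idempotent $e$, $G_M[e]=\{x\in M\mid e\leq x\leq e\}$, which is an abelian group under the addition of $M$ with identity $e$; for idempotents $e\leq f$, $x\mapsto x+f$ is a group homomorphism $G_M[e]\to G_M[f]$. A subgroup $H$ of an abelian group $G$ is pure if $nG\cap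 H=nH$ for all positive integers $n$. *)

theory Defs
  imports "HOL-Algebra.Algebra"
begin

text \<open>
  Abelian monoids are HOL-Algebra's commutative monoids, so the addition \<open>+\<close>, the
  identity \<open>0\<close> and the multiple \<open>n x\<close> of the additive notation appear as \<open>\<otimes>\<close>,
  \<open>\<one>\<close> and \<open>x [^] n\<close>, and the algebraic preorder \<open>x \<le> y\<close> is \<open>x divides y\<close>.
\<close>

section \<open>Homomorphisms and direct limits of abelian monoids\<close>

text \<open>The library's \<^const>\<open>hom\<close> does not require preservation of the identity.\<close>

definition monoid_homs :: "('a, 'm) monoid_scheme \<Rightarrow> ('b, 'n) monoid_scheme \<Rightarrow> ('a \<Rightarrow> 'b) set"
  where "monoid_homs G H = {h \<in> hom G H. h \<one>\<^bsub>G\<^esub> = \<one>\<^bsub>H\<^esub>}"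

locale directed_system =
  fixes I :: "'i set" and r :: "'i rel"
    and N :: "'i \<Rightarrow> 'b monoid" and f :: "'i \<Rightarrow> 'i \<Rightarrow> 'b \<Rightarrow> 'b"
  assumes nonempty: "I \<noteq> {}"
    and order: "partial_order_on I r"
    and directed: "\<And>i j. i \<in> I \<Longrightarrow> j \<in> I \<Longrightarrow> \<exists>k\<in>I. (i, k) \<in> r \<and> (j, k) \<in> r"
    and monoids: "\<And>i. i \<in> I \<Longrightarrow> comm_monoid (N i)"
    and homs: "\<And>i j. (i, j) \<in> r \<Longrightarrow> f i j \<in> monoid_homs (N i) (N j)"
    and identity: "\<And>i x. i \<in> I \<Longrightarrow> x \<in> carrier (N i) \<Longrightarrow> f i i x = x"
    and composition: "\<And>i j k x. (i, j) \<in> r \<Longrightarrow> (j, k) \<in> r \<Longrightarrow> x \<in> carrier (N i) \<Longrightarrow>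
          f j k (f i j x) = f i k x"

text \<open>
  The direct limit is the disjoint union of the monoids modulo eventual equality.  The
  universal property characterising it as the colimit in the category of abelian monoids
  is \<open>direct_limit_universal\<close> below; it is not used as the definition because its
  quantification over all monoids ranges over arbitrary carrier types.
\<close>

definition limit_rel :: "'i set \<Rightarrow> 'i rel \<Rightarrow> ('i \<Rightarrow> 'b monoid) \<Rightarrow> ('i \<Rightarrow> 'i \<Rightarrow> 'b \<Rightarrow> 'b) \<Rightarrow> ('i \<times> 'b) rel"
  where "limit_rel I r N f =
    {((i, x), (j, y)). i \<in> I \<and> x \<in> carrier (N i) \<and> j \<in> I \<and> y \<in> carrier (N j) \<and>
       (\<exists>k\<in>I. (i, k) \<in> r \<and> (j, k) \<in> r \<and> f i k x = f j k y)}"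

definition direct_limit ::
    "'i set \<Rightarrow> 'i rel \<Rightarrow> ('i \<Rightarrow> 'b monoid) \<Rightarrow> ('i \<Rightarrow> 'i \<Rightarrow> 'b \<Rightarrow> 'b) \<Rightarrow> ('i \<times> 'b) set monoid"
  where "direct_limit I r N f =
    \<lparr>carrier = (SIGMA i:I. carrier (N i)) // limit_rel I r N f,
     monoid.mult = (\<lambda>A B. limit_rel I r N f ``
       {(k, f i k x \<otimes>\<^bsub>N k\<^esub> f j k y) | i j k x y.
          (i, x) \<in> A \<and> (j, y) \<in> B \<and> (i, k) \<in> r \<and> (j, k) \<in> r}),
     one = limit_rel I r N f `` {(i, \<one>\<^bsub>N i\<^esub>) | i. i \<in> I}\<rparr>"

definition limit_map ::
    "'i set \<Rightarrow> 'i rel \<Rightarrow> ('i \<Rightarrow> 'b monoid) \<Rightarrow> ('i \<Rightarrow> 'i \<Rightarrow> 'b \<Rightarrow> 'b) \<Rightarrow> 'i \<Rightarrow> 'b \<Rightarrow> ('i \<times> 'b) set"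
  where "limit_map I r N f i x = limit_rel I r N f `` {(i, x)}"

context directed_system
begin

lemma r_sub: "(i, j) \<in> r \<Longrightarrow> i \<in> I \<and> j \<in> I"
  using order unfolding partial_order_on_def preorder_on_def by blast

lemma r_refl: "i \<in> I \<Longrightarrow> (i, i) \<in> r"
  using order unfolding partial_order_on_def preorder_on_def refl_on_def by blast

lemma r_trans: "(i, j) \<in> r \<Longrightarrow> (j, k) \<in> r \<Longrightarrow> (i, k) \<in> r"
  using order unfolding partial_order_on_def preorder_on_def trans_def by blast

lemma f_closed: "(i, j) \<in> r \<Longrightarrow> x \<in> carrier (N i) \<Longrightarrow> f i j x \<in> carrier (N j)"
  using homs unfolding monoid_homs_def hom_def by blast

lemma f_mult: "(i, j) \<in> r \<Longrightarrow> x \<in> carrier (N i) \<Longrightarrow> y \<in> carrier (N i) \<Longrightarrow>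
    f i j (x \<otimes>\<^bsub>N i\<^esub> y) = f i j x \<otimes>\<^bsub>N j\<^esub> f i j y"
  using homs unfolding monoid_homs_def hom_def by blast

lemma f_one: "(i, j) \<in> r \<Longrightarrow> f i j \<one>\<^bsub>N i\<^esub> = \<one>\<^bsub>N j\<^esub>"
  using homs unfolding monoid_homs_def by blast

lemma m_closed: "i \<in> I \<Longrightarrow> x \<in> carrier (N i) \<Longrightarrow> y \<in> carrier (N i) \<Longrightarrow>
    x \<otimes>\<^bsub>N i\<^esub> y \<in> carrier (N i)"
  by (meson comm_monoid.axioms(1) monoid.m_closed monoids)

lemma one_closed: "i \<in> I \<Longrightarrow> \<one>\<^bsub>N i\<^esub> \<in> carrier (N i)"
  by (meson comm_monoid.axioms(1) monoid.one_closed monoids)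

lemma equiv_limit_rel: "equiv (SIGMA i:I. carrier (N i)) (limit_rel I r N f)"
proof (rule equivI)
  show "limit_rel I r N f \<subseteq> (SIGMA i:I. carrier (N i)) \<times> (SIGMA i:I. carrier (N i))"
    unfolding limit_rel_def by blast
  show "refl_on (SIGMA i:I. carrier (N i)) (limit_rel I r N f)"
    unfolding refl_on_def limit_rel_def using r_refl by blast
  show "sym (limit_rel I r N f)"
    unfolding sym_def limit_rel_def by fastforce
  show "trans (limit_rel I r N f)"
  proof (rule transI, clarify)
    fix i x j y k z
    assume a: "((i, x), (j, y)) \<in> limit_rel I r N f" and b: "((j, y), (k, z)) \<in> limit_rel I r N f"
    from a obtain p where p: "p \<in> I" "(i, p) \<in> r" "(j, p) \<in> r" "f i p x = f j p y"
        and x: "i \<in> I" "x \<in> carrier (N i)" "y \<in> carrier (N j)"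
      unfolding limit_rel_def by blast
    from b obtain q where q: "q \<in> I" "(j, q) \<in> r" "(k, q) \<in> r" "f j q y = f k q z"
        and z: "k \<in> I" "z \<in> carrier (N k)"
      unfolding limit_rel_def by blast
    obtain s where s: "s \<in> I" "(p, s) \<in> r" "(q, s) \<in> r" using directed p q by blast
    have "f i s x = f k s z"
      using composition p q s x z by metis
    then show "((i, x), (k, z)) \<in> limit_rel I r N f"
      unfolding limit_rel_def using x z s p q r_trans by blast
  qed
qed

lemma limit_map_eq_iff:
  assumes "i \<in> I" "x \<in> carrier (N i)" "j \<in> I" "y \<in> carrier (N j)"
  shows "limit_map I r N f i x = limit_map I r N f j y \<longleftrightarrow>
    (\<exists>k\<in>I. (i, k) \<in> r \<and> (j, k) \<in> r \<and> f i k x = f j k y)"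
proof -
  have "limit_map I r N f i x = limit_map I r N f j y \<longleftrightarrow> ((i, x), (j, y)) \<in> limit_rel I r N f"
    unfolding limit_map_def using eq_equiv_class_iff[OF equiv_limit_rel] assms by simp
  then show ?thesis using assms by (simp add: limit_rel_def)
qed

lemma limit_map_compat:
  assumes "(i, j) \<in> r" "x \<in> carrier (N i)"
  shows "limit_map I r N f j (f i j x) = limit_map I r N f i x"
proof -
  have ij: "i \<in> I" "j \<in> I" using r_sub assms by blast+
  have "f j j (f i j x) = f i j x" using identity ij f_closed assms by blast
  then show ?thesis
    using limit_map_eq_iff[OF ij(2) f_closed[OF assms] ij(1) assms(2)] assms(1) ij(2) r_refl by blast
qed

lemma carrier_direct_limit:
  "carrier (direct_limit I r N f) = {limit_map I r N f i x | i x. i \<in> I \<and> x \<in> carrier (N i)}"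
  unfolding direct_limit_def limit_map_def quotient_def by auto

lemma limit_map_closed:
  "i \<in> I \<Longrightarrow> x \<in> carrier (N i) \<Longrightarrow> limit_map I r N f i x \<in> carrier (direct_limit I r N f)"
  unfolding carrier_direct_limit by blast

lemma Image_const:
  assumes "P \<noteq> {}" "\<And>p. p \<in> P \<Longrightarrow> limit_rel I r N f `` {p} = C"
  shows "limit_rel I r N f `` P = C"
proof -
  have "limit_rel I r N f `` P = (\<Union>p\<in>P. limit_rel I r N f `` {p})" by blast
  also have "\<dots> = (\<Union>p\<in>P. C)" using assms(2) by (intro SUP_cong) simp_all
  finally show ?thesis using assms(1) by simp
qed

lemma limit_one:
  assumes "i \<in> I"
  shows "\<one>\<^bsub>direct_limit I r N f\<^esub> = limit_map I r N f i \<one>\<^bsub>N i\<^esub>"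
proof -
  have *: "limit_map I r N f j \<one>\<^bsub>N j\<^esub> = limit_map I r N f i \<one>\<^bsub>N i\<^esub>" if j: "j \<in> I" for j
  proof -
    obtain k where k: "k \<in> I" "(j, k) \<in> r" "(i, k) \<in> r" using directed[OF j assms] by blast
    then have "f j k \<one>\<^bsub>N j\<^esub> = f i k \<one>\<^bsub>N i\<^esub>" by (simp add: f_one)
    then show ?thesis
      using limit_map_eq_iff[OF j one_closed[OF j] assms one_closed[OF assms]] k by blast
  qed
  have "limit_rel I r N f `` {(j, \<one>\<^bsub>N j\<^esub>) | j. j \<in> I} = limit_map I r N f i \<one>\<^bsub>N i\<^esub>"
  proof (rule Image_const)
    show "{(j, \<one>\<^bsub>N j\<^esub>) | j. j \<in> I} \<noteq> {}" using assms by blast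
    fix p assume "p \<in> {(j, \<one>\<^bsub>N j\<^esub>) | j. j \<in> I}"
    then obtain j where "j \<in> I" "p = (j, \<one>\<^bsub>N j\<^esub>)" by blast
    then show "limit_rel I r N f `` {p} = limit_map I r N f i \<one>\<^bsub>N i\<^esub>"
      using * unfolding limit_map_def by blast
  qed
  then show ?thesis by (simp add: direct_limit_def)
qed

lemma mem_limit_map:
  "(j, y) \<in> limit_map I r N f i x \<longleftrightarrow> ((i, x), (j, y)) \<in> limit_rel I r N f"
  unfolding limit_map_def by blast

lemma limit_mult:
  assumes ik: "(i, k) \<in> r" and jk: "(j, k) \<in> r" and x: "x \<in> carrier (N i)" and y: "y \<in> carrier (N j)"
  shows "limit_map I r N f i x \<otimes>\<^bsub>direct_limit I r N f\<^esub> limit_map I r N f j y =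
    limit_map I r N f k (f i k x \<otimes>\<^bsub>N k\<^esub> f j k y)"
proof -
  have I: "i \<in> I" "j \<in> I" "k \<in> I" using r_sub ik jk by blast+
  have *: "limit_map I r N f k' (f i' k' x' \<otimes>\<^bsub>N k'\<^esub> f j' k' y') =
      limit_map I r N f k (f i k x \<otimes>\<^bsub>N k\<^esub> f j k y)"
    if x': "(i', x') \<in> limit_map I r N f i x" and y': "(j', y') \<in> limit_map I r N f j y"
      and ik': "(i', k') \<in> r" and jk': "(j', k') \<in> r" for i' j' k' x' y'
  proof -
    from x' obtain p where p: "p \<in> I" "(i, p) \<in> r" "(i', p) \<in> r" "f i p x = f i' p x'"
        and x'c: "x' \<in> carrier (N i')"
      unfolding mem_limit_map limit_rel_def by blast
    from y' obtain q where q: "q \<in> I" "(j, q) \<in> r" "(j', q) \<in> r" "f j q y = f j' q y'"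
        and y'c: "y' \<in> carrier (N j')"
      unfolding mem_limit_map limit_rel_def by blast
    have k': "k' \<in> I" using r_sub ik' by blast
    obtain s where s: "s \<in> I" "(p, s) \<in> r" "(q, s) \<in> r" using directed p q by blast
    obtain t where t: "t \<in> I" "(k, t) \<in> r" "(k', t) \<in> r" using directed I k' by blast
    obtain u where u: "u \<in> I" "(s, u) \<in> r" "(t, u) \<in> r" using directed s t by blast
    have pu: "(p, u) \<in> r" "(q, u) \<in> r" "(k, u) \<in> r" "(k', u) \<in> r"
      using s t u r_trans by blast+
    have ex: "f i u x = f i' u x'" using composition p pu x x'c by metis
    have ey: "f j u y = f j' u y'" using composition q pu y y'c by metis
    have "f k' u (f i' k' x' \<otimes>\<^bsub>N k'\<^esub> f j' k' y') = f i' u x' \<otimes>\<^bsub>N u\<^esub> f j' u y'"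
      using f_mult pu ik' jk' x'c y'c f_closed composition by simp
    moreover have "f k u (f i k x \<otimes>\<^bsub>N k\<^esub> f j k y) = f i u x \<otimes>\<^bsub>N u\<^esub> f j u y"
      using f_mult pu ik jk x y f_closed composition by simp
    ultimately have "f k' u (f i' k' x' \<otimes>\<^bsub>N k'\<^esub> f j' k' y') = f k u (f i k x \<otimes>\<^bsub>N k\<^esub> f j k y)"
      using ex ey by simp
    moreover have "f i' k' x' \<otimes>\<^bsub>N k'\<^esub> f j' k' y' \<in> carrier (N k')"
      using m_closed k' f_closed ik' jk' x'c y'c by blast
    moreover have "f i k x \<otimes>\<^bsub>N k\<^esub> f j k y \<in> carrier (N k)"
      using m_closed I f_closed ik jk x y by blast
    ultimately show ?thesis
      using limit_map_eq_iff[of k' _ k] k' I u pu by blast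
  qed
  have mem: "(i, x) \<in> limit_map I r N f i x" "(j, y) \<in> limit_map I r N f j y"
    unfolding mem_limit_map limit_rel_def using r_refl I x y by blast+
  have "limit_rel I r N f `` {(k, f a k c \<otimes>\<^bsub>N k\<^esub> f b k d) | a b k c d.
          (a, c) \<in> limit_map I r N f i x \<and> (b, d) \<in> limit_map I r N f j y \<and> (a, k) \<in> r \<and> (b, k) \<in> r} =
      limit_map I r N f k (f i k x \<otimes>\<^bsub>N k\<^esub> f j k y)"
  proof (rule Image_const)
    show "{(k, f a k c \<otimes>\<^bsub>N k\<^esub> f b k d) | a b k c d.
          (a, c) \<in> limit_map I r N f i x \<and> (b, d) \<in> limit_map I r N f j y \<and> (a, k) \<in> r \<and> (b, k) \<in> r} \<noteq> {}"
      using mem ik jk by blast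
  next
    fix p
    assume "p \<in> {(k, f a k c \<otimes>\<^bsub>N k\<^esub> f b k d) | a b k c d.
          (a, c) \<in> limit_map I r N f i x \<and> (b, d) \<in> limit_map I r N f j y \<and> (a, k) \<in> r \<and> (b, k) \<in> r}"
    then obtain a b k' c d where "p = (k', f a k' c \<otimes>\<^bsub>N k'\<^esub> f b k' d)"
      "(a, c) \<in> limit_map I r N f i x" "(b, d) \<in> limit_map I r N f j y" "(a, k') \<in> r" "(b, k') \<in> r"
      by blast
    then show "limit_rel I r N f `` {p} = limit_map I r N f k (f i k x \<otimes>\<^bsub>N k\<^esub> f j k y)"
      using * unfolding limit_map_def by metis
  qed
  then show ?thesis by (simp add: direct_limit_def)
qed

lemma limit_mult_same:
  assumes "i \<in> I" "x \<in> carrier (N i)" "y \<in> carrier (N i)"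
  shows "limit_map I r N f i x \<otimes>\<^bsub>direct_limit I r N f\<^esub> limit_map I r N f i y =
    limit_map I r N f i (x \<otimes>\<^bsub>N i\<^esub> y)"
  using limit_mult[OF r_refl r_refl, of i x y] assms identity[of i x] identity[of i y] by simp

lemma limit_common:
  assumes "A \<in> carrier (direct_limit I r N f)" "B \<in> carrier (direct_limit I r N f)"
  obtains k x y where "k \<in> I" "x \<in> carrier (N k)" "y \<in> carrier (N k)"
    "A = limit_map I r N f k x" "B = limit_map I r N f k y"
proof -
  from assms obtain i x j y where a: "i \<in> I" "x \<in> carrier (N i)" "A = limit_map I r N f i x"
      "j \<in> I" "y \<in> carrier (N j)" "B = limit_map I r N f j y"
    unfolding carrier_direct_limit by blast
  obtain k where k: "k \<in> I" "(i, k) \<in> r" "(j, k) \<in> r" using directed a by blast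
  show ?thesis
    by (rule that[of k "f i k x" "f j k y"]) (use a k f_closed limit_map_compat in auto)
qed

lemma comm_monoid_direct_limit: "comm_monoid (direct_limit I r N f)"
proof -
  let ?L = "direct_limit I r N f"
  obtain i0 where i0: "i0 \<in> I" using nonempty by blast
  have comm_closed: "A \<otimes>\<^bsub>?L\<^esub> B \<in> carrier ?L \<and> A \<otimes>\<^bsub>?L\<^esub> B = B \<otimes>\<^bsub>?L\<^esub> A"
    if AB: "A \<in> carrier ?L" "B \<in> carrier ?L" for A B
  proof -
    obtain k x y where k: "k \<in> I" "x \<in> carrier (N k)" "y \<in> carrier (N k)"
      "A = limit_map I r N f k x" "B = limit_map I r N f k y"
      using AB by (rule limit_common)
    have "x \<otimes>\<^bsub>N k\<^esub> y = y \<otimes>\<^bsub>N k\<^esub> x"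
      using comm_monoid.m_comm[OF monoids] k by blast
    then show ?thesis
      using k limit_mult_same[OF k(1)] m_closed[OF k(1)] limit_map_closed[OF k(1)] by simp
  qed
  show ?thesis
  proof (rule comm_monoidI)
    show "\<one>\<^bsub>?L\<^esub> \<in> carrier ?L" using limit_one[OF i0] limit_map_closed[OF i0 one_closed[OF i0]] by simp
    fix A assume A: "A \<in> carrier ?L"
    then obtain i x where x: "i \<in> I" "x \<in> carrier (N i)" "A = limit_map I r N f i x"
      unfolding carrier_direct_limit by blast
    then show "\<one>\<^bsub>?L\<^esub> \<otimes>\<^bsub>?L\<^esub> A = A"
      using limit_one[OF x(1)] limit_mult_same[OF x(1) one_closed[OF x(1)] x(2)]
        monoid.l_one[OF comm_monoid.axioms(1)[OF monoids[OF x(1)]] x(2)] by simp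
    fix B assume B: "B \<in> carrier ?L"
    show "A \<otimes>\<^bsub>?L\<^esub> B \<in> carrier ?L" "A \<otimes>\<^bsub>?L\<^esub> B = B \<otimes>\<^bsub>?L\<^esub> A"
      using comm_closed A B by blast+
    fix C assume C: "C \<in> carrier ?L"
    obtain k x y where k: "k \<in> I" "x \<in> carrier (N k)" "y \<in> carrier (N k)"
        "A = limit_map I r N f k x" "B = limit_map I r N f k y"
      using A B by (rule limit_common)
    obtain l z where l: "l \<in> I" "z \<in> carrier (N l)" "C = limit_map I r N f l z"
      using C unfolding carrier_direct_limit by blast
    obtain m where m: "m \<in> I" "(k, m) \<in> r" "(l, m) \<in> r" using directed k l by blast
    let ?x = "f k m x" and ?y = "f k m y" and ?z = "f l m z"
    have c: "?x \<in> carrier (N m)" "?y \<in> carrier (N m)" "?z \<in> carrier (N m)"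
      using f_closed m k l by blast+
    have e: "A = limit_map I r N f m ?x" "B = limit_map I r N f m ?y" "C = limit_map I r N f m ?z"
      using limit_map_compat m k l by simp_all
    show "(A \<otimes>\<^bsub>?L\<^esub> B) \<otimes>\<^bsub>?L\<^esub> C = A \<otimes>\<^bsub>?L\<^esub> (B \<otimes>\<^bsub>?L\<^esub> C)"
      unfolding e using c limit_mult_same[OF m(1)] m_closed[OF m(1)]
        monoid.m_assoc[OF comm_monoid.axioms(1)[OF monoids[OF m(1)]] c] by simp
  qed
qed

lemma limit_map_hom:
  assumes "i \<in> I"
  shows "limit_map I r N f i \<in> monoid_homs (N i) (direct_limit I r N f)"
  unfolding monoid_homs_def hom_def
  using limit_map_closed[OF assms] limit_mult_same[OF assms] limit_one[OF assms]
  by (simp add: Pi_iff)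

theorem direct_limit_universal:
  fixes K :: "('c, 'k) monoid_scheme"
  assumes K: "comm_monoid K"
    and \<psi>: "\<And>i. i \<in> I \<Longrightarrow> \<psi> i \<in> monoid_homs (N i) K"
    and compat: "\<And>i j x. (i, j) \<in> r \<Longrightarrow> x \<in> carrier (N i) \<Longrightarrow> \<psi> j (f i j x) = \<psi> i x"
  shows "\<exists>!h. h \<in> monoid_homs (direct_limit I r N f) K \<and>
    h \<in> extensional (carrier (direct_limit I r N f)) \<and>
    (\<forall>i\<in>I. \<forall>x\<in>carrier (N i). h (limit_map I r N f i x) = \<psi> i x)"
proof -
  let ?L = "direct_limit I r N f" and ?l = "limit_map I r N f"
  have wd: "\<psi> i x = \<psi> j y"
    if a: "i \<in> I" "x \<in> carrier (N i)" "j \<in> I" "y \<in> carrier (N j)" "?l i x = ?l j y" for i x j y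
  proof -
    obtain k where k: "(i, k) \<in> r" "(j, k) \<in> r" "f i k x = f j k y"
      using limit_map_eq_iff[OF a(1-4)] a(5) by blast
    then show ?thesis using compat[OF k(1) a(2)] compat[OF k(2) a(4)] k(3) by simp
  qed
  define h where "h = (\<lambda>A\<in>carrier ?L. THE v. \<exists>i\<in>I. \<exists>x\<in>carrier (N i). A = ?l i x \<and> v = \<psi> i x)"
  have h: "h (?l i x) = \<psi> i x" if "i \<in> I" "x \<in> carrier (N i)" for i x
    unfolding h_def using that limit_map_closed by (auto intro!: the_equality wd)
  have hom: "h \<in> monoid_homs ?L K"
    unfolding monoid_homs_def hom_def
  proof (intro CollectI conjI ballI Pi_I)
    fix A assume "A \<in> carrier ?L"
    then obtain i x where x: "i \<in> I" "x \<in> carrier (N i)" "A = ?l i x"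
      unfolding carrier_direct_limit by blast
    then show "h A \<in> carrier K"
      using h[OF x(1,2)] \<psi>[OF x(1)] by (auto simp: monoid_homs_def hom_def)
  next
    fix A B assume "A \<in> carrier ?L" "B \<in> carrier ?L"
    then obtain k x y where k: "k \<in> I" "x \<in> carrier (N k)" "y \<in> carrier (N k)"
      "A = ?l k x" "B = ?l k y" by (rule limit_common)
    then show "h (A \<otimes>\<^bsub>?L\<^esub> B) = h A \<otimes>\<^bsub>K\<^esub> h B"
      using limit_mult_same[OF k(1-3)] h[OF k(1)] m_closed[OF k(1-3)] \<psi>[OF k(1)]
      by (simp add: monoid_homs_def hom_def)
  next
    obtain i where i: "i \<in> I" using nonempty by blast
    show "h \<one>\<^bsub>?L\<^esub> = \<one>\<^bsub>K\<^esub>"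
      using limit_one[OF i] h[OF i one_closed[OF i]] \<psi>[OF i] by (simp add: monoid_homs_def)
  qed
  have ext: "h \<in> extensional (carrier ?L)" unfolding h_def by simp
  show ?thesis
  proof (rule ex1I[of _ h])
    show "h \<in> monoid_homs ?L K \<and> h \<in> extensional (carrier ?L) \<and>
        (\<forall>i\<in>I. \<forall>x\<in>carrier (N i). h (?l i x) = \<psi> i x)"
      using hom ext h by blast
    fix g
    assume g: "g \<in> monoid_homs ?L K \<and> g \<in> extensional (carrier ?L) \<and>
        (\<forall>i\<in>I. \<forall>x\<in>carrier (N i). g (?l i x) = \<psi> i x)"
    show "g = h"
    proof (rule extensionalityI[of g "carrier ?L"])
      fix A assume "A \<in> carrier ?L"
      then obtain i x where x: "i \<in> I" "x \<in> carrier (N i)" "A = ?l i x"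
        unfolding carrier_direct_limit by blast
      then show "g A = h A" using g h[OF x(1,2)] by metis
    qed (use g ext in auto)
  qed
qed

end

text \<open>
  \<open>M\<close> is a direct limit of monoids from the class \<open>C\<close>.  HOL cannot quantify over the
  type of indices inside a formula, so that type is a parameter; \<open>C\<close> fixes the carrier type.
  A finite-subset-indexed construction shows that \<open>('a \<times> nat) set\<close> is large enough as
  index type for the classes \<open>C\<close> considered here when \<open>M\<close> has carrier type \<open>'a\<close>.
\<close>

definition is_direct_limit_of ::
    "'i itself \<Rightarrow> ('b monoid \<Rightarrow> bool) \<Rightarrow> ('a, 'm) monoid_scheme \<Rightarrow> bool"
  where "is_direct_limit_of TYPE('i) C M \<longleftrightarrow>
    (\<exists>(I :: 'i set) r N f. directed_system I r N f \<and> (\<forall>i\<in>I. C (N i)) \<and> M \<cong> direct_limit I r N f)"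

section \<open>Finite direct sums of the monoids obtained from finite cyclic groups\<close>

text \<open>\<open>G \<squnion> {0}\<close>: \<open>None\<close> is the new identity.\<close>

definition adjoin_identity :: "('a, 'm) monoid_scheme \<Rightarrow> 'a option monoid"
  where "adjoin_identity G =
    \<lparr>carrier = insert None (Some ` carrier G),
     monoid.mult = (\<lambda>x y. case x of None \<Rightarrow> y
        | Some a \<Rightarrow> (case y of None \<Rightarrow> x | Some b \<Rightarrow> Some (a \<otimes>\<^bsub>G\<^esub> b))),
     one = None\<rparr>"

text \<open>
  Finite direct sums are finite direct products; \<^const>\<open>product_group\<close> only uses the monoid
  structure of the factors.  The library's \<open>sum_group\<close> is unsuitable, since it is
  generated using inverses.  The empty sum is the trivial monoid.
\<close>

definition finite_sum_of_cyclic_with_identity :: "'b monoid \<Rightarrow> bool"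
  where "finite_sum_of_cyclic_with_identity N \<longleftrightarrow>
    (\<exists>(k::nat) n. (\<forall>i<k. 0 < n i) \<and>
       N \<cong> product_group {..<k} (\<lambda>i. adjoin_identity (integer_mod_group (n i))))"

section \<open>Properties of abelian monoids\<close>

definition conical :: "('a, 'm) monoid_scheme \<Rightarrow> bool"
  where "conical M \<longleftrightarrow>
    (\<forall>x\<in>carrier M. \<forall>y\<in>carrier M. x \<otimes>\<^bsub>M\<^esub> y = \<one>\<^bsub>M\<^esub> \<longrightarrow> x = \<one>\<^bsub>M\<^esub> \<and> y = \<one>\<^bsub>M\<^esub>)"

definition refinement_monoid :: "('a, 'm) monoid_scheme \<Rightarrow> bool"
  where "refinement_monoid M \<longleftrightarrow>
    (\<forall>x1\<in>carrier M. \<forall>x2\<in>carrier M. \<forall>y1\<in>carrier M. \<forall>y2\<in>carrier M.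
      x1 \<otimes>\<^bsub>M\<^esub> x2 = y1 \<otimes>\<^bsub>M\<^esub> y2 \<longrightarrow>
      (\<exists>z11\<in>carrier M. \<exists>z12\<in>carrier M. \<exists>z21\<in>carrier M. \<exists>z22\<in>carrier M.
         x1 = z11 \<otimes>\<^bsub>M\<^esub> z12 \<and> x2 = z21 \<otimes>\<^bsub>M\<^esub> z22 \<and>
         y1 = z11 \<otimes>\<^bsub>M\<^esub> z21 \<and> y2 = z12 \<otimes>\<^bsub>M\<^esub> z22))"

definition strongly_periodic :: "('a, 'm) monoid_scheme \<Rightarrow> bool"
  where "strongly_periodic M \<longleftrightarrow> (\<forall>x\<in>carrier M. \<exists>m::nat. 0 < m \<and> x [^]\<^bsub>M\<^esub> (m + 1) = x)"

definition idempotents :: "('a, 'm) monoid_scheme \<Rightarrow> 'a set"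
  where "idempotents M = {e \<in> carrier M. e \<otimes>\<^bsub>M\<^esub> e = e}"

text \<open>The group of all \<open>x\<close> with \<open>e \<le> x \<le> e\<close> in the algebraic preorder.\<close>

definition idem_group :: "('a, 'm) monoid_scheme \<Rightarrow> 'a \<Rightarrow> 'a monoid"
  where "idem_group M e =
    \<lparr>carrier = {x \<in> carrier M. e divides\<^bsub>M\<^esub> x \<and> x divides\<^bsub>M\<^esub> e}, monoid.mult = monoid.mult M, one = e\<rparr>"

lemma (in comm_monoid) idem_group_carrier_iff:
  assumes "e \<in> idempotents G"
  shows "x \<in> carrier (idem_group G e) \<longleftrightarrow>
    x \<in> carrier G \<and> e \<otimes> x = x \<and> (\<exists>w\<in>carrier G. x \<otimes> w = e)"
proof -
  have e: "e \<in> carrier G" "e \<otimes> e = e" using assms by (simp_all add: idempotents_def)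
  have "e divides x \<longleftrightarrow> e \<otimes> x = x" if x: "x \<in> carrier G"
  proof
    assume "e divides x"
    then obtain z where z: "z \<in> carrier G" "x = e \<otimes> z" unfolding factor_def by blast
    have "e \<otimes> (e \<otimes> z) = e \<otimes> z" using m_assoc[OF e(1) e(1) z(1)] e(2) by simp
    then show "e \<otimes> x = x" unfolding z(2) .
  next
    assume "e \<otimes> x = x"
    then show "e divides x" unfolding factor_def using x by metis
  qed
  moreover have "x divides e \<longleftrightarrow> (\<exists>w\<in>carrier G. x \<otimes> w = e)"
    unfolding factor_def by metis
  ultimately show ?thesis unfolding idem_group_def by auto
qed

lemma (in comm_monoid) comm_group_idem_group:
  assumes "e \<in> idempotents G"
  shows "comm_group (idem_group G e)"
proof -
  let ?H = "idem_group G e"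
  note iff = idem_group_carrier_iff[OF assms]
  have e: "e \<in> carrier G" "e \<otimes> e = e" using assms by (simp_all add: idempotents_def)
  have ops: "x \<otimes>\<^bsub>?H\<^esub> y = x \<otimes> y" "\<one>\<^bsub>?H\<^esub> = e" for x y
    by (simp_all add: idem_group_def)
  show ?thesis
  proof (rule comm_groupI, unfold ops)
    show "e \<in> carrier ?H" unfolding iff using e by blast
    fix x assume "x \<in> carrier ?H"
    then obtain w where x: "x \<in> carrier G" "e \<otimes> x = x" and w: "w \<in> carrier G" "x \<otimes> w = e"
      unfolding iff by blast
    show "e \<otimes> x = x" by (fact x(2))
    have "(e \<otimes> w) \<otimes> x = e \<otimes> (x \<otimes> w)" using e(1) w(1) x(1) by (simp add: m_ac)
    then have inverse: "(e \<otimes> w) \<otimes> x = e" using w(2) e(2) by simp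
    have "e \<otimes> (e \<otimes> w) = e \<otimes> w" using m_assoc[OF e(1) e(1) w(1)] e(2) by simp
    then have "e \<otimes> w \<in> carrier ?H" unfolding iff using e(1) w(1) x(1) inverse by blast
    then show "\<exists>y\<in>carrier ?H. y \<otimes> x = e" using inverse by blast
    fix y assume "y \<in> carrier ?H"
    then obtain v where y: "y \<in> carrier G" "e \<otimes> y = y" and v: "v \<in> carrier G" "y \<otimes> v = e"
      unfolding iff by blast
    have "(x \<otimes> y) \<otimes> (w \<otimes> v) = (x \<otimes> w) \<otimes> (y \<otimes> v)" using x(1) y(1) w(1) v(1) by (simp add: m_ac)
    then have "(x \<otimes> y) \<otimes> (w \<otimes> v) = e" using w(2) v(2) e(2) by simp
    moreover have "e \<otimes> (x \<otimes> y) = x \<otimes> y" using m_assoc[OF e(1) x(1) y(1)] x(2) by simp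
    ultimately show "x \<otimes> y \<in> carrier ?H" unfolding iff using x(1) y(1) w(1) v(1) by blast
    show "x \<otimes> y = y \<otimes> x" using x(1) y(1) by (rule m_comm)
    fix z assume "z \<in> carrier ?H"
    then have z: "z \<in> carrier G" unfolding iff by blast
    show "x \<otimes> y \<otimes> z = x \<otimes> (y \<otimes> z)" using x(1) y(1) z by (rule m_assoc)
  qed
qed

definition pure_subgroup :: "'a set \<Rightarrow> ('a, 'm) monoid_scheme \<Rightarrow> bool"
  where "pure_subgroup H G \<longleftrightarrow> subgroup H G \<and>
    (\<forall>n::nat. 0 < n \<longrightarrow> (\<lambda>x. x [^]\<^bsub>G\<^esub> n) ` carrier G \<inter> H = (\<lambda>x. x [^]\<^bsub>G\<^esub> n) ` H)"

text \<open>The maps \<open>x \<mapsto> x + f\<close> between these groups are injective with pure image.\<close>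

definition groups_embed_purely :: "('a, 'm) monoid_scheme \<Rightarrow> bool"
  where "groups_embed_purely M \<longleftrightarrow>
    (\<forall>e\<in>idempotents M. \<forall>f\<in>idempotents M. e divides\<^bsub>M\<^esub> f \<longrightarrow>
       inj_on (\<lambda>x. x \<otimes>\<^bsub>M\<^esub> f) (carrier (idem_group M e)) \<and>
       pure_subgroup ((\<lambda>x. x \<otimes>\<^bsub>M\<^esub> f) ` carrier (idem_group M e)) (idem_group M f))"

end

theory Submission
  imports Defs
begin

text \<open>
  A monoid satisfying (a) and (b) is the union of its groups \<open>G[e]\<close>, and the injectivity in (b)
  realises all groups \<open>G[e]\<close> with \<open>e \<le> t\<close> as subgroups of \<open>G[t]\<close>.  Refinement makes
  \<open>J \<mapsto> J + t\<close> compatible with sums and intersections of the order ideals \<open>J\<close> below \<open>t\<close>, and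
  the order ideals form a distributive lattice; (b) says that the subgroups \<open>J + t\<close> are pure.

  The key point is that the inclusion of every finite submonoid \<open>A\<close> factors through a finite sum
  of monoids \<open>(\<int>/n\<int>) \<squnion> {0}\<close>.  Let \<open>E\<close> be the set of idempotents of \<open>A\<close>, with largest element \<open>t\<close>.
  For \<open>m \<noteq> t\<close> in \<open>E\<close> let \<open>I m\<close> be the ideal of all \<open>x\<close> lying below every \<open>e \<in> E\<close> with \<open>e\<close> not below \<open>m\<close>.
  By distributivity each \<open>e \<in> E\<close> is a sum of elements of those \<open>I m\<close> for which \<open>e\<close> is not below \<open>m\<close>.
  Climbing through \<open>E\<close>, purity splits off from \<open>I m + t\<close> a finite direct sum of cyclic groups that
  is independent of the contributions of smaller indices.  This yields independent cyclic
  generators, each in some \<open>I m + t\<close>, spanning \<open>A + t\<close>, and the coordinates of \<open>x \<in> A\<close> together with its support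
  define the map from \<open>A\<close> to the finite sum.

  Conversely, all the conditions involve finitely many elements and equations at a time, so that they
  pass to direct limits, and they hold in finite sums of the monoids \<open>(\<int>/n\<int>) \<squnion> {0}\<close>.
\<close>

section \<open>Torsion abelian groups over a pure subgroup\<close>

text \<open>Inside the single group of \<open>t\<close> all the relevant groups can be compared, but
  the image of an element there forgets its support. Both data must survive in the finite sum, so
  the independence of the generators has to be graded: a combination that comes from elements below
  \<open>e\<close> must have trivial coordinates at every index \<open>m \<ge> e\<close>. These are
  exactly the coordinates that become the adjoined identity, and \<open>e = \<one>\<close> gives
  ordinary independence.

  An obstacle is that an intersection of principal order ideals need not be principal, even in a
  semilattice, so an ideal \<open>I m\<close> offers no canonical idempotent for the summands at
  \<open>m\<close>. Only finitely many elements are in play, however, and a generator found in the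
  group of \<open>t\<close> can be lifted to an element of \<open>I m\<close> whose support is as
  large as they require.

  Purity is needed because generators of a finite group modulo a subgroup must be lifted without
  changing their orders. It passes from the groups of idempotents to \<open>J + t\<close> for every
  order ideal \<open>J\<close>, since extracting one root concerns only one idempotent of
  \<open>J\<close>.\<close>

definition int_comb :: "('g, 'm) monoid_scheme \<Rightarrow> ('x \<Rightarrow> 'g) \<Rightarrow> ('x \<Rightarrow> int) \<Rightarrow> 'x set \<Rightarrow> 'g"
  where "int_comb G y c S = finprod G (\<lambda>x. y x [^]\<^bsub>G\<^esub> c x) S"

text \<open>For a subgroup \<open>V\<close> this is the preimage of a finitely generated subgroup of
  the quotient by \<open>V\<close>. It allows arguing modulo \<open>V\<close> with elements instead
  of cosets.\<close>

definition span_over ::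
    "('g, 'm) monoid_scheme \<Rightarrow> 'g set \<Rightarrow> ('x \<Rightarrow> 'g) \<Rightarrow> 'x set \<Rightarrow> 'g set"
  where "span_over G V y S = {v \<otimes>\<^bsub>G\<^esub> int_comb G y c S | v c. v \<in> V}"

context comm_group
begin

lemma int_comb_closed [simp]: "y \<in> S \<rightarrow> carrier G \<Longrightarrow> int_comb G y c S \<in> carrier G"
  unfolding int_comb_def by (rule finprod_closed) auto

lemma int_comb_insert:
  assumes "finite S" "x \<notin> S" "y \<in> insert x S \<rightarrow> carrier G"
  shows "int_comb G y c (insert x S) = y x [^] c x \<otimes> int_comb G y c S"
  unfolding int_comb_def using assms by (intro finprod_insert) auto

lemma int_comb_remove:
  assumes "finite S" "x \<in> S" "y \<in> S \<rightarrow> carrier G"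
  shows "int_comb G y c S = y x [^] c x \<otimes> int_comb G y c (S - {x})"
  using int_comb_insert[of "S - {x}" x y c] assms by (simp add: insert_absorb)

lemma int_comb_cong:
  assumes "\<And>x. x \<in> S \<Longrightarrow> y x = z x" "\<And>x. x \<in> S \<Longrightarrow> c x = d x" "z \<in> S \<rightarrow> carrier G"
  shows "int_comb G y c S = int_comb G z d S"
  unfolding int_comb_def using assms by (intro finprod_cong') auto

lemma int_comb_upd:
  assumes "x \<notin> S" "y \<in> S \<rightarrow> carrier G"
  shows "int_comb G (y(x := a)) c S = int_comb G y c S" "int_comb G y (c(x := n)) S = int_comb G y c S"
  using assms by (intro int_comb_cong; auto)+

lemma int_comb_zero [simp]: "int_comb G y (\<lambda>_. 0) S = \<one>"
  unfolding int_comb_def by simp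

lemma int_comb_add:
  assumes "y \<in> S \<rightarrow> carrier G"
  shows "int_comb G y (\<lambda>x. c x + d x) S = int_comb G y c S \<otimes> int_comb G y d S"
proof -
  have "int_comb G y (\<lambda>x. c x + d x) S = (\<Otimes>x\<in>S. y x [^] c x \<otimes> y x [^] d x)"
    unfolding int_comb_def using assms by (intro finprod_cong') (auto simp: int_pow_mult Pi_iff)
  then show ?thesis unfolding int_comb_def using assms by (subst (asm) finprod_multf) auto
qed

lemma int_comb_scale:
  assumes "finite S" "y \<in> S \<rightarrow> carrier G"
  shows "int_comb G y (\<lambda>x. k * c x) S = int_comb G y c S [^] k"
  using assms
proof (induction S)
  case empty
  then show ?case by (simp add: int_comb_def)
next
  case (insert x S)
  then show ?case
    by (simp add: int_comb_insert int_pow_distrib int_pow_pow mult.commute)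
qed

lemma int_comb_subgroup:
  assumes "subgroup H G" "finite S" "\<And>x. x \<in> S \<Longrightarrow> y x \<in> H"
  shows "int_comb G y c S \<in> H"
  using assms(2,3)
proof (induction S)
  case empty
  then show ?case using assms(1) by (simp add: int_comb_def subgroup.one_closed)
next
  case (insert x S)
  have "y \<in> insert x S \<rightarrow> carrier G" using insert.prems subgroup.subset[OF assms(1)] by auto
  moreover have "y x [^] c x \<in> H"
    using insert.prems assms(1) by (simp add: subgroup_int_pow_closed)
  ultimately show ?case
    using insert assms(1) by (simp add: int_comb_insert subgroup.m_closed)
qed

lemma span_over_subgroup:
  assumes V: "subgroup V G" and S: "finite S" and y: "y \<in> S \<rightarrow> carrier G"
  shows "subgroup (span_over G V y S) G"
proof (rule subgroupI)
  note Vc = subgroup.mem_carrier[OF V]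
  show "span_over G V y S \<subseteq> carrier G" using y Vc unfolding span_over_def by auto
  show "span_over G V y S \<noteq> {}" unfolding span_over_def using subgroup.one_closed[OF V] by blast
  fix a assume "a \<in> span_over G V y S"
  then obtain v c where a: "a = v \<otimes> int_comb G y c S" "v \<in> V" unfolding span_over_def by blast
  have "inv a = inv v \<otimes> int_comb G y (\<lambda>x. (-1) * c x) S"
    using a y Vc S by (subst int_comb_scale) (auto simp: int_pow_neg inv_mult m_comm)
  then show "inv a \<in> span_over G V y S"
    unfolding span_over_def using subgroup.m_inv_closed[OF V a(2)] by blast
  fix b assume "b \<in> span_over G V y S"
  then obtain u d where b: "b = u \<otimes> int_comb G y d S" "u \<in> V" unfolding span_over_def by blast
  have "a \<otimes> b = (v \<otimes> u) \<otimes> int_comb G y (\<lambda>x. c x + d x) S"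
    using a b y Vc by (simp add: int_comb_add m_ac)
  then show "a \<otimes> b \<in> span_over G V y S"
    unfolding span_over_def using subgroup.m_closed[OF V a(2) b(2)] by blast
qed

lemma span_over_minimal:
  assumes "subgroup H G" "finite S" "V \<subseteq> H" "\<And>x. x \<in> S \<Longrightarrow> y x \<in> H"
  shows "span_over G V y S \<subseteq> H"
  unfolding span_over_def using assms int_comb_subgroup[OF assms(1,2,4)]
  by (auto intro: subgroup.m_closed)

lemma span_over_base: "subgroup V G \<Longrightarrow> V \<subseteq> span_over G V y S"
proof
  fix v assume V: "subgroup V G" and v: "v \<in> V"
  have "v = v \<otimes> int_comb G y (\<lambda>_. 0) S" using subgroup.mem_carrier[OF V v] by simp
  then show "v \<in> span_over G V y S" unfolding span_over_def using v by blast
qed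

lemma span_over_gen:
  assumes "subgroup V G" "finite S" "y \<in> S \<rightarrow> carrier G" "x \<in> S"
  shows "y x \<in> span_over G V y S"
proof -
  have "int_comb G y (\<lambda>z. if z = x then 1 else 0) S = y x"
    using assms int_comb_remove[OF assms(2,4,3), of "\<lambda>z. if z = x then 1 else 0"]
      int_comb_cong[of "S - {x}" y y "\<lambda>z. if z = x then 1 else 0" "\<lambda>_. 0"]
    by (auto simp: Pi_iff)
  then have "y x = \<one> \<otimes> int_comb G y (\<lambda>z. if z = x then 1 else 0) S"
    using assms by (auto simp: Pi_iff)
  then show ?thesis unfolding span_over_def using subgroup.one_closed[OF assms(1)] by blast
qed

lemma span_over_eqI:
  assumes "subgroup V G" "finite S" "y \<in> S \<rightarrow> carrier G" "z \<in> S \<rightarrow> carrier G"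
    and "\<And>x. x \<in> S \<Longrightarrow> y x \<in> span_over G V z S" "\<And>x. x \<in> S \<Longrightarrow> z x \<in> span_over G V y S"
  shows "span_over G V y S = span_over G V z S"
  by (intro equalityI span_over_minimal span_over_subgroup span_over_base assms)

text \<open>An elementary operation on generators: \<open>y x\<close> is recovered by subtracting
  \<open>h\<close>, which lies in the span of \<open>V\<close> and the other generators and is
  therefore unaffected by the change at \<open>x\<close>.\<close>

lemma span_over_upd:
  assumes V: "subgroup V G" and S: "finite S" "x \<in> S" and y: "y \<in> S \<rightarrow> carrier G"
    and h: "h \<in> span_over G V y (S - {x})"
  shows "span_over G V (y(x := y x \<otimes> h)) S = span_over G V y S"
proof -
  let ?z = "y(x := y x \<otimes> h)"
  have yX: "y \<in> (S - {x}) \<rightarrow> carrier G" "y x \<in> carrier G" using y S(2) by auto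
  have hc: "h \<in> carrier G"
    using h subgroup.subset[OF span_over_subgroup[OF V _ yX(1)]] S by blast
  have z: "?z \<in> S \<rightarrow> carrier G" using y hc S(2) by (auto simp: Pi_iff)
  note gy = span_over_gen[OF V S(1) y] and gz = span_over_gen[OF V S(1) z]
  note sy = span_over_subgroup[OF V S(1) y] and sz = span_over_subgroup[OF V S(1) z]
  have hy: "h \<in> span_over G V y S"
    using h span_over_minimal[OF sy, of "S - {x}" V y] gy span_over_base[OF V] S(1) by blast
  have "?z a \<in> span_over G V ?z S" if "a \<in> S - {x}" for a using gz[of a] that by blast
  then have "y a \<in> span_over G V ?z S" if "a \<in> S - {x}" for a
    using that by (metis Diff_iff fun_upd_other singletonI)
  then have hz: "h \<in> span_over G V ?z S"
    using h span_over_minimal[OF sz, of "S - {x}" V y] span_over_base[OF V] S(1) by blast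
  show ?thesis
  proof (rule span_over_eqI[OF V S(1) z y])
    fix a assume a: "a \<in> S"
    show "?z a \<in> span_over G V y S"
      using gy[OF a] subgroup.m_closed[OF sy _ hy] by auto
    show "y a \<in> span_over G V ?z S"
    proof (cases "a = x")
      case True
      have "y x = ?z x \<otimes> inv h" using yX hc by (simp add: m_assoc)
      then show ?thesis
        using True subgroup.m_closed[OF sz gz[OF S(2)] subgroup.m_inv_closed[OF sz hz]] by simp
    next
      case False
      then show ?thesis using gz[OF a] by simp
    qed
  qed
qed

text \<open>
  Among all generating families equivalent to the given one and all their relations modulo
  \<open>V\<close>, the least positive coefficient divides the other coefficients of its relation, so that
  one generator splits off; purity lets it be chosen with exact order.
\<close>

theorem independent_generators_over_pure:
  fixes y :: "'x \<Rightarrow> 'a"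
  assumes V: "subgroup V G"
    and pure: "\<And>g n. g \<in> carrier G \<Longrightarrow> 0 < n \<Longrightarrow> g [^] (n::nat) \<in> V \<Longrightarrow> \<exists>v\<in>V. v [^] n = g [^] n"
    and torsion: "\<And>g. g \<in> carrier G \<Longrightarrow> \<exists>n>0. g [^] (n::nat) = \<one>"
    and "finite S" "y \<in> S \<rightarrow> carrier G"
  obtains w n where "w \<in> S \<rightarrow> carrier G" "span_over G V w S = span_over G V y S"
    "\<And>x. x \<in> S \<Longrightarrow> 0 < n x \<and> w x [^] (n x :: nat) = \<one>"
    "\<And>c x. int_comb G w c S \<in> V \<Longrightarrow> x \<in> S \<Longrightarrow> int (n x) dvd c x"
proof -
  define Q where "Q S y w n \<longleftrightarrow> w \<in> S \<rightarrow> carrier G \<and> span_over G V w S = span_over G V y S \<and>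
    (\<forall>x\<in>S. 0 < n x \<and> w x [^] (n x :: nat) = \<one>) \<and>
    (\<forall>c. int_comb G w c S \<in> V \<longrightarrow> (\<forall>x\<in>S. int (n x) dvd c x))" for S :: "'x set" and y w n
  have "\<exists>w n. Q S y w n" using assms(4,5)
  \<comment> \<open>\<open>y\<close> varies together with \<open>S\<close>, because the generators
    that remain after splitting one off are modified ones.\<close>
  proof (induction "card S" arbitrary: S y)
    case 0
    then show ?case by (intro exI[of _ y]) (simp add: Q_def)
  next
    case (Suc k)
    note S = Suc.prems(1)
    define P where "P N \<longleftrightarrow> 0 < N \<and> (\<exists>z c x. z \<in> S \<rightarrow> carrier G \<and>
      span_over G V z S = span_over G V y S \<and> x \<in> S \<and> int_comb G z c S \<in> V \<and> c x = int N)" for N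
    obtain x0 where x0: "x0 \<in> S" using Suc.hyps(2) by fastforce
    obtain N0 :: nat where N0: "N0 > 0" "y x0 [^] N0 = \<one>" using torsion[of "y x0"] x0 Suc.prems(2) by blast
    \<comment> \<open>Torsion supplies a first relation with a positive coefficient, so that a least
      such coefficient exists.\<close>
    have "int_comb G y ((\<lambda>_. 0)(x0 := int N0)) S = \<one>"
      using int_comb_remove[OF S x0 Suc.prems(2)] int_comb_upd(2)[of x0 "S - {x0}" y "\<lambda>_. 0" "int N0"]
        Suc.prems(2) N0(2) by (simp add: int_pow_int Pi_iff)
    then have "P N0" unfolding P_def using N0(1) x0 Suc.prems(2) subgroup.one_closed[OF V]
      by (intro conjI exI[of _ y] exI[of _ "(\<lambda>_. 0)(x0 := int N0)"] exI[of _ x0]) auto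
    define N where "N = (LEAST N. P N)"
    have "P N" unfolding N_def using \<open>P N0\<close> by (rule LeastI)
    have least: "\<not> P M" if "M < N" for M using that unfolding N_def by (rule not_less_Least)
    from \<open>P N\<close> have Npos: "0 < N" unfolding P_def by blast
    from \<open>P N\<close> obtain z c x where z: "z \<in> S \<rightarrow> carrier G"
      and zs: "span_over G V z S = span_over G V y S" and x: "x \<in> S"
      and zc: "int_comb G z c S \<in> V" and cx: "c x = int N" unfolding P_def by blast
    have zx: "z x \<in> carrier G" and zX: "z \<in> (S - {x}) \<rightarrow> carrier G" using z x by auto
    have no_small: "r = 0" if "0 \<le> r" "r < int N" "z' \<in> S \<rightarrow> carrier G"
      "span_over G V z' S = span_over G V y S" "a \<in> S" "int_comb G z' d S \<in> V" "d a = r" for r z' a d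
    proof (rule ccontr)
      assume "r \<noteq> 0"
      then have "P (nat r)" unfolding P_def using that by auto
      then show False using least[of "nat r"] that by auto
    qed
    have dvd: "int N dvd c j" if j: "j \<in> S" for j
    proof (cases "j = x")
      case False
      define q where "q = c j div int N"
      define r where "r = c j mod int N"
      have qr: "c j = q * int N + r" unfolding q_def r_def by simp
      have zj: "z j \<in> carrier G" using z j by auto
      \<comment> \<open>Euclidean division: with the generators at x and j written additively as a
        and b, N a + (q N + r) b equals N (a + q b) + r b. After the change of generator the same
        relation has the coefficient \<open>r < N\<close> at \<open>j\<close>.\<close>
      let ?z = "z(x := z x \<otimes> z j [^] q)"
      let ?c = "c(j := r)"
      have jX: "j \<in> S - {x}" using j False by simp
      have sub: "subgroup (span_over G V z (S - {x})) G" by (rule span_over_subgroup[OF V _ zX]) (use S in simp)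
      have "z j [^] q \<in> span_over G V z (S - {x})"
        by (rule subgroup_int_pow_closed[OF sub], rule span_over_gen[OF V _ zX jX]) (use S in simp)
      then have s: "span_over G V ?z S = span_over G V y S"
        using span_over_upd[OF V S x z] zs by simp
      have z': "?z \<in> S \<rightarrow> carrier G" using z zj x by (auto simp: Pi_iff)
      let ?R = "S - {x} - {j}"
      have zR: "z \<in> ?R \<rightarrow> carrier G" using z by auto
      have "int_comb G ?z ?c S = (z x \<otimes> z j [^] q) [^] c x \<otimes> (z j [^] r \<otimes> int_comb G ?z ?c ?R)"
        using int_comb_remove[OF S x z', of ?c] int_comb_remove[of "S - {x}" j ?z ?c] S jX z' zX False by auto
      also have "int_comb G ?z ?c ?R = int_comb G z c ?R"
        using zR by (intro int_comb_cong) auto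
      also have "(z x \<otimes> z j [^] q) [^] c x = z x [^] c x \<otimes> z j [^] (q * int N)"
        using zx zj by (simp add: int_pow_distrib int_pow_pow cx)
      also have "z x [^] c x \<otimes> z j [^] (q * int N) \<otimes> (z j [^] r \<otimes> int_comb G z c ?R) =
          z x [^] c x \<otimes> ((z j [^] (q * int N) \<otimes> z j [^] r) \<otimes> int_comb G z c ?R)"
        using zx zj zR by (simp add: m_assoc)
      also have "z j [^] (q * int N) \<otimes> z j [^] r = z j [^] c j"
        unfolding qr using zj by (simp add: int_pow_mult)
      also have "z x [^] c x \<otimes> (z j [^] c j \<otimes> int_comb G z c ?R) = int_comb G z c S"
        using int_comb_remove[OF S x z, of c] int_comb_remove[of "S - {x}" j z c] S jX zX by simp
      finally have "int_comb G ?z ?c S \<in> V" using zc by (simp add: fun_upd_def)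
      then have "r = 0"
        using no_small[of r ?z j ?c] z' s j Npos by (simp add: r_def)
      then show ?thesis using qr by simp
    qed (simp add: cx)
    \<comment> \<open>Dividing the relation by \<open>N\<close> gives an element \<open>g\<close>
      with \<open>g [^] N \<in> V\<close>. As the coefficient of \<open>z x\<close> becomes 1,
      \<open>g\<close> and all its translates by \<open>V\<close> can replace \<open>z x\<close>;
      purity selects the translate \<open>w0\<close> whose \<open>N\<close>-th power is
      trivial.\<close>
    define e where "e j = c j div int N" for j
    have ce: "c j = int N * e j" if "j \<in> S" for j using dvd[OF that] by (simp add: e_def)
    have ex: "e x = 1" using cx Npos by (simp add: e_def)
    define g where "g = int_comb G z e S"
    have gc: "g \<in> carrier G" using z by (simp add: g_def)
    have "g [^] N = int_comb G z (\<lambda>j. int N * e j) S"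
      using int_comb_scale[OF S z, of "int N" e] by (simp add: g_def int_pow_int)
    also have "\<dots> = int_comb G z c S" using z ce by (intro int_comb_cong) auto
    finally have "g [^] N \<in> V" using zc by simp
    then obtain v where v: "v \<in> V" "v [^] N = g [^] N" using pure[OF gc Npos] by blast
    have vc: "v \<in> carrier G" using v V by (simp add: subgroup.mem_carrier)
    define w0 where "w0 = g \<otimes> inv v"
    have w0c: "w0 \<in> carrier G" using gc vc by (simp add: w0_def)
    have w0N: "w0 [^] N = \<one>"
      unfolding w0_def using gc vc v(2)
      by (subst nat_pow_distrib) (auto simp: nat_pow_inv)
    define z3 where "z3 = z(x := w0)"
    have z3: "z3 \<in> S \<rightarrow> carrier G" using z w0c by (auto simp: z3_def)
    have "w0 = z x \<otimes> (inv v \<otimes> int_comb G z e (S - {x}))"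
      unfolding w0_def g_def using int_comb_remove[OF S x z, of e] ex zx zX vc by (simp add: m_ac)
    moreover have "inv v \<otimes> int_comb G z e (S - {x}) \<in> span_over G V z (S - {x})"
      unfolding span_over_def using subgroup.m_inv_closed[OF V v(1)] by blast
    ultimately have z3s: "span_over G V z3 S = span_over G V y S"
      unfolding z3_def using span_over_upd[OF V S x z] zs by simp
    \<comment> \<open>Powers of \<open>w0\<close> depend only on the exponent modulo
      \<open>N\<close>, so the coefficient at \<open>x\<close> may be replaced by its remainder,
      which the minimality of \<open>N\<close> forces to be 0.\<close>
    have Ndvd: "int N dvd d x" if d: "int_comb G z3 d S \<in> V" for d
    proof -
      define q where "q = d x div int N"
      define r where "r = d x mod int N"
      have qr: "d x = int N * q + r" unfolding q_def r_def by simp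
      have "w0 [^] d x = w0 [^] r"
        unfolding qr using w0c w0N
        by (simp add: int_pow_mult flip: int_pow_pow) (simp add: int_pow_int)
      then have "int_comb G z3 (d(x := r)) S = int_comb G z3 d S"
        using int_comb_remove[OF S x z3] int_comb_upd(2)[of x "S - {x}" z3 d r] z3
        by (simp add: Pi_iff) (simp add: z3_def)
      then have "r = 0"
        using no_small[of r z3 x "d(x := r)"] z3 z3s x d Npos by (simp add: r_def)
      then show ?thesis using qr by simp
    qed
    have z3X: "z3 \<in> (S - {x}) \<rightarrow> carrier G" using z3 by auto
    have "\<exists>w n. Q (S - {x}) z3 w n"
      by (rule Suc.hyps(1)) (use Suc.hyps(2) S x z3X in auto)
    then obtain w' n' where Qw': "Q (S - {x}) z3 w' n'" by blast
    have w': "w' \<in> (S - {x}) \<rightarrow> carrier G"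
      and w's: "span_over G V w' (S - {x}) = span_over G V z3 (S - {x})"
      and w'n: "\<forall>a\<in>S - {x}. 0 < n' a \<and> w' a [^] n' a = \<one>"
      and w'i: "\<And>c. int_comb G w' c (S - {x}) \<in> V \<Longrightarrow> \<forall>a\<in>S - {x}. int (n' a) dvd c a"
      using Qw' unfolding Q_def by blast+
    define w where "w = w'(x := w0)"
    define n where "n = n'(x := N)"
    have w: "w \<in> S \<rightarrow> carrier G" using w' w0c by (auto simp: w_def)
    have fX: "finite (S - {x})" using S by simp
    have s3: "subgroup (span_over G V z3 S) G" and sw: "subgroup (span_over G V w S) G"
      using span_over_subgroup[OF V S] w z3 by blast+
    have "span_over G V z3 (S - {x}) \<subseteq> span_over G V z3 S"
      by (rule span_over_minimal[OF s3 fX span_over_base[OF V] span_over_gen[OF V S z3]]) simp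
    moreover have ws: "span_over G V w' (S - {x}) \<subseteq> span_over G V w S"
    proof (rule span_over_minimal[OF sw fX span_over_base[OF V]])
      fix a assume "a \<in> S - {x}"
      then show "w' a \<in> span_over G V w S" using span_over_gen[OF V S w, of a] by (auto simp: w_def)
    qed
    ultimately have sub: "span_over G V z3 (S - {x}) \<subseteq> span_over G V w S"
        "span_over G V w' (S - {x}) \<subseteq> span_over G V z3 S" using w's by auto
    have "span_over G V w S = span_over G V z3 S"
    proof (rule span_over_eqI[OF V S w z3])
      fix a assume a: "a \<in> S"
      show "w a \<in> span_over G V z3 S"
        using span_over_gen[OF V fX w', of a] sub(2) span_over_gen[OF V S z3, of x] a x
        by (cases "a = x") (auto simp: w_def z3_def)
      show "z3 a \<in> span_over G V w S"
        using span_over_gen[OF V fX z3X, of a] sub(1) span_over_gen[OF V S w, of x] a x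
        by (cases "a = x") (auto simp: w_def z3_def)
    qed
    then have c1: "span_over G V w S = span_over G V y S" using z3s by simp
    \<comment> \<open>The part of the relation on \<open>S - {x}\<close> is rewritten in the
      generators \<open>z3\<close>, at the cost of an element of \<open>V\<close> and without
      touching the coefficient at \<open>x\<close>. Hence \<open>N\<close> divides that coefficient,
      its term vanishes, and a relation among the remaining \<open>w'\<close> is left.\<close>
    have c2: "int (n a) dvd d a" if d: "int_comb G w d S \<in> V" and a: "a \<in> S" for d a
    proof -
      have cw: "int_comb G w d S = w0 [^] d x \<otimes> int_comb G w' d (S - {x})"
        using int_comb_remove[OF S x w, of d] int_comb_upd(1)[of x "S - {x}" w' w0 d] w'
        by (simp add: w_def)
      have "int_comb G w' d (S - {x}) \<in> span_over G V z3 (S - {x})"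
        unfolding w's[symmetric]
        by (rule int_comb_subgroup[OF span_over_subgroup[OF V fX w'] fX span_over_gen[OF V fX w']])
      then obtain u d' where u: "u \<in> V" "int_comb G w' d (S - {x}) = u \<otimes> int_comb G z3 d' (S - {x})"
        unfolding span_over_def by blast
      have uc: "u \<in> carrier G" using u V by (simp add: subgroup.mem_carrier)
      have "int_comb G z3 (d'(x := d x)) S = w0 [^] d x \<otimes> int_comb G z3 d' (S - {x})"
        using int_comb_remove[OF S x z3, of "d'(x := d x)"] int_comb_upd(2)[of x "S - {x}" z3] z3X
        by (simp add: z3_def)
      also have "\<dots> = inv u \<otimes> int_comb G w d S"
        unfolding cw u(2) using w0c uc z3X
        by (subst m_lcomm[of "w0 [^] d x" u]) (simp_all flip: m_assoc)
      finally have "int_comb G z3 (d'(x := d x)) S \<in> V"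
        using d u(1) V by (simp add: subgroup.m_closed subgroup.m_inv_closed)
      then have Nd: "int N dvd d x" using Ndvd by fastforce
      then obtain q where "d x = int N * q" by blast
      then have "w0 [^] d x = \<one>"
        using w0c w0N by (simp flip: int_pow_pow) (simp add: int_pow_int)
      then have "int_comb G w' d (S - {x}) \<in> V" using cw d w' by simp
      then show ?thesis using w'i a Nd by (cases "a = x") (auto simp: n_def)
    qed
    have "Q S y w n"
      unfolding Q_def using w c1 c2 w'n w0N Npos by (auto simp: w_def n_def)
    then show ?case by blast
  qed
  then show ?thesis using that unfolding Q_def by blast
qed

end

section \<open>Supports and order ideals\<close>

context comm_monoid
begin

lemma mult_idem_group [simp]: "x \<otimes>\<^bsub>idem_group G e\<^esub> y = x \<otimes> y"
  and one_idem_group [simp]: "\<one>\<^bsub>idem_group G e\<^esub> = e"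
  by (simp_all add: idem_group_def)

lemma idempotents_closed: "e \<in> idempotents G \<Longrightarrow> e \<in> carrier G"
  and idempotents_idem: "e \<in> idempotents G \<Longrightarrow> e \<otimes> e = e"
  by (simp_all add: idempotents_def)

lemma idempotents_mult: "e \<in> idempotents G \<Longrightarrow> f \<in> idempotents G \<Longrightarrow> e \<otimes> f \<in> idempotents G"
proof -
  assume "e \<in> idempotents G" "f \<in> idempotents G"
  then have c: "e \<in> carrier G" "f \<in> carrier G" "e \<otimes> e = e" "f \<otimes> f = f" by (simp_all add: idempotents_def)
  have "e \<otimes> f \<otimes> (e \<otimes> f) = (e \<otimes> e) \<otimes> (f \<otimes> f)" using c(1,2) by (simp add: m_ac)
  then show "e \<otimes> f \<in> idempotents G" using c by (simp add: idempotents_def)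
qed

lemma one_idempotent: "\<one> \<in> idempotents G"
  by (simp add: idempotents_def)

lemma idempotent_divides_iff:
  assumes e: "e \<in> idempotents G" and x: "x \<in> carrier G"
  shows "e divides x \<longleftrightarrow> e \<otimes> x = x"
proof
  assume "e divides x"
  then obtain z where z: "z \<in> carrier G" "x = e \<otimes> z" unfolding factor_def by blast
  then show "e \<otimes> x = x" using e by (simp add: idempotents_def flip: m_assoc)
next
  assume "e \<otimes> x = x"
  then show "e divides x" unfolding factor_def using x by metis
qed

lemma idem_group_closed:
  assumes "e \<in> idempotents G" "x \<in> carrier (idem_group G e)"
  shows "x \<in> carrier G" "e \<otimes> x = x" "x \<otimes> e = x"
proof -
  show x: "x \<in> carrier G" "e \<otimes> x = x" using assms idem_group_carrier_iff by blast+
  then show "x \<otimes> e = x" using m_comm[OF _ x(1), of e] idempotents_closed[OF assms(1)] by simp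
qed

text \<open>Exponent 0 is excluded because the zeroth power is \<open>e\<close> in the group but
  \<open>\<one>\<close> in the monoid.\<close>

lemma idem_group_pow:
  assumes e: "e \<in> idempotents G" and x: "x \<in> carrier (idem_group G e)" and "0 < (n::nat)"
  shows "x [^]\<^bsub>idem_group G e\<^esub> n = x [^] n"
proof -
  interpret E: comm_group "idem_group G e" by (rule comm_group_idem_group[OF e])
  note c = idem_group_closed[OF e x]
  show ?thesis using \<open>0 < n\<close>
  proof (induction n rule: nat_induct_non_zero)
    case 1
    then show ?case using x c by simp
  next
    case (Suc n)
    then show ?case by simp
  qed
qed

lemma translation_hom:
  assumes e: "e \<in> idempotents G" and f: "f \<in> idempotents G" and ef: "e \<otimes> f = f"
  shows "group_hom (idem_group G e) (idem_group G f) (\<lambda>x. x \<otimes> f)"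
proof -
  interpret E: comm_group "idem_group G e" by (rule comm_group_idem_group[OF e])
  interpret F: comm_group "idem_group G f" by (rule comm_group_idem_group[OF f])
  have fc: "f \<in> carrier G" "f \<otimes> f = f" using f by (simp_all add: idempotents_def)
  show ?thesis
  proof (unfold_locales, rule homI)
    fix x assume x: "x \<in> carrier (idem_group G e)"
    then obtain w where xw: "x \<in> carrier G" "w \<in> carrier G" "x \<otimes> w = e"
      using idem_group_carrier_iff[OF e] by blast
    have "f \<otimes> (x \<otimes> f) = x \<otimes> (f \<otimes> f)" using xw fc(1) by (simp only: m_lcomm)
    then have "f \<otimes> (x \<otimes> f) = x \<otimes> f" using fc(2) by simp
    moreover have "x \<otimes> f \<otimes> w = (x \<otimes> w) \<otimes> f" using xw(1,2) fc(1) by (simp add: m_ac)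
    then have "x \<otimes> f \<otimes> w = f" using xw(3) ef by simp
    ultimately show "x \<otimes> f \<in> carrier (idem_group G f)"
      unfolding idem_group_carrier_iff[OF f] using xw fc by blast
    fix y assume "y \<in> carrier (idem_group G e)"
    then have y: "y \<in> carrier G" using idem_group_closed(1)[OF e] by blast
    have "x \<otimes> y \<otimes> f = x \<otimes> y \<otimes> (f \<otimes> f)" using fc by simp
    also have "\<dots> = (x \<otimes> f) \<otimes> (y \<otimes> f)" using xw(1) y fc(1) by (simp add: m_ac)
    finally show "x \<otimes>\<^bsub>idem_group G e\<^esub> y \<otimes> f = (x \<otimes> f) \<otimes>\<^bsub>idem_group G f\<^esub> (y \<otimes> f)" by simp
  qed
qed

text \<open>Condition (b) in terms of elements and equations: injectivity moves the root demanded by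
  purity back into the group of \<open>e\<close>. In this form the condition can be transported
  along homomorphisms by lifting and solving equations.\<close>

lemma groups_embed_purely_iff:
  "groups_embed_purely G \<longleftrightarrow> (\<forall>e\<in>idempotents G. \<forall>f\<in>idempotents G. e \<otimes> f = f \<longrightarrow>
    (\<forall>x\<in>carrier (idem_group G e). \<forall>y\<in>carrier (idem_group G e). x \<otimes> f = y \<otimes> f \<longrightarrow> x = y) \<and>
    (\<forall>x\<in>carrier (idem_group G e). \<forall>y\<in>carrier (idem_group G f). \<forall>n>0.
       y [^] (n::nat) = x \<otimes> f \<longrightarrow> (\<exists>z\<in>carrier (idem_group G e). z [^] n = x)))"
proof -
  have "(inj_on (\<lambda>x. x \<otimes> f) (carrier (idem_group G e)) \<and>
       pure_subgroup ((\<lambda>x. x \<otimes> f) ` carrier (idem_group G e)) (idem_group G f)) \<longleftrightarrow>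
    (\<forall>x\<in>carrier (idem_group G e). \<forall>y\<in>carrier (idem_group G e). x \<otimes> f = y \<otimes> f \<longrightarrow> x = y) \<and>
    (\<forall>x\<in>carrier (idem_group G e). \<forall>y\<in>carrier (idem_group G f). \<forall>n>0.
       y [^] (n::nat) = x \<otimes> f \<longrightarrow> (\<exists>z\<in>carrier (idem_group G e). z [^] n = x))"
    (is "?inj \<and> ?pure \<longleftrightarrow> ?inj' \<and> ?pure'")
    if e: "e \<in> idempotents G" and f: "f \<in> idempotents G" and ef: "e \<otimes> f = f" for e f
  proof -
    let ?E = "idem_group G e" and ?F = "idem_group G f"
    let ?h = "\<lambda>x. x \<otimes> f"
    interpret h: group_hom ?E ?F ?h by (rule translation_hom[OF e f ef])
    note pe = idem_group_pow[OF e] and pf = idem_group_pow[OF f]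
    have hp: "?h (z [^] n) = ?h z [^]\<^bsub>?F\<^esub> n" if "z \<in> carrier ?E" "0 < n" for z and n :: nat
      using h.hom_nat_pow[OF that(1), of n] pe[OF that] by simp
    have "?inj \<longleftrightarrow> ?inj'" unfolding inj_on_def by blast
    moreover have "?pure \<longleftrightarrow> ?pure'" if inj: ?inj'
    proof
      assume p: ?pure
      show ?pure'
      proof (intro ballI allI impI)
        fix x y and n :: nat
        assume x: "x \<in> carrier ?E" and y: "y \<in> carrier ?F" and n: "0 < n" and eq: "y [^] n = x \<otimes> f"
        have "y [^]\<^bsub>?F\<^esub> n \<in> (\<lambda>x. x [^]\<^bsub>?F\<^esub> n) ` carrier ?F \<inter> ?h ` carrier ?E"
          using pf[OF y n] eq x y by (metis IntI imageI)
        then have "y [^]\<^bsub>?F\<^esub> n \<in> (\<lambda>x. x [^]\<^bsub>?F\<^esub> n) ` ?h ` carrier ?E"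
          using p n unfolding pure_subgroup_def by blast
        then obtain z where z: "z \<in> carrier ?E" "y [^]\<^bsub>?F\<^esub> n = ?h z [^]\<^bsub>?F\<^esub> n" by blast
        have "?h (z [^] n) = ?h x" using hp[OF z(1) n] z(2) pf[OF y n] eq by simp
        moreover have "z [^] n \<in> carrier ?E" using pe[OF z(1) n] h.G.nat_pow_closed[OF z(1), of n] by simp
        ultimately have "z [^] n = x" using inj x by blast
        then show "\<exists>z\<in>carrier ?E. z [^] n = x" using z(1) by blast
      qed
    next
      assume p: ?pure'
      show ?pure unfolding pure_subgroup_def
      proof (intro conjI allI impI equalityI)
        show "subgroup (?h ` carrier ?E) ?F" by (rule h.img_is_subgroup)
        fix n :: nat assume n: "0 < n"
        show "(\<lambda>x. x [^]\<^bsub>?F\<^esub> n) ` ?h ` carrier ?E \<subseteq> (\<lambda>x. x [^]\<^bsub>?F\<^esub> n) ` carrier ?F \<inter> ?h ` carrier ?E"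
        proof clarify
          fix z assume z: "z \<in> carrier ?E"
          have "?h z [^]\<^bsub>?F\<^esub> n = ?h (z [^]\<^bsub>?E\<^esub> n)" using h.hom_nat_pow[OF z] by simp
          then have "?h z [^]\<^bsub>?F\<^esub> n \<in> ?h ` carrier ?E" using h.G.nat_pow_closed[OF z, of n] by simp
          then show "?h z [^]\<^bsub>?F\<^esub> n \<in> (\<lambda>x. x [^]\<^bsub>?F\<^esub> n) ` carrier ?F \<inter> ?h ` carrier ?E"
            using h.hom_closed[OF z] by blast
        qed
        show "(\<lambda>x. x [^]\<^bsub>?F\<^esub> n) ` carrier ?F \<inter> ?h ` carrier ?E \<subseteq> (\<lambda>x. x [^]\<^bsub>?F\<^esub> n) ` ?h ` carrier ?E"
        proof
          fix a assume "a \<in> (\<lambda>x. x [^]\<^bsub>?F\<^esub> n) ` carrier ?F \<inter> ?h ` carrier ?E"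
          then obtain y x where y: "y \<in> carrier ?F" and x: "x \<in> carrier ?E"
            and eq: "y [^]\<^bsub>?F\<^esub> n = x \<otimes> f" and a: "a = x \<otimes> f" by blast
          then obtain z where z: "z \<in> carrier ?E" "z [^] n = x" using p n pf[OF y n] by metis
          then have "x \<otimes> f = ?h z [^]\<^bsub>?F\<^esub> n" using hp[OF z(1) n] by simp
          then show "a \<in> (\<lambda>x. x [^]\<^bsub>?F\<^esub> n) ` ?h ` carrier ?E" unfolding a using z(1) by blast
        qed
      qed
    qed
    ultimately show ?thesis by blast
  qed
  moreover have "e divides f \<longleftrightarrow> e \<otimes> f = f" if "e \<in> idempotents G" "f \<in> idempotents G" for e f
    using idempotent_divides_iff idempotents_closed that by blast
  ultimately show ?thesis unfolding groups_embed_purely_def by (simp cong: ball_cong)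
qed

end

section \<open>Supports in a monoid with (a) and (b)\<close>

locale periodic_refinement_monoid = comm_monoid G for G (structure) +
  assumes strongly_periodic: "strongly_periodic G"
    and conical: "conical G"
    and refinement: "refinement_monoid G"
    and embed: "groups_embed_purely G"
begin

definition supp :: "'a \<Rightarrow> 'a"
  where "supp x = (THE e. e \<in> idempotents G \<and> x \<in> carrier (idem_group G e))"

lemma supp_exists:
  assumes x: "x \<in> carrier G"
  shows "\<exists>e\<in>idempotents G. x \<in> carrier (idem_group G e)"
proof -
  obtain m :: nat where m: "0 < m" "x [^] (m + 1) = x"
    using strongly_periodic x unfolding strongly_periodic_def by blast
  \<comment> \<open>In additive notation, \<open>m x\<close> is the idempotent and
    \<open>(m - 1) x\<close> serves as the inverse of \<open>x\<close>.\<close>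
  define k where "k = m - 1"
  have mk: "m = k + 1" using m(1) by (simp add: k_def)
  have "x [^] m \<otimes> x [^] m = x [^] (m + m)" by (rule nat_pow_mult[OF x])
  also have "m + m = k + (m + 1)" by (simp add: mk)
  also have "x [^] (k + (m + 1)) = x [^] k \<otimes> x [^] (m + 1)" by (rule nat_pow_mult[symmetric, OF x])
  also have "\<dots> = x [^] m" using m(2) x by (simp add: mk)
  finally have e: "x [^] m \<in> idempotents G" using x by (simp add: idempotents_def)
  moreover have "x [^] m \<otimes> x = x" using m(2) by simp
  moreover have "x \<otimes> x [^] k = x [^] m" using x by (simp add: mk m_comm)
  ultimately have "x \<in> carrier (idem_group G (x [^] m))"
    unfolding idem_group_carrier_iff[OF e] using x by blast
  then show ?thesis using e by blast
qed

text \<open>\<open>e\<close> is absorbed by \<open>x\<close> and \<open>x\<close> divides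
  \<open>f\<close>, so \<open>e\<close> is absorbed by \<open>f\<close>. By symmetry the two
  idempotents coincide.\<close>

lemma supp_unique:
  assumes e: "e \<in> idempotents G" and f: "f \<in> idempotents G"
    and xe: "x \<in> carrier (idem_group G e)" and xf: "x \<in> carrier (idem_group G f)"
  shows "e = f"
proof -
  have "e \<otimes> f = f" if e: "e \<in> idempotents G" and f: "f \<in> idempotents G"
    and xe: "x \<in> carrier (idem_group G e)" and xf: "x \<in> carrier (idem_group G f)" for e f
  proof -
    obtain w where w: "w \<in> carrier G" "x \<otimes> w = f" using xf idem_group_carrier_iff[OF f] by blast
    have "e \<otimes> (x \<otimes> w) = e \<otimes> x \<otimes> w"
      by (rule m_assoc[symmetric]) (use idempotents_closed[OF e] idem_group_closed[OF e xe] w(1) in simp_all)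
    then show ?thesis unfolding w(2) idem_group_closed(2)[OF e xe] w(2) .
  qed
  from this[OF e f xe xf] this[OF f e xf xe] show ?thesis
    using m_comm e f idempotents_closed by metis
qed

lemma supp:
  assumes "x \<in> carrier G"
  shows "supp x \<in> idempotents G" "x \<in> carrier (idem_group G (supp x))"
proof -
  have "\<exists>!e. e \<in> idempotents G \<and> x \<in> carrier (idem_group G e)"
    using supp_exists[OF assms] supp_unique by blast
  from theI'[OF this] show "supp x \<in> idempotents G" "x \<in> carrier (idem_group G (supp x))"
    unfolding supp_def by blast+
qed

lemma supp_closed [simp]: "x \<in> carrier G \<Longrightarrow> supp x \<in> carrier G"
  using supp idempotents_closed by blast

lemma supp_idem [simp]: "x \<in> carrier G \<Longrightarrow> supp x \<otimes> supp x = supp x"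
  using supp idempotents_idem by blast

lemma supp_eqI: "e \<in> idempotents G \<Longrightarrow> x \<in> carrier (idem_group G e) \<Longrightarrow> supp x = e"
  using supp supp_unique idem_group_closed(1) by metis

lemma mem_idem_group_iff:
  "e \<in> idempotents G \<Longrightarrow> x \<in> carrier (idem_group G e) \<longleftrightarrow> x \<in> carrier G \<and> supp x = e"
  using supp supp_eqI idem_group_closed(1) by metis

lemma supp_of_idempotent: "e \<in> idempotents G \<Longrightarrow> supp e = e"
proof (rule supp_eqI)
  assume e: "e \<in> idempotents G"
  then interpret E: comm_group "idem_group G e" by (rule comm_group_idem_group)
  show "e \<in> carrier (idem_group G e)" using E.one_closed by simp
qed

lemma supp_absorb [simp]: "x \<in> carrier G \<Longrightarrow> supp x \<otimes> x = x"
  using supp idem_group_closed(2) by blast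

lemma supp_inverse: "x \<in> carrier G \<Longrightarrow> \<exists>w\<in>carrier G. x \<otimes> w = supp x"
  using supp idem_group_carrier_iff by blast

lemma supp_mult:
  assumes x: "x \<in> carrier G" and y: "y \<in> carrier G"
  shows "supp (x \<otimes> y) = supp x \<otimes> supp y"
proof (rule supp_eqI)
  show i: "supp x \<otimes> supp y \<in> idempotents G" using supp x y idempotents_mult by blast
  obtain w v where w: "w \<in> carrier G" "x \<otimes> w = supp x" and v: "v \<in> carrier G" "y \<otimes> v = supp y"
    using supp_inverse x y by metis
  have "supp x \<otimes> supp y \<otimes> (x \<otimes> y) = (supp x \<otimes> x) \<otimes> (supp y \<otimes> y)"
    using x y supp_closed[OF x] supp_closed[OF y] by (simp add: m_ac del: supp_absorb)
  then have 1: "supp x \<otimes> supp y \<otimes> (x \<otimes> y) = x \<otimes> y" using x y by simp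
  have "x \<otimes> y \<otimes> (w \<otimes> v) = (x \<otimes> w) \<otimes> (y \<otimes> v)" using x y w(1) v(1) by (simp add: m_ac)
  then have 2: "x \<otimes> y \<otimes> (w \<otimes> v) = supp x \<otimes> supp y" using w v by simp
  show "x \<otimes> y \<in> carrier (idem_group G (supp x \<otimes> supp y))"
    unfolding idem_group_carrier_iff[OF i] using x y w(1) v(1) 1 2 by blast
qed

lemma translation_inject:
  assumes "x \<in> carrier G" "y \<in> carrier G" "supp x = supp y" "f \<in> idempotents G" "supp x \<otimes> f = f"
    and "x \<otimes> f = y \<otimes> f"
  shows "x = y"
proof -
  have "y \<in> carrier (idem_group G (supp x))" using supp(2)[OF assms(2)] assms(3) by simp
  then show ?thesis
    using embed supp[OF assms(1)] assms(4-6) unfolding groups_embed_purely_iff by blast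
qed

lemma translation_pure:
  assumes "x \<in> carrier G" "y \<in> carrier G" "supp x \<otimes> supp y = supp y" "0 < n"
    and "y [^] (n::nat) = x \<otimes> supp y"
  shows "\<exists>z\<in>carrier G. supp z = supp x \<and> z [^] n = x"
proof -
  have "\<exists>z\<in>carrier (idem_group G (supp x)). z [^] n = x"
    using embed supp[OF assms(1)] supp[OF assms(2)] assms(3-5) unfolding groups_embed_purely_iff by blast
  then show ?thesis using mem_idem_group_iff[OF supp(1)[OF assms(1)]] by blast
qed

section \<open>Order ideals and their sums\<close>

lemma refine:
  assumes "x1 \<in> carrier G" "x2 \<in> carrier G" "y1 \<in> carrier G" "y2 \<in> carrier G" "x1 \<otimes> x2 = y1 \<otimes> y2"
  obtains z11 z12 z21 z22 where "z11 \<in> carrier G" "z12 \<in> carrier G" "z21 \<in> carrier G" "z22 \<in> carrier G"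
    "x1 = z11 \<otimes> z12" "x2 = z21 \<otimes> z22" "y1 = z11 \<otimes> z21" "y2 = z12 \<otimes> z22"
  using refinement assms unfolding refinement_monoid_def by metis

text \<open>The equivalence encodes at once closure under sums and downward closure for the
  algebraic preorder.\<close>

definition order_ideal :: "'a set \<Rightarrow> bool"
  where "order_ideal J \<longleftrightarrow> J \<subseteq> carrier G \<and> \<one> \<in> J \<and>
    (\<forall>x\<in>carrier G. \<forall>y\<in>carrier G. x \<otimes> y \<in> J \<longleftrightarrow> x \<in> J \<and> y \<in> J)"

text \<open>For an idempotent \<open>e\<close> this is its principal order ideal: \<open>x\<close>
  divides \<open>e\<close> exactly if \<open>e\<close> absorbs \<open>supp x\<close>.\<close>

definition below :: "'a \<Rightarrow> 'a set"
  where "below e = {x \<in> carrier G. supp x \<otimes> e = e}"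

lemma order_ideal_closed: "order_ideal J \<Longrightarrow> x \<in> J \<Longrightarrow> x \<in> carrier G"
  and order_ideal_one: "order_ideal J \<Longrightarrow> \<one> \<in> J"
  and order_ideal_mult_iff:
    "order_ideal J \<Longrightarrow> x \<in> carrier G \<Longrightarrow> y \<in> carrier G \<Longrightarrow> x \<otimes> y \<in> J \<longleftrightarrow> x \<in> J \<and> y \<in> J"
  unfolding order_ideal_def by blast+

text \<open>An element and its support divide each other.\<close>

lemma order_ideal_supp_iff:
  assumes J: "order_ideal J" and x: "x \<in> carrier G"
  shows "supp x \<in> J \<longleftrightarrow> x \<in> J"
proof
  obtain w where w: "w \<in> carrier G" "x \<otimes> w = supp x" using supp_inverse[OF x] by blast
  show "x \<in> J" if "supp x \<in> J" using order_ideal_mult_iff[OF J x w(1)] w(2) that by simp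
  show "supp x \<in> J" if "x \<in> J" using order_ideal_mult_iff[OF J supp_closed[OF x] x] x that by simp
qed

lemma order_ideal_below:
  assumes e: "e \<in> idempotents G"
  shows "order_ideal (below e)"
  unfolding order_ideal_def
proof (intro conjI ballI iffI)
  note ec = idempotents_closed[OF e]
  show "below e \<subseteq> carrier G" by (auto simp: below_def)
  show "\<one> \<in> below e" using ec supp_of_idempotent[OF one_idempotent] by (simp add: below_def)
  fix x y assume x: "x \<in> carrier G" and y: "y \<in> carrier G"
  note s = supp_closed[OF x] supp_closed[OF y]
  {
    assume "x \<otimes> y \<in> below e"
    then have *: "e = supp x \<otimes> (supp y \<otimes> e)"
      using x y ec s by (simp add: below_def supp_mult m_assoc)
    have absorb: "a \<otimes> e = e" if "e = a \<otimes> c" "a \<otimes> a = a" "a \<in> carrier G" "c \<in> carrier G" for a c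
      using m_assoc[of a a c] that by simp
    have "supp x \<otimes> e = e" by (rule absorb[OF *]) (use x s ec in simp_all)
    then show "x \<in> below e" using x by (simp add: below_def)
    have **: "e = supp y \<otimes> (supp x \<otimes> e)" by (rule trans[OF *]) (rule m_lcomm[OF s ec])
    have "supp y \<otimes> e = e" by (rule absorb[OF **]) (use y s ec in simp_all)
    then show "y \<in> below e" using y by (simp add: below_def)
  }
  assume "x \<in> below e \<and> y \<in> below e"
  then show "x \<otimes> y \<in> below e" using x y ec s by (simp add: below_def supp_mult m_assoc)
qed

lemma below_subset_order_ideal:
  assumes J: "order_ideal J" and e: "e \<in> J" "e \<in> idempotents G"
  shows "below e \<subseteq> J"
proof
  fix x assume "x \<in> below e"
  then have x: "x \<in> carrier G" "supp x \<otimes> e = e" by (simp_all add: below_def)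
  then show "x \<in> J"
    using order_ideal_mult_iff[OF J, of "supp x" e] order_ideal_supp_iff[OF J] e idempotents_closed by simp
qed

lemma order_ideal_trivial: "order_ideal {\<one>}"
proof -
  have "x \<otimes> y = \<one> \<longleftrightarrow> x = \<one> \<and> y = \<one>" if "x \<in> carrier G" "y \<in> carrier G" for x y
    using conical that unfolding conical_def by (metis l_one one_closed)
  then show ?thesis unfolding order_ideal_def by simp
qed

lemma order_ideal_Int: "order_ideal J \<Longrightarrow> order_ideal K \<Longrightarrow> order_ideal (J \<inter> K)"
  unfolding order_ideal_def by blast

lemma order_ideal_Inter:
  "(\<And>p. p \<in> P \<Longrightarrow> order_ideal (J p)) \<Longrightarrow> order_ideal (carrier G \<inter> (\<Inter>p\<in>P. J p))"
  unfolding order_ideal_def by auto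

lemma mem_set_mult: "a \<in> J <#> K \<longleftrightarrow> (\<exists>x\<in>J. \<exists>y\<in>K. a = x \<otimes> y)"
  unfolding set_mult_def by blast

text \<open>Refinement is what makes the sum downward closed: when \<open>x \<otimes> y\<close>
  splits into a part in \<open>J\<close> and a part in \<open>K\<close>, the refinement splits
  \<open>x\<close> and \<open>y\<close> in the same way.\<close>

lemma order_ideal_set_mult:
  assumes J: "order_ideal J" and K: "order_ideal K"
  shows "order_ideal (J <#> K)"
  unfolding order_ideal_def
proof (intro conjI ballI iffI)
  note c = order_ideal_closed[OF J] order_ideal_closed[OF K]
  show "J <#> K \<subseteq> carrier G" using c by (auto simp: mem_set_mult)
  show "\<one> \<in> J <#> K" unfolding mem_set_mult
    by (rule bexI[OF bexI[OF _ order_ideal_one[OF K]] order_ideal_one[OF J]]) simp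
  fix x y assume x: "x \<in> carrier G" and y: "y \<in> carrier G"
  {
    assume "x \<otimes> y \<in> J <#> K"
    then obtain a b where ab: "a \<in> J" "b \<in> K" "x \<otimes> y = a \<otimes> b" unfolding mem_set_mult by blast
    obtain z11 z12 z21 z22 where z: "z11 \<in> carrier G" "z12 \<in> carrier G" "z21 \<in> carrier G" "z22 \<in> carrier G"
      and eq: "x = z11 \<otimes> z12" "y = z21 \<otimes> z22" "a = z11 \<otimes> z21" "b = z12 \<otimes> z22"
      by (rule refine[OF x y c(1)[OF ab(1)] c(2)[OF ab(2)] ab(3)])
    have "z11 \<in> J \<and> z21 \<in> J" "z12 \<in> K \<and> z22 \<in> K"
      using ab(1,2) order_ideal_mult_iff[OF J z(1,3)] order_ideal_mult_iff[OF K z(2,4)]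
      unfolding eq by simp_all
    then show "x \<in> J <#> K" "y \<in> J <#> K" unfolding mem_set_mult eq by blast+
  }
  assume "x \<in> J <#> K \<and> y \<in> J <#> K"
  then obtain a b a' b' where ab: "a \<in> J" "b \<in> K" "x = a \<otimes> b" "a' \<in> J" "b' \<in> K" "y = a' \<otimes> b'"
    unfolding mem_set_mult by blast
  then have "x \<otimes> y = (a \<otimes> a') \<otimes> (b \<otimes> b')" using c by (simp add: m_ac)
  moreover have "a \<otimes> a' \<in> J" "b \<otimes> b' \<in> K"
    using ab c by (simp_all add: order_ideal_mult_iff[OF J] order_ideal_mult_iff[OF K])
  ultimately show "x \<otimes> y \<in> J <#> K" unfolding mem_set_mult by blast
qed

lemma set_mult_contains:
  assumes "order_ideal J" "order_ideal K"
  shows "J \<subseteq> J <#> K" "K \<subseteq> J <#> K"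
proof -
  show "J \<subseteq> J <#> K"
  proof
    fix x assume x: "x \<in> J"
    have "x = x \<otimes> \<one>" using order_ideal_closed[OF assms(1) x] by simp
    then show "x \<in> J <#> K" unfolding mem_set_mult using x order_ideal_one[OF assms(2)] by blast
  qed
  show "K \<subseteq> J <#> K"
  proof
    fix x assume x: "x \<in> K"
    have "x = \<one> \<otimes> x" using order_ideal_closed[OF assms(2) x] by simp
    then show "x \<in> J <#> K" unfolding mem_set_mult using x order_ideal_one[OF assms(1)] by blast
  qed
qed

text \<open>Summands of an element of \<open>I\<close> lie in \<open>I\<close>, so a decomposition
  along \<open>J\<close> and \<open>K\<close> is already one along the intersections. This is the
  distributivity of the lattice of order ideals.\<close>

lemma order_ideal_Int_set_mult:
  assumes I: "order_ideal I" and J: "order_ideal J" and K: "order_ideal K"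
  shows "I \<inter> (J <#> K) \<subseteq> (I \<inter> J) <#> (I \<inter> K)"
proof
  fix x assume "x \<in> I \<inter> (J <#> K)"
  then obtain a b where ab: "a \<in> J" "b \<in> K" "x = a \<otimes> b" "x \<in> I" unfolding mem_set_mult Int_iff by blast
  then have "a \<in> I \<and> b \<in> I"
    using order_ideal_mult_iff[OF I order_ideal_closed[OF J ab(1)] order_ideal_closed[OF K ab(2)]] by simp
  then show "x \<in> (I \<inter> J) <#> (I \<inter> K)" unfolding mem_set_mult using ab by blast
qed

lemma set_mult_subset:
  assumes "order_ideal I" "J \<subseteq> I" "K \<subseteq> I"
  shows "J <#> K \<subseteq> I"
proof
  fix x assume "x \<in> J <#> K"
  then obtain a b where ab: "a \<in> J" "b \<in> K" "x = a \<otimes> b" unfolding mem_set_mult by blast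
  then have "a \<in> I" "b \<in> I" using assms by blast+
  then show "x \<in> I"
    unfolding ab(3) using order_ideal_mult_iff[OF assms(1)] order_ideal_closed[OF assms(1)] by simp
qed

section \<open>Order ideals as subgroups of the group of a top idempotent\<close>

definition translate :: "'a \<Rightarrow> 'a set \<Rightarrow> 'a set"
  where "translate t J = (\<lambda>x. x \<otimes> t) ` J"

lemma translate_mult:
  assumes "t \<in> idempotents G" "x \<in> carrier G" "y \<in> carrier G"
  shows "x \<otimes> y \<otimes> t = (x \<otimes> t) \<otimes> (y \<otimes> t)"
proof -
  have t: "t \<in> carrier G" "t \<otimes> t = t" using assms(1) by (simp_all add: idempotents_def)
  have "(x \<otimes> t) \<otimes> (y \<otimes> t) = x \<otimes> y \<otimes> (t \<otimes> t)" using assms(2,3) t(1) by (simp add: m_ac)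
  then show ?thesis using t by simp
qed

lemma below_translate:
  assumes t: "t \<in> idempotents G" and x: "x \<in> below t"
  shows "x \<otimes> t \<in> carrier (idem_group G t)"
  using assms supp_mult supp_of_idempotent idempotents_closed
  by (simp add: mem_idem_group_iff below_def)

text \<open>The local inverse \<open>w\<close> of an element of \<open>J\<close> divides the support
  of that element and hence lies in \<open>J\<close>; translation turns it into the inverse in the
  group of \<open>t\<close>.\<close>

lemma translate_subgroup:
  assumes t: "t \<in> idempotents G" and J: "order_ideal J" and Jt: "J \<subseteq> below t"
  shows "subgroup (translate t J) (idem_group G t)"
proof -
  interpret T: comm_group "idem_group G t" by (rule comm_group_idem_group[OF t])
  note tc = idempotents_closed[OF t]
  show ?thesis
  proof (rule T.subgroupI)
    show "translate t J \<subseteq> carrier (idem_group G t)" unfolding translate_def using below_translate[OF t] Jt by blast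
    show "translate t J \<noteq> {}" unfolding translate_def using order_ideal_one[OF J] by blast
    fix a assume "a \<in> translate t J"
    then obtain x where x: "x \<in> J" "a = x \<otimes> t" unfolding translate_def by blast
    have xc: "x \<in> carrier G" "x \<in> below t" using x(1) Jt order_ideal_closed[OF J] by blast+
    obtain w where w: "w \<in> carrier G" "x \<otimes> w = supp x" using supp_inverse[OF xc(1)] by blast
    have "w \<in> J" using w(2) order_ideal_supp_iff[OF J xc(1)] order_ideal_mult_iff[OF J xc(1) w(1)] x(1) by simp
    have "w \<otimes> t \<otimes> a = supp x \<otimes> t" unfolding x(2)
      using translate_mult[OF t w(1) xc(1)] w(2) m_comm[OF xc(1) w(1)] by simp
    then have "w \<otimes> t \<otimes> a = t" using xc(2) by (simp add: below_def)
    then have "inv\<^bsub>idem_group G t\<^esub> a = w \<otimes> t"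
      using below_translate[OF t] Jt \<open>w \<in> J\<close> x by (intro T.inv_equality) auto
    then show "inv\<^bsub>idem_group G t\<^esub> a \<in> translate t J" unfolding translate_def using \<open>w \<in> J\<close> by blast
    fix b assume "b \<in> translate t J"
    then obtain y where y: "y \<in> J" "b = y \<otimes> t" unfolding translate_def by blast
    have "a \<otimes> b = (x \<otimes> y) \<otimes> t" using x y translate_mult[OF t] order_ideal_closed[OF J] by simp
    moreover have "x \<otimes> y \<in> J" using x y order_ideal_closed[OF J] by (simp add: order_ideal_mult_iff[OF J])
    ultimately show "a \<otimes>\<^bsub>idem_group G t\<^esub> b \<in> translate t J" unfolding translate_def by simp
  qed
qed

text \<open>A root of a single \<open>x \<otimes> t\<close> concerns only the idempotents
  \<open>supp x\<close> and \<open>t\<close>. Condition (b) yields a root with the support of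
  \<open>x\<close>, and this support keeps it inside \<open>J\<close>.\<close>

lemma translate_pure:
  assumes t: "t \<in> idempotents G" and J: "order_ideal J" and Jt: "J \<subseteq> below t"
    and g: "g \<in> carrier (idem_group G t)" and n: "0 < (n::nat)"
    and gn: "g [^]\<^bsub>idem_group G t\<^esub> n \<in> translate t J"
  shows "\<exists>v\<in>translate t J. v [^]\<^bsub>idem_group G t\<^esub> n = g [^]\<^bsub>idem_group G t\<^esub> n"
proof -
  obtain x where x: "x \<in> J" "g [^]\<^bsub>idem_group G t\<^esub> n = x \<otimes> t" using gn unfolding translate_def by blast
  have xc: "x \<in> carrier G" "supp x \<otimes> t = t" using x(1) Jt by (auto simp: below_def)
  have gc: "g \<in> carrier G" "supp g = t" using g mem_idem_group_iff[OF t] by simp_all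
  have "g [^] n = x \<otimes> supp g" using idem_group_pow[OF t g n] x(2) gc(2) by simp
  then obtain z where z: "z \<in> carrier G" "supp z = supp x" "z [^] n = x"
    using translation_pure[OF xc(1) gc(1) _ n] xc(2) gc(2) by auto
  have zJ: "z \<in> J" using order_ideal_supp_iff[OF J z(1)] order_ideal_supp_iff[OF J xc(1)] z(2) x(1) by simp
  interpret h: group_hom "idem_group G (supp z)" "idem_group G t" "\<lambda>x. x \<otimes> t"
    using translation_hom[OF supp(1)[OF z(1)] t] xc(2) z(2) by simp
  have "(z \<otimes> t) [^]\<^bsub>idem_group G t\<^esub> n = x \<otimes> t"
    using h.hom_nat_pow[OF supp(2)[OF z(1)], of n] idem_group_pow[OF supp[OF z(1)] n] z(3) by simp
  then show ?thesis unfolding translate_def x(2) by (intro bexI[OF _ imageI[OF zJ]])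
qed

lemma translate_set_mult:
  assumes t: "t \<in> idempotents G" and J: "order_ideal J" and K: "order_ideal K"
  shows "translate t (J <#> K) = translate t J <#>\<^bsub>idem_group G t\<^esub> translate t K"
proof -
  have *: "x \<otimes> y \<otimes> t = (x \<otimes> t) \<otimes> (y \<otimes> t)" if "x \<in> J" "y \<in> K" for x y
    using translate_mult[OF t order_ideal_closed[OF J that(1)] order_ideal_closed[OF K that(2)]] .
  show ?thesis
  proof (intro equalityI subsetI)
    fix a assume "a \<in> translate t (J <#> K)"
    then obtain x y where xy: "x \<in> J" "y \<in> K" "a = x \<otimes> y \<otimes> t"
      unfolding translate_def by (auto simp: mem_set_mult)
    then show "a \<in> translate t J <#>\<^bsub>idem_group G t\<^esub> translate t K"
      unfolding set_mult_def translate_def mult_idem_group using *[OF xy(1,2)] by blast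
  next
    fix a assume "a \<in> translate t J <#>\<^bsub>idem_group G t\<^esub> translate t K"
    then obtain x y where xy: "x \<in> J" "y \<in> K" "a = (x \<otimes> t) \<otimes> (y \<otimes> t)"
      unfolding set_mult_def translate_def mult_idem_group by blast
    then have "a = x \<otimes> y \<otimes> t" using *[OF xy(1,2)] by simp
    moreover have "x \<otimes> y \<in> J <#> K" unfolding mem_set_mult using xy(1,2) by blast
    ultimately have "a = x \<otimes> y \<otimes> t" "x \<otimes> y \<in> J <#> K" .
    then show "a \<in> translate t (J <#> K)" unfolding translate_def by blast
  qed
qed

text \<open>Refining \<open>x + supp y = y + supp x\<close> produces the common part of \<open>x\<close> and \<open>y\<close>.\<close>

lemma translate_Int:
  assumes t: "t \<in> idempotents G" and J: "order_ideal J" "J \<subseteq> below t"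
    and K: "order_ideal K" "K \<subseteq> below t"
  shows "translate t J \<inter> translate t K \<subseteq> translate t (J \<inter> K)"
proof
  note tc = idempotents_closed[OF t]
  fix a assume "a \<in> translate t J \<inter> translate t K"
  then obtain x y where x: "x \<in> J" "a = x \<otimes> t" and y: "y \<in> K" "a = y \<otimes> t" unfolding translate_def by blast
  have xc: "x \<in> carrier G" "supp x \<otimes> t = t" and yc: "y \<in> carrier G" "supp y \<otimes> t = t"
    using x(1) y(1) J(2) K(2) by (auto simp: below_def)
  note sc = supp_closed[OF xc(1)] supp_closed[OF yc(1)]
  have "x \<otimes> supp y \<otimes> t = a" "y \<otimes> supp x \<otimes> t = a"
    using x(2) y(2) xc yc tc sc by (simp_all add: m_assoc)
  moreover have "supp (x \<otimes> supp y) = supp x \<otimes> supp y" "supp (y \<otimes> supp x) = supp x \<otimes> supp y"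
    using supp_of_idempotent[OF supp(1)] xc(1) yc(1) sc by (simp_all add: supp_mult m_comm)
  moreover have "supp x \<otimes> supp y \<otimes> t = t" using xc yc sc tc by (simp add: m_assoc)
  \<comment> \<open>Both sides have the support \<open>supp x \<otimes> supp y\<close> and the same
    translate \<open>a\<close>.\<close>
  ultimately have "x \<otimes> supp y = y \<otimes> supp x"
    using xc(1) yc(1) sc t by - (rule translation_inject[where f = t], simp_all)
  then obtain z11 z12 z21 z22 where z: "z11 \<in> carrier G" "z12 \<in> carrier G" "z21 \<in> carrier G" "z22 \<in> carrier G"
    and eq: "x = z11 \<otimes> z12" "supp y = z21 \<otimes> z22" "y = z11 \<otimes> z21" "supp x = z12 \<otimes> z22"
    using refine[of x "supp y" y "supp x"] xc(1) yc(1) sc by metis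
  have sJ: "supp x \<in> J" and sK: "supp y \<in> K"
    using order_ideal_supp_iff[OF J(1) xc(1)] order_ideal_supp_iff[OF K(1) yc(1)] x(1) y(1) by simp_all
  have "z11 \<otimes> z12 \<in> J" "z12 \<otimes> z22 \<in> J" "z11 \<otimes> z21 \<in> K" "z21 \<otimes> z22 \<in> K"
    using x(1) y(1) sJ sK eq by simp_all
  then have zJ: "z11 \<in> J" "z22 \<in> J" and zK: "z11 \<in> K" "z22 \<in> K"
    using z by (simp_all add: order_ideal_mult_iff[OF J(1)] order_ideal_mult_iff[OF K(1)])
  \<comment> \<open>In the group of \<open>t\<close> the translates of \<open>z12\<close> and
    \<open>z22\<close> are inverse to each other, since \<open>z12 \<otimes> z22\<close> is
    \<open>supp x\<close>. Thus \<open>z11 \<otimes> w\<close> has the same translate as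
    \<open>z11 \<otimes> z12 = x\<close>, while both of its summands lie in \<open>J\<close> and in
    \<open>K\<close>.\<close>
  obtain w where w: "w \<in> carrier G" "z22 \<otimes> w = supp z22" using supp_inverse[OF z(4)] by blast
  have JK: "order_ideal (J \<inter> K)" using J(1) K(1) by (rule order_ideal_Int)
  have "z22 \<otimes> w \<in> J \<inter> K" using order_ideal_supp_iff[OF JK z(4)] zJ zK w by simp
  then have wJK: "w \<in> J \<inter> K" using order_ideal_mult_iff[OF JK z(4) w(1)] by simp
  have zt: "z22 \<otimes> w \<otimes> t = t" unfolding w(2) using zJ(2) J(2) by (auto simp: below_def)
  have xt: "z12 \<otimes> z22 \<otimes> t = t" using xc(2) eq(4) by simp
  have "z11 \<otimes> w \<otimes> t = z11 \<otimes> w \<otimes> (z12 \<otimes> z22 \<otimes> t)" using xt by simp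
  also have "\<dots> = z11 \<otimes> z12 \<otimes> (z22 \<otimes> w \<otimes> t)" using z w(1) tc by (simp add: m_ac)
  also have "\<dots> = a" using zt x(2) eq by simp
  finally have "a = z11 \<otimes> w \<otimes> t" by simp
  moreover have "z11 \<otimes> w \<in> J \<inter> K" using order_ideal_mult_iff[OF JK z(1) w(1)] zJ zK wJK by simp
  ultimately show "a \<in> translate t (J \<inter> K)" unfolding translate_def by blast
qed

section \<open>Finite sums of order ideals and finite distributivity\<close>

definition ideal_sum :: "('i \<Rightarrow> 'a set) \<Rightarrow> 'i set \<Rightarrow> 'a set"
  where "ideal_sum J D = {finprod G g D | g. g \<in> Pi D J}"

lemma ideal_sum_empty [simp]: "ideal_sum J {} = {\<one>}"
  unfolding ideal_sum_def by simp

lemma ideal_sum_cong: "(\<And>d. d \<in> D \<Longrightarrow> J d = K d) \<Longrightarrow> ideal_sum J D = ideal_sum K D"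
proof -
  assume "\<And>d. d \<in> D \<Longrightarrow> J d = K d"
  then have "Pi D J = Pi D K" by (simp add: Pi_def)
  then show ?thesis unfolding ideal_sum_def by simp
qed

lemma ideal_sum_insert:
  assumes "finite D" "m \<notin> D" "\<And>d. d \<in> insert m D \<Longrightarrow> order_ideal (J d)"
  shows "ideal_sum J (insert m D) = J m <#> ideal_sum J D"
proof (intro equalityI subsetI)
  have c: "g \<in> D \<rightarrow> carrier G" if "g \<in> Pi D J" for g
    using that assms(3) order_ideal_closed by fastforce
  have cm: "x \<in> carrier G" if "x \<in> J m" for x using that assms(3) order_ideal_closed by blast
  {
    fix x assume "x \<in> ideal_sum J (insert m D)"
    then obtain g where g: "x = finprod G g (insert m D)" "g \<in> Pi (insert m D) J"
      unfolding ideal_sum_def by blast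
    then have "x = g m \<otimes> finprod G g D" using assms(1,2) c[of g] cm by simp
    then show "x \<in> J m <#> ideal_sum J D" unfolding mem_set_mult ideal_sum_def using g(2) by blast
  }
  fix x assume "x \<in> J m <#> ideal_sum J D"
  then obtain a g where g: "a \<in> J m" "x = a \<otimes> finprod G g D" "g \<in> Pi D J"
    unfolding mem_set_mult ideal_sum_def by blast
  let ?g = "g(m := a)"
  have "finprod G ?g D = finprod G g D" using assms(2) c[OF g(3)] by (intro finprod_cong') auto
  then have "x = finprod G ?g (insert m D)"
    using assms(1,2) c[OF g(3)] cm[OF g(1)] g(2) by (subst finprod_insert) (auto simp: Pi_iff)
  moreover have "?g \<in> Pi (insert m D) J" using g by auto
  ultimately show "x \<in> ideal_sum J (insert m D)" unfolding ideal_sum_def by blast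
qed

lemma order_ideal_ideal_sum:
  "finite D \<Longrightarrow> (\<And>d. d \<in> D \<Longrightarrow> order_ideal (J d)) \<Longrightarrow> order_ideal (ideal_sum J D)"
proof (induction D rule: finite_induct)
  case empty
  then show ?case by (simp add: order_ideal_trivial)
next
  case (insert m D)
  have "order_ideal (J m <#> ideal_sum J D)"
    by (rule order_ideal_set_mult) (use insert in blast)+
  then show ?case using ideal_sum_insert[OF insert.hyps insert.prems] by simp
qed

lemma ideal_sum_least:
  assumes "finite D" "\<And>d. d \<in> D \<Longrightarrow> order_ideal (J d)" "\<And>d. d \<in> D \<Longrightarrow> J d \<subseteq> K" "order_ideal K"
  shows "ideal_sum J D \<subseteq> K"
  using assms(1,2,3)
proof (induction D)
  case empty
  then show ?case using order_ideal_one[OF assms(4)] by simp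
next
  case (insert m D)
  have "J m <#> ideal_sum J D \<subseteq> K"
    by (rule set_mult_subset[OF assms(4)]) (use insert in blast)+
  then show ?case using ideal_sum_insert[OF insert.hyps insert.prems(1)] by simp
qed

lemma ideal_sum_contains:
  assumes "finite D" "\<And>d. d \<in> D \<Longrightarrow> order_ideal (J d)" "d \<in> D"
  shows "J d \<subseteq> ideal_sum J D"
proof -
  have D: "insert d (D - {d}) = D" using assms(3) by blast
  have "J d \<subseteq> J d <#> ideal_sum J (D - {d})"
    by (rule set_mult_contains(1)[OF _ order_ideal_ideal_sum]) (use assms in blast)+
  also have "\<dots> = ideal_sum J (insert d (D - {d}))"
    by (rule ideal_sum_insert[symmetric]) (use assms in blast)+
  finally show ?thesis unfolding D .
qed

lemma set_mult_assoc_monoid: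
  assumes "I \<subseteq> carrier G" "J \<subseteq> carrier G" "K \<subseteq> carrier G"
  shows "I <#> J <#> K = I <#> (J <#> K)"
proof -
  have "I <#> J <#> K = (\<Union>x\<in>I. \<Union>y\<in>J. \<Union>z\<in>K. {x \<otimes> y \<otimes> z})" unfolding set_mult_def by simp
  also have "\<dots> = (\<Union>x\<in>I. \<Union>y\<in>J. \<Union>z\<in>K. {x \<otimes> (y \<otimes> z)})"
    by (intro SUP_cong refl arg_cong[where f = "\<lambda>a. {a}"] m_assoc) (use assms in blast)+
  also have "\<dots> = I <#> (J <#> K)" unfolding set_mult_def by simp
  finally show ?thesis .
qed
lemma set_mult_ac:
  assumes "I \<subseteq> carrier G" "J \<subseteq> carrier G" "K \<subseteq> carrier G"
  shows "I <#> J <#> K = J <#> (I <#> K)" "I <#> (J <#> K) = J <#> (I <#> K)"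
proof -
  have "(\<Union>x\<in>I. \<Union>y\<in>J. {x \<otimes> y}) = (\<Union>x\<in>I. \<Union>y\<in>J. {y \<otimes> x})"
    by (intro SUP_cong refl arg_cong[where f = "\<lambda>a. {a}"] m_comm) (use assms in blast)+
  also have "\<dots> = (\<Union>y\<in>J. \<Union>x\<in>I. {y \<otimes> x})" by (rule SUP_commute)
  finally have "I <#> J = J <#> I" unfolding set_mult_def .
  then show "I <#> J <#> K = J <#> (I <#> K)" using set_mult_assoc_monoid[OF assms(2,1,3)] by simp
  then show "I <#> (J <#> K) = J <#> (I <#> K)" using set_mult_assoc_monoid[OF assms] by simp
qed

text \<open>The dual distributive law. The part \<open>a\<close> already found in the intersection
  divides \<open>x\<close> and so splits again along \<open>J p\<close> and \<open>K\<close>; its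
  part in \<open>J p\<close> divides \<open>a\<close> and stays in the old intersection. The factor
  \<open>carrier G\<close> is the value of the empty intersection.\<close>

lemma Inter_set_mult:
  assumes "finite P" "\<And>p. p \<in> P \<Longrightarrow> order_ideal (J p)" "order_ideal K" "x \<in> carrier G"
    and "\<And>p. p \<in> P \<Longrightarrow> x \<in> J p <#> K"
  shows "x \<in> (carrier G \<inter> (\<Inter>p\<in>P. J p)) <#> K"
  using assms(1,2,5)
proof (induction P)
  case empty
  have "x = x \<otimes> \<one>" using assms(4) by simp
  then have "x \<in> carrier G <#> K" unfolding mem_set_mult using order_ideal_one[OF assms(3)] assms(4) by blast
  then show ?case by simp
next
  case (insert p P)
  have o: "order_ideal (carrier G \<inter> (\<Inter>p\<in>P. J p))" using insert.prems(1) by (intro order_ideal_Inter) blast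
  have "x \<in> (carrier G \<inter> (\<Inter>p\<in>P. J p)) <#> K"
    by (rule insert.IH) (use insert.prems in simp_all)
  then obtain a c where a: "a \<in> carrier G \<inter> (\<Inter>p\<in>P. J p)" "c \<in> K" "x = a \<otimes> c"
    unfolding mem_set_mult by blast
  have cc: "c \<in> carrier G" using a(2) assms(3) order_ideal_closed by blast
  have "a \<in> J p <#> K"
    using insert.prems(2)[of p] a(1,3) cc insert.prems(1) assms(3)
      order_ideal_mult_iff[OF order_ideal_set_mult[of "J p" K], of a c] by simp
  then obtain b d where b: "b \<in> J p" "d \<in> K" "a = b \<otimes> d" unfolding mem_set_mult by blast
  have bc: "b \<in> carrier G" "d \<in> carrier G"
    using b insert.prems(1) assms(3) order_ideal_closed by blast+
  have "b \<in> carrier G \<inter> (\<Inter>p\<in>P. J p)" using order_ideal_mult_iff[OF o bc] a(1) b(3) by simp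
  moreover have "d \<otimes> c \<in> K" using order_ideal_mult_iff[OF assms(3) bc(2) cc] a(2) b(2) by simp
  moreover have "x = b \<otimes> (d \<otimes> c)" using a(3) b(3) bc cc by (simp add: m_assoc)
  moreover have "b \<in> carrier G \<inter> (\<Inter>p\<in>insert p P. J p)" using b(1) calculation(1) by simp
  ultimately show ?case unfolding mem_set_mult by blast
qed

text \<open>Finite distributivity with choice functions \<open>c\<close>. The extra summand
  \<open>K\<close> carries the ideal chosen for one index while the induction treats the
  others.\<close>

lemma ideal_sum_Inter:
  assumes "finite D" "\<And>m. m \<in> D \<Longrightarrow> finite (P m)" "\<And>m p. m \<in> D \<Longrightarrow> p \<in> P m \<Longrightarrow> order_ideal (J p)"
    and "order_ideal K" "x \<in> carrier G"
    and "\<And>c. c \<in> Pi D P \<Longrightarrow> x \<in> ideal_sum (\<lambda>m. J (c m)) D <#> K"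
  shows "x \<in> ideal_sum (\<lambda>m. carrier G \<inter> (\<Inter>p\<in>P m. J p)) D <#> K"
  using assms
proof (induction D arbitrary: K)
  case empty
  then show ?case by simp
next
  case (insert m D)
  let ?I = "\<lambda>m. carrier G \<inter> (\<Inter>p\<in>P m. J p)"
  have oI: "order_ideal (?I d)" if "d \<in> insert m D" for d
    using that insert.prems(2) by (intro order_ideal_Inter) blast
  have oS: "order_ideal (ideal_sum ?I D)" using insert.hyps(1) oI by (intro order_ideal_ideal_sum) auto
  have sub: "J' \<subseteq> carrier G" if "order_ideal J'" for J' using that order_ideal_closed by blast
  have "x \<in> J p <#> (ideal_sum ?I D <#> K)" if p: "p \<in> P m" for p
  proof -
    have op: "order_ideal (J p)" using insert.prems(2) p by blast
    have "x \<in> ideal_sum ?I D <#> (J p <#> K)"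
    proof (rule insert.IH)
      show "order_ideal (J p <#> K)" using op insert.prems(3) by (rule order_ideal_set_mult)
      fix c assume c: "c \<in> Pi D P"
      have oc: "order_ideal (J (c d))" if "d \<in> D" for d using insert.prems(2) c that by blast
      have "c(m := p) \<in> Pi (insert m D) P" using c p by auto
      then have "x \<in> ideal_sum (\<lambda>d. J ((c(m := p)) d)) (insert m D) <#> K" by (rule insert.prems(5))
      also have "ideal_sum (\<lambda>d. J ((c(m := p)) d)) (insert m D) =
          J p <#> ideal_sum (\<lambda>d. J ((c(m := p)) d)) D"
        by (subst ideal_sum_insert) (use insert.hyps op oc in auto)
      also have "ideal_sum (\<lambda>d. J ((c(m := p)) d)) D = ideal_sum (\<lambda>d. J (c d)) D"
        using insert.hyps(2) by (intro ideal_sum_cong) auto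
      also have "J p <#> ideal_sum (\<lambda>d. J (c d)) D <#> K = ideal_sum (\<lambda>d. J (c d)) D <#> (J p <#> K)"
        using sub op insert.prems(3) order_ideal_ideal_sum[OF insert.hyps(1), of "\<lambda>d. J (c d)"] oc
        by (intro set_mult_ac) auto
      finally show "x \<in> ideal_sum (\<lambda>d. J (c d)) D <#> (J p <#> K)" .
    qed (use insert.prems in auto)
    also have "\<dots> = J p <#> (ideal_sum ?I D <#> K)"
      using sub op oS insert.prems(3) by (intro set_mult_ac) auto
    finally show ?thesis .
  qed
  then have "x \<in> ?I m <#> (ideal_sum ?I D <#> K)"
    using insert.prems by (intro Inter_set_mult order_ideal_set_mult oS) auto
  also have "\<dots> = (?I m <#> ideal_sum ?I D) <#> K"
    by (rule set_mult_assoc_monoid[symmetric]) (use sub oI oS insert.prems(3) in auto)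
  also have "?I m <#> ideal_sum ?I D = ideal_sum ?I (insert m D)"
    by (rule ideal_sum_insert[symmetric, OF insert.hyps oI])
  finally show ?case .
qed

end

section \<open>Stratification along a finite set of idempotents\<close>

context comm_group
begin

lemma int_comb_times_insert:
  assumes "finite D" "finite S" "m \<notin> D" "w \<in> insert m D \<times> S \<rightarrow> carrier G"
  shows "int_comb G w c (insert m D \<times> S) =
    int_comb G (\<lambda>x. w (m, x)) (\<lambda>x. c (m, x)) S \<otimes> int_comb G w c (D \<times> S)"
proof -
  have w: "w (m, x) \<in> carrier G" if "x \<in> S" for x using assms(4) that by blast
  have "insert m D \<times> S = Pair m ` S \<union> D \<times> S" by blast
  moreover have "finprod G (\<lambda>q. w q [^] c q) (Pair m ` S) = finprod G (\<lambda>x. w (m, x) [^] c (m, x)) S"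
    by (rule finprod_reindex) (use w in \<open>auto intro: inj_onI\<close>)
  moreover have "finprod G (\<lambda>q. w q [^] c q) (Pair m ` S \<union> D \<times> S) =
      finprod G (\<lambda>q. w q [^] c q) (Pair m ` S) \<otimes> finprod G (\<lambda>q. w q [^] c q) (D \<times> S)"
    by (rule finprod_Un_disjoint) (use assms in \<open>auto simp: Pi_iff\<close>)
  ultimately show ?thesis unfolding int_comb_def by simp
qed

lemma int_comb_one:
  assumes "\<And>x. x \<in> S \<Longrightarrow> w x [^] c x = \<one>"
  shows "int_comb G w c S = \<one>"
  unfolding int_comb_def using assms by (rule finprod_one_eqI)

end

context periodic_refinement_monoid
begin

lemma order_ideal_finprod_iff:
  assumes J: "order_ideal J" and "finite D" "g \<in> D \<rightarrow> carrier G"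
  shows "finprod G g D \<in> J \<longleftrightarrow> (\<forall>d\<in>D. g d \<in> J)"
  using assms(2,3)
proof (induction D)
  case empty
  then show ?case using order_ideal_one[OF J] by simp
next
  case (insert d D)
  have g: "g \<in> D \<rightarrow> carrier G" "g d \<in> carrier G" using insert.prems by auto
  then have "finprod G g (insert d D) \<in> J \<longleftrightarrow> g d \<in> J \<and> finprod G g D \<in> J"
    using insert.hyps order_ideal_mult_iff[OF J g(2) finprod_closed[OF g(1)]] by simp
  then show ?case using insert.IH[OF g(1)] by simp
qed

lemma finprod_idempotents:
  assumes "finite D" "g \<in> D \<rightarrow> idempotents G"
  shows "finprod G g D \<in> idempotents G"
  using assms
proof (induction D)
  case empty
  then show ?case by (simp add: one_idempotent)
next
  case (insert d D)
  then have "g \<in> D \<rightarrow> carrier G" "g d \<in> carrier G" using idempotents_closed by auto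
  then show ?case using insert idempotents_mult by simp
qed

lemma idempotent_mem_below: "e \<in> idempotents G \<Longrightarrow> e \<in> below e"
  unfolding below_def using supp_of_idempotent idempotents_closed idempotents_idem by simp

lemma idempotent_mem_below_iff:
  "e \<in> idempotents G \<Longrightarrow> f \<in> idempotents G \<Longrightarrow> e \<in> below f \<longleftrightarrow> e \<otimes> f = f"
  unfolding below_def using supp_of_idempotent idempotents_closed by simp

lemma idempotent_finprod_absorb:
  assumes "finite D" "g \<in> D \<rightarrow> idempotents G" "d \<in> D"
  shows "g d \<otimes> finprod G g D = finprod G g D"
proof -
  have u: "finprod G g D \<in> idempotents G" by (rule finprod_idempotents[OF assms(1,2)])
  have "g \<in> D \<rightarrow> carrier G" using assms(2) idempotents_closed by auto
  then have "g d \<in> below (finprod G g D)"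
    using order_ideal_finprod_iff[OF order_ideal_below[OF u] assms(1)] idempotent_mem_below[OF u] assms(3)
    by blast
  then show ?thesis using idempotent_mem_below_iff[OF _ u] assms(2,3) by blast
qed

end

locale idempotent_stratification = periodic_refinement_monoid +
  fixes E and t
  assumes E_finite: "finite E" and E_idem: "E \<subseteq> idempotents G" and E_one: "\<one> \<in> E"
    and E_mult: "e \<in> E \<Longrightarrow> f \<in> E \<Longrightarrow> e \<otimes> f \<in> E"
    and t_mem: "t \<in> E" and t_top: "e \<in> E \<Longrightarrow> e \<otimes> t = t"
begin

definition above :: "'a \<Rightarrow> 'a set"
  where "above m = {e \<in> E. e \<otimes> m \<noteq> m}"

text \<open>
  The join irreducible pieces of the finite semilattice \<open>E\<close> exist only as order ideals of \<open>G\<close>;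
  \<open>stratum m\<close> is the one attached to the prime filter of those \<open>e\<close> that are not below \<open>m\<close>.
\<close>

definition stratum :: "'a \<Rightarrow> 'a set"
  where "stratum m = carrier G \<inter> (\<Inter>e\<in>above m. below e)"

text \<open>For \<open>e\<close> and \<open>m\<close> in \<open>E\<close> this is the transpose of
  \<open>above\<close>, so every \<open>stratum m\<close> with \<open>m \<in> strata e\<close> lies
  in \<open>below e\<close>.\<close>

definition strata :: "'a \<Rightarrow> 'a set"
  where "strata e = {m \<in> E. e \<otimes> m \<noteq> m}"

lemma E_closed: "e \<in> E \<Longrightarrow> e \<in> carrier G"
  using E_idem idempotents_closed by blast

lemma t_idem: "t \<in> idempotents G"
  using E_idem t_mem by blast

lemma finite_above [simp]: "finite (above m)" and finite_strata [simp]: "finite (strata e)"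
  unfolding above_def strata_def using E_finite by simp_all

lemma order_ideal_stratum: "order_ideal (stratum m)"
  unfolding stratum_def
  by (rule order_ideal_Inter) (use order_ideal_below E_idem in \<open>auto simp: above_def\<close>)

lemma finprod_mem_E:
  assumes "finite D" "g \<in> D \<rightarrow> E"
  shows "finprod G g D \<in> E"
  using assms
proof (induction D)
  case empty
  then show ?case by (simp add: E_one)
next
  case (insert d D)
  then have "g \<in> D \<rightarrow> carrier G" "g d \<in> carrier G" using E_closed by auto
  then show ?case using insert E_mult by simp
qed

text \<open>By distributivity it suffices to consider a choice of some
  \<open>c m \<in> above m\<close> for each \<open>m \<in> strata e\<close>. The sum
  \<open>u\<close> of the chosen idempotents must absorb \<open>e\<close>: otherwise
  \<open>u\<close> would itself be one of the indices, although \<open>c u\<close> is a summand of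
  \<open>u\<close> and not below \<open>u\<close>.\<close>

lemma mem_strata_sum:
  assumes e: "e \<in> E"
  shows "e \<in> ideal_sum stratum (strata e)"
proof -
  let ?D = "strata e"
  note ob = order_ideal_below[OF subsetD[OF E_idem]]
  have "e \<in> ideal_sum (\<lambda>m. carrier G \<inter> (\<Inter>p\<in>above m. below p)) ?D <#> {\<one>}"
  proof (rule ideal_sum_Inter)
    fix c assume c: "c \<in> Pi ?D above"
    define u where "u = finprod G c ?D"
    have cE: "c \<in> ?D \<rightarrow> E" using c by (auto simp: above_def)
    then have ci: "c \<in> ?D \<rightarrow> idempotents G" using E_idem by blast
    have uE: "u \<in> E" unfolding u_def by (rule finprod_mem_E[OF finite_strata cE])
    have "e \<otimes> u = u"
    proof (rule ccontr)
      assume "e \<otimes> u \<noteq> u"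
      then have u: "u \<in> ?D" using uE by (simp add: strata_def)
      then have "c u \<otimes> u \<noteq> u" using c by (auto simp: above_def)
      then show False using idempotent_finprod_absorb[OF finite_strata ci u] by (simp add: u_def)
    qed
    have oc: "order_ideal (below (c d))" if "d \<in> ?D" for d using ob cE that by blast
    have o: "order_ideal (ideal_sum (\<lambda>m. below (c m)) ?D)"
      by (rule order_ideal_ideal_sum[OF finite_strata oc])
    have "c \<in> Pi ?D (\<lambda>m. below (c m))" using ci idempotent_mem_below by blast
    then have "u \<in> ideal_sum (\<lambda>m. below (c m)) ?D" unfolding u_def ideal_sum_def by blast
    then have "below u \<subseteq> ideal_sum (\<lambda>m. below (c m)) ?D"
      by (rule below_subset_order_ideal[OF o]) (use uE E_idem in blast)
    moreover have "e \<in> below u"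
      using idempotent_mem_below_iff e uE E_idem \<open>e \<otimes> u = u\<close> by blast
    ultimately show "e \<in> ideal_sum (\<lambda>m. below (c m)) ?D <#> {\<one>}"
      using set_mult_contains(1)[OF o order_ideal_trivial] by blast
  next
    fix m p assume "p \<in> above m"
    then show "order_ideal (below p)" using ob by (simp add: above_def)
  qed (simp_all add: order_ideal_trivial E_closed e)
  then obtain a where a: "a \<in> ideal_sum stratum ?D" "e = a \<otimes> \<one>"
    unfolding mem_set_mult stratum_def by blast
  have "a \<in> carrier G"
    by (rule order_ideal_closed[OF order_ideal_ideal_sum a(1)]) (simp_all add: order_ideal_stratum)
  then show ?thesis using a by simp
qed

text \<open>\<open>k\<close> is the meet of \<open>m\<close> and \<open>d\<close> in
  \<open>E\<close>, formed as the sum of all their common lower bounds in \<open>E\<close>. An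
  idempotent of \<open>E\<close> below both is one of these bounds and so below \<open>k\<close>;
  hence every ideal intersected in \<open>stratum k\<close> is intersected in
  \<open>stratum m\<close> or in \<open>stratum d\<close>.\<close>

lemma stratum_Int_subset:
  assumes m: "m \<in> E" and d: "d \<in> E"
  obtains k where "k \<in> E" "k \<otimes> m = m" "k \<otimes> d = d" "stratum m \<inter> stratum d \<subseteq> stratum k"
proof -
  let ?K = "{k \<in> E. k \<otimes> m = m \<and> k \<otimes> d = d}"
  define k where "k = finprod G (\<lambda>x. x) ?K"
  have K: "finite ?K" "(\<lambda>x. x) \<in> ?K \<rightarrow> E" "(\<lambda>x. x) \<in> ?K \<rightarrow> idempotents G"
    using E_finite E_idem by auto
  have kE: "k \<in> E" unfolding k_def by (rule finprod_mem_E[OF K(1,2)])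
  have ki: "k \<in> idempotents G" using kE E_idem by blast
  have kle: "k \<otimes> f = f" if f: "f \<in> E" and *: "\<And>x. x \<in> ?K \<Longrightarrow> x \<otimes> f = f" for f
  proof -
    have fi: "f \<in> idempotents G" using f E_idem by blast
    have c: "(\<lambda>x. x) \<in> ?K \<rightarrow> carrier G" using E_closed by auto
    have "\<forall>x\<in>?K. x \<in> below f" using * idempotent_mem_below_iff[OF _ fi] K(3) by blast
    then have "k \<in> below f"
      unfolding k_def using order_ideal_finprod_iff[OF order_ideal_below[OF fi] K(1) c] by simp
    then show ?thesis using idempotent_mem_below_iff[OF ki fi] by simp
  qed
  have 1: "k \<otimes> m = m" "k \<otimes> d = d" using kle m d by auto
  have "above k \<subseteq> above m \<union> above d"
  proof
    fix e assume e: "e \<in> above k"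
    show "e \<in> above m \<union> above d"
    proof (rule ccontr)
      assume "e \<notin> above m \<union> above d"
      then have "e \<in> ?K" using e by (auto simp: above_def)
      then have "e \<otimes> k = k" using idempotent_finprod_absorb[OF K(1,3)] unfolding k_def by blast
      then show False using e by (simp add: above_def)
    qed
  qed
  then have "stratum m \<inter> stratum d \<subseteq> stratum k" unfolding stratum_def by blast
  then show ?thesis using that kE 1 by blast
qed

lemma stratum_below_t: "m \<in> E \<Longrightarrow> m \<noteq> t \<Longrightarrow> stratum m \<subseteq> below t"
proof -
  assume m: "m \<in> E" "m \<noteq> t"
  have "t \<otimes> m = m \<otimes> t" using m_comm E_closed m t_mem by blast
  then have "t \<in> above m" using t_top[OF m(1)] m t_mem by (simp add: above_def)
  then show ?thesis unfolding stratum_def by blast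
qed

text \<open>\<open>t\<close> is left out because \<open>above t\<close> is empty and
  \<open>stratum t\<close> is therefore all of \<open>carrier G\<close>.\<close>

definition lower_set :: "'a set \<Rightarrow> bool"
  where "lower_set D \<longleftrightarrow> D \<subseteq> E - {t} \<and> (\<forall>m\<in>D. \<forall>k\<in>E. k \<otimes> m = m \<longrightarrow> k \<in> D)"

lemma lower_set_finite: "lower_set D \<Longrightarrow> finite D"
  unfolding lower_set_def using E_finite finite_subset by blast

text \<open>A strictly larger idempotent has more lower bounds in \<open>E\<close>, so an
  \<open>m\<close> with the greatest number of lower bounds is maximal in \<open>D\<close>.\<close>

lemma lower_set_remove_maximal:
  assumes D: "lower_set D" "D \<noteq> {}"
  obtains m where "m \<in> D" "lower_set (D - {m})"
proof -
  let ?f = "\<lambda>m. card {k \<in> E. k \<otimes> m = m}"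
  have fin: "finite D" using D lower_set_finite by blast
  then have "Max (?f ` D) \<in> ?f ` D" using D(2) by (intro Max_in) auto
  then obtain m where "m \<in> D" "?f m = Max (?f ` D)" by auto
  then have m: "m \<in> D" "\<forall>d\<in>D. ?f d \<le> ?f m" using fin by auto
  have DE: "D \<subseteq> E" using D(1) by (auto simp: lower_set_def)
  have "m \<otimes> d \<noteq> d" if d: "d \<in> D" "d \<noteq> m" for d
  proof
    assume md: "m \<otimes> d = d"
    have c: "m \<in> carrier G" "d \<in> carrier G" using E_closed DE m(1) d(1) by blast+
    have "k \<otimes> d = d" if k: "k \<in> E" "k \<otimes> m = m" for k
    proof -
      have "k \<otimes> (m \<otimes> d) = k \<otimes> m \<otimes> d" using m_assoc[OF E_closed[OF k(1)] c] by simp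
      then show ?thesis using md k(2) by simp
    qed
    moreover have "d \<otimes> m \<noteq> m" using md m_comm[OF c] d(2) by simp
    moreover have "d \<otimes> d = d" using d(1) DE E_idem idempotents_idem by blast
    ultimately have "{k \<in> E. k \<otimes> m = m} \<subset> {k \<in> E. k \<otimes> d = d}" using d(1) DE by blast
    then have "?f m < ?f d" using E_finite by (intro psubset_card_mono) auto
    then show False using m(2) d(1) by fastforce
  qed
  then have "lower_set (D - {m})" using D(1) unfolding lower_set_def by blast
  then show ?thesis using that m(1) by blast
qed

lemma lower_set_sum_below_t: "lower_set D \<Longrightarrow> ideal_sum stratum D \<subseteq> below t"
  by (rule ideal_sum_least)
    (use lower_set_finite order_ideal_stratum stratum_below_t order_ideal_below[OF t_idem] in
      \<open>auto simp: lower_set_def\<close>)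

text \<open>An element below \<open>e\<close> is a sum of pieces from strata \<open>d\<close> with
  \<open>e\<close> not below \<open>d\<close>. Lying in \<open>stratum m\<close> as well, such a
  piece falls into the stratum of the meet of \<open>m\<close> and \<open>d\<close>. That meet is
  strictly below \<open>m\<close>, as \<open>e \<le> m \<le> d\<close> is impossible.\<close>

lemma stratum_Int_below:
  assumes D: "lower_set D" and m: "m \<in> D" and e: "e \<in> E" "e \<otimes> m = m"
  shows "stratum m \<inter> below e \<subseteq> ideal_sum stratum (D - {m})"
proof
  fix x assume x: "x \<in> stratum m \<inter> below e"
  let ?J = "ideal_sum stratum (D - {m})"
  have fin: "finite (D - {m})" using lower_set_finite[OF D] by simp
  have oJ: "order_ideal ?J" by (rule order_ideal_ideal_sum[OF fin order_ideal_stratum])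
  have mE: "m \<in> E" using D m by (auto simp: lower_set_def)
  have oS: "order_ideal (ideal_sum stratum (strata e))"
    by (rule order_ideal_ideal_sum[OF finite_strata order_ideal_stratum])
  have "below e \<subseteq> ideal_sum stratum (strata e)"
    by (rule below_subset_order_ideal[OF oS mem_strata_sum[OF e(1)]]) (use e(1) E_idem in blast)
  then obtain g where g: "x = finprod G g (strata e)" "g \<in> Pi (strata e) stratum"
    using x unfolding ideal_sum_def by blast
  have gc: "g \<in> strata e \<rightarrow> carrier G" using g(2) order_ideal_closed[OF order_ideal_stratum] by auto
  have "g d \<in> ?J" if d: "d \<in> strata e" for d
  proof -
    have dE: "d \<in> E" "e \<otimes> d \<noteq> d" using d by (simp_all add: strata_def)
    have "g d \<in> stratum m"
      using order_ideal_finprod_iff[OF order_ideal_stratum finite_strata gc] x g(1) d by blast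
    then have gmd: "g d \<in> stratum m \<inter> stratum d" using g(2) d by blast
    obtain k where k: "k \<in> E" "k \<otimes> m = m" "k \<otimes> d = d" "stratum m \<inter> stratum d \<subseteq> stratum k"
      by (rule stratum_Int_subset[OF mE dE(1)])
    have "k \<noteq> m"
    proof
      assume "k = m"
      then have md: "m \<otimes> d = d" using k(3) by simp
      have "e \<otimes> (m \<otimes> d) = e \<otimes> m \<otimes> d"
        using m_assoc[OF E_closed[OF e(1)] E_closed[OF mE] E_closed[OF dE(1)]] by simp
      then show False using md e(2) dE(2) by simp
    qed
    then have "k \<in> D - {m}" using D m k(1,2) unfolding lower_set_def by blast
    then have "stratum k \<subseteq> ?J" by (rule ideal_sum_contains[OF fin order_ideal_stratum])
    then show ?thesis using gmd k(4) by blast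
  qed
  then show "x \<in> ?J"
    unfolding g(1) using order_ideal_finprod_iff[OF oJ finite_strata gc] by blast
qed

end

context periodic_refinement_monoid
begin

lemma idem_group_torsion:
  assumes t: "t \<in> idempotents G" and g: "g \<in> carrier (idem_group G t)"
  shows "\<exists>n>0. g [^]\<^bsub>idem_group G t\<^esub> (n::nat) = \<one>\<^bsub>idem_group G t\<^esub>"
proof -
  interpret T: comm_group "idem_group G t" by (rule comm_group_idem_group[OF t])
  obtain m :: nat where m: "0 < m" "g [^] (m + 1) = g"
    using strongly_periodic idem_group_closed(1)[OF t g] unfolding strongly_periodic_def by blast
  have "g [^]\<^bsub>idem_group G t\<^esub> (m + 1) = g" using idem_group_pow[OF t g, of "m + 1"] m(2) by simp
  then have "g [^]\<^bsub>idem_group G t\<^esub> m \<otimes>\<^bsub>idem_group G t\<^esub> g = \<one>\<^bsub>idem_group G t\<^esub> \<otimes>\<^bsub>idem_group G t\<^esub> g"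
    using T.nat_pow_Suc[of g m] idem_group_closed(2)[OF t g] by simp
  then have "g [^]\<^bsub>idem_group G t\<^esub> m = \<one>\<^bsub>idem_group G t\<^esub>"
    using g T.nat_pow_closed[OF g, of m] T.one_closed by (simp only: T.r_cancel)
  then show ?thesis using m(1) by blast
qed

end

context idempotent_stratification
begin

abbreviation "T \<equiv> idem_group G t"

text \<open>The same finite set \<open>S\<close> labels the generators at every level, so some of
  them may have order 1. The last clause is the graded independence; it is asked for every
  \<open>e\<close> in \<open>E\<close>, and not only for \<open>\<one>\<close>, because the
  coordinates of an element at indices above its support have to be trivial.\<close>

lemma stratified_generators:
  fixes y :: "'x \<Rightarrow> 'a"
  assumes "lower_set D" and S: "finite S" and "y \<in> S \<rightarrow> translate t (ideal_sum stratum D)"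
  shows "\<exists>w n. (\<forall>m\<in>D. \<forall>x\<in>S. w (m, x) \<in> translate t (stratum m) \<and> 0 < n (m, x) \<and>
        w (m, x) [^]\<^bsub>T\<^esub> (n (m, x) :: nat) = \<one>\<^bsub>T\<^esub>) \<and>
      (\<forall>x\<in>S. \<exists>c. y x = int_comb T w c (D \<times> S)) \<and>
      (\<forall>c e. e \<in> E \<longrightarrow> int_comb T w c (D \<times> S) \<in> translate t (below e) \<longrightarrow>
        (\<forall>m\<in>D. \<forall>x\<in>S. e \<otimes> m = m \<longrightarrow> int (n (m, x)) dvd c (m, x)))"
  using assms(1,3)
proof (induction "card D" arbitrary: D y rule: less_induct)
  case less
  note D = less.prems(1) and y = less.prems(2)
  interpret T: comm_group T by (rule comm_group_idem_group[OF t_idem])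
  show ?case
  proof (cases "D = {}")
    case True
    have "y x = \<one>\<^bsub>T\<^esub>" if "x \<in> S" for x
      using y that idempotents_closed[OF t_idem] unfolding True translate_def by auto
    then show ?thesis unfolding True by (simp add: int_comb_def)
  next
    case False
    obtain m where m: "m \<in> D" and D0: "lower_set (D - {m})"
      by (rule lower_set_remove_maximal[OF D False])
    define D0 where "D0 = D - {m}"
    have lower0: "lower_set D0" and D_eq: "D = insert m D0" and mD0: "m \<notin> D0"
      using D0 m by (auto simp: D0_def)
    have finD: "finite D" "finite D0" using lower_set_finite D lower0 by blast+
    have mE: "m \<in> E" "m \<noteq> t" using D m by (auto simp: lower_set_def)
    define J where "J = ideal_sum stratum D0"
    define I where "I = stratum m"
    have oJ: "order_ideal J" unfolding J_def by (rule order_ideal_ideal_sum[OF finD(2) order_ideal_stratum])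
    have oI: "order_ideal I" unfolding I_def by (rule order_ideal_stratum)
    have It: "I \<subseteq> below t" unfolding I_def by (rule stratum_below_t[OF mE])
    have Jt: "J \<subseteq> below t" unfolding J_def by (rule lower_set_sum_below_t[OF lower0])
    have oIJ: "order_ideal (I \<inter> J)" "I \<inter> J \<subseteq> below t" using oI oJ It by (auto intro: order_ideal_Int)
    have sub: "subgroup (translate t K) T" if "order_ideal K" "K \<subseteq> below t" for K
      by (rule translate_subgroup[OF t_idem that])
    note sI = sub[OF oI It] and sJ = sub[OF oJ Jt] and sIJ = sub[OF oIJ]
    have sum: "ideal_sum stratum D = I <#> J"
      unfolding D_eq I_def J_def by (rule ideal_sum_insert[OF finD(2) mD0 order_ideal_stratum])
    have "\<exists>a b. a \<in> translate t I \<and> b \<in> translate t J \<and> y x = a \<otimes> b" if x: "x \<in> S" for x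
    proof -
      have "y x \<in> translate t I <#>\<^bsub>T\<^esub> translate t J"
        using y x unfolding sum translate_set_mult[OF t_idem oI oJ] by blast
      then show ?thesis unfolding set_mult_def mult_idem_group by blast
    qed
    then obtain y1 y2 where y12: "\<And>x. x \<in> S \<Longrightarrow> y1 x \<in> translate t I \<and> y2 x \<in> translate t J \<and> y x = y1 x \<otimes> y2 x"
      by metis
    have y1c: "y1 \<in> S \<rightarrow> carrier T" using y12 subgroup.mem_carrier[OF sI] by blast
    \<comment> \<open>Working modulo the pure subgroup coming from \<open>I \<inter> J\<close>
      splits off what \<open>I\<close> adds to \<open>J\<close>. The error \<open>v\<close> made in
      expressing \<open>y1\<close> comes from \<open>J\<close> and is handed to the smaller lower
      set together with \<open>y2\<close>.\<close>
    obtain w1 n1 where w1: "w1 \<in> S \<rightarrow> carrier T"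
      and span: "span_over T (translate t (I \<inter> J)) w1 S = span_over T (translate t (I \<inter> J)) y1 S"
      and n1: "\<And>x. x \<in> S \<Longrightarrow> 0 < n1 x \<and> w1 x [^]\<^bsub>T\<^esub> (n1 x :: nat) = \<one>\<^bsub>T\<^esub>"
      and ind1: "\<And>c x. int_comb T w1 c S \<in> translate t (I \<inter> J) \<Longrightarrow> x \<in> S \<Longrightarrow> int (n1 x) dvd c x"
      using T.independent_generators_over_pure[OF sIJ translate_pure[OF t_idem oIJ] idem_group_torsion[OF t_idem] S y1c]
      by blast
    have "span_over T (translate t (I \<inter> J)) y1 S \<subseteq> translate t I"
      by (rule T.span_over_minimal[OF sI S]) (use y12 in \<open>auto simp: translate_def\<close>)
    then have w1I: "w1 x \<in> translate t I" if "x \<in> S" for x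
      using T.span_over_gen[OF sIJ S w1 that] unfolding span by blast
    have "\<exists>v c. v \<in> translate t (I \<inter> J) \<and> y1 x = v \<otimes> int_comb T w1 c S" if x: "x \<in> S" for x
      using T.span_over_gen[OF sIJ S y1c x] unfolding span[symmetric]
      unfolding span_over_def mult_idem_group by blast
    then obtain v c1 where v: "\<And>x. x \<in> S \<Longrightarrow> v x \<in> translate t (I \<inter> J) \<and> y1 x = v x \<otimes> int_comb T w1 (c1 x) S"
      by metis
    have vJ: "v x \<in> translate t J" if "x \<in> S" for x using v[OF that] by (auto simp: translate_def)
    have "(\<lambda>x. v x \<otimes> y2 x) \<in> S \<rightarrow> translate t (ideal_sum stratum D0)"
      using subgroup.m_closed[OF sJ] vJ y12 by (simp add: J_def Pi_iff)
    note y0 = this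
    have "card D0 < card D" unfolding D0_def by (rule card_Diff1_less[OF finD(1) m])
    from less.hyps[OF this lower0 y0] obtain w0 n0
      where w0': "\<forall>k\<in>D0. \<forall>x\<in>S. w0 (k, x) \<in> translate t (stratum k) \<and> 0 < n0 (k, x) \<and>
          w0 (k, x) [^]\<^bsub>T\<^esub> (n0 (k, x) :: nat) = \<one>\<^bsub>T\<^esub>"
        and c0': "\<forall>x\<in>S. \<exists>c. v x \<otimes> y2 x = int_comb T w0 c (D0 \<times> S)"
        and ind0': "\<forall>c e. e \<in> E \<longrightarrow> int_comb T w0 c (D0 \<times> S) \<in> translate t (below e) \<longrightarrow>
          (\<forall>k\<in>D0. \<forall>x\<in>S. e \<otimes> k = k \<longrightarrow> int (n0 (k, x)) dvd c (k, x))"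
      by (elim exE conjE) (rule that)
    note w0 = w0'[rule_format] and c0 = c0'[rule_format] and ind0 = ind0'[rule_format]
    have w0J: "w0 q \<in> translate t J" if "q \<in> D0 \<times> S" for q
    proof -
      obtain k x where q: "q = (k, x)" "k \<in> D0" "x \<in> S" using \<open>q \<in> D0 \<times> S\<close> by blast
      have "stratum k \<subseteq> J" unfolding J_def by (rule ideal_sum_contains[OF finD(2) order_ideal_stratum q(2)])
      then show ?thesis using w0[OF q(2,3)] q(1) by (auto simp: translate_def)
    qed
    have w0c: "w0 \<in> D0 \<times> S \<rightarrow> carrier T" using w0J subgroup.mem_carrier[OF sJ] by blast
    define w where "w q = (if fst q = m then w1 (snd q) else w0 q)" for q
    define n where "n q = (if fst q = m then n1 (snd q) else n0 q)" for q
    have wm: "w (m, x) = w1 x" "n (m, x) = n1 x" for x by (simp_all add: w_def n_def)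
    have wk: "w (k, x) = w0 (k, x)" "n (k, x) = n0 (k, x)" if "k \<in> D0" for k x
      using that mD0 by (auto simp: w_def n_def)
    have "w \<in> insert m D0 \<times> S \<rightarrow> carrier T"
      using w1 w0c wm wk by (auto simp: Pi_iff)
    then have split: "int_comb T w c (D \<times> S) = int_comb T w1 (\<lambda>x. c (m, x)) S \<otimes> int_comb T w0 c (D0 \<times> S)" for c
      unfolding D_eq using T.int_comb_times_insert[OF finD(2) S mD0, of w c] wm
        T.int_comb_cong[of "D0 \<times> S" w w0 c c] wk w0c by auto
    have "w (k, x) \<in> translate t (stratum k) \<and> 0 < n (k, x) \<and> w (k, x) [^]\<^bsub>T\<^esub> n (k, x) = \<one>\<^bsub>T\<^esub>"
      if "k \<in> D" "x \<in> S" for k x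
      using that w0[of k x] w1I[of x] n1[of x] wm wk unfolding D_eq I_def by auto
    moreover have "\<exists>c. y x = int_comb T w c (D \<times> S)" if x: "x \<in> S" for x
    proof -
      obtain c where c: "v x \<otimes> y2 x = int_comb T w0 c (D0 \<times> S)" using c0[OF x] by blast
      let ?c = "\<lambda>q. if fst q = m then c1 x (snd q) else c q"
      have cl: "v x \<in> carrier T" "y2 x \<in> carrier T" "int_comb T w1 (c1 x) S \<in> carrier T"
        using vJ[OF x] y12[OF x] subgroup.mem_carrier[OF sJ] T.int_comb_closed[OF w1] by auto
      have "y x = (v x \<otimes>\<^bsub>T\<^esub> int_comb T w1 (c1 x) S) \<otimes>\<^bsub>T\<^esub> y2 x" using y12[OF x] v[OF x] by simp
      also have "\<dots> = int_comb T w1 (c1 x) S \<otimes>\<^bsub>T\<^esub> (v x \<otimes>\<^bsub>T\<^esub> y2 x)"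
        using cl by (simp only: T.m_assoc T.m_lcomm T.m_closed)
      also have "v x \<otimes>\<^bsub>T\<^esub> y2 x = int_comb T w0 ?c (D0 \<times> S)"
        using c T.int_comb_cong[of "D0 \<times> S" w0 w0 ?c c] w0c mD0 by force
      finally have "y x = int_comb T w ?c (D \<times> S)" unfolding split by simp
      then show ?thesis by blast
    qed
    moreover have "int (n (k, x)) dvd c (k, x)"
      if e: "e \<in> E" and C: "int_comb T w c (D \<times> S) \<in> translate t (below e)"
        and k: "k \<in> D" and x: "x \<in> S" and ek: "e \<otimes> k = k" for c e k x
    proof -
      let ?W = "int_comb T w1 (\<lambda>x. c (m, x)) S" and ?O = "int_comb T w0 c (D0 \<times> S)"
      have ei: "e \<in> idempotents G" using e E_idem by blast
      have oe: "order_ideal (below e)" by (rule order_ideal_below[OF ei])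
      have et: "below e \<subseteq> below t"
        by (rule below_subset_order_ideal[OF order_ideal_below[OF t_idem] _ ei])
          (use idempotent_mem_below_iff[OF ei t_idem] t_top[OF e] in simp)
      have W: "?W \<in> translate t I" by (rule T.int_comb_subgroup[OF sI S w1I])
      have O: "?O \<in> translate t J" by (rule T.int_comb_subgroup[OF sJ _ w0J]) (use finD S in simp)
      note cl = subgroup.mem_carrier[OF sI W] subgroup.mem_carrier[OF sJ O]
      have se: "subgroup (translate t (below e)) T" by (rule sub[OF oe et])
      have C': "?W \<otimes>\<^bsub>T\<^esub> ?O \<in> translate t (below e)" using C unfolding split by simp
      have "?O \<in> translate t (below e) \<and> (e \<otimes> m = m \<longrightarrow> (\<forall>x\<in>S. int (n1 x) dvd c (m, x)))"
      proof (cases "e \<otimes> m = m")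
        case True
        \<comment> \<open>\<open>?W\<close> is the difference of an element coming from
          \<open>below e\<close> and one coming from \<open>J\<close>, so it comes from
          \<open>I \<inter> (below e <#> J)\<close>. By distributivity and \<open>inc\<close> this
          ideal lies in \<open>I \<inter> J\<close>, and independence modulo the latter makes
          \<open>?W\<close> trivial.\<close>
        have inc: "I \<inter> below e \<subseteq> J"
          unfolding I_def J_def D0_def by (rule stratum_Int_below[OF D m e True])
        have "?W = (?W \<otimes>\<^bsub>T\<^esub> ?O) \<otimes>\<^bsub>T\<^esub> inv\<^bsub>T\<^esub> ?O"
          using cl T.m_assoc[OF cl T.inv_closed[OF cl(2)]] T.r_inv[OF cl(2)] T.r_one[OF cl(1)] by simp
        then have "?W \<in> translate t (below e) <#>\<^bsub>T\<^esub> translate t J"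
          unfolding set_mult_def using C' subgroup.m_inv_closed[OF sJ O] by blast
        then have "?W \<in> translate t (below e <#> J)" unfolding translate_set_mult[OF t_idem oe oJ] .
        then have "?W \<in> translate t (I \<inter> (below e <#> J))"
          using W translate_Int[OF t_idem oI It order_ideal_set_mult[OF oe oJ]
              set_mult_subset[OF order_ideal_below[OF t_idem] et Jt]] by blast
        moreover have "I \<inter> (below e <#> J) \<subseteq> I \<inter> J"
        proof -
          have "I \<inter> (below e <#> J) \<subseteq> (I \<inter> below e) <#> (I \<inter> J)"
            by (rule order_ideal_Int_set_mult[OF oI oe oJ])
          also have "\<dots> \<subseteq> I \<inter> J" by (rule set_mult_subset[OF oIJ(1)]) (use inc in blast)+
          finally show ?thesis .
        qed
        ultimately have "?W \<in> translate t (I \<inter> J)" unfolding translate_def by blast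
        then have dvd: "\<forall>x\<in>S. int (n1 x) dvd c (m, x)" using ind1 by blast
        have "?W = \<one>\<^bsub>T\<^esub>"
        proof (rule T.int_comb_one)
          fix x assume x: "x \<in> S"
          obtain r where r: "c (m, x) = int (n1 x) * r" using dvd x by blast
          have wx: "w1 x \<in> carrier T" using w1 x by blast
          have "w1 x [^]\<^bsub>T\<^esub> c (m, x) = (w1 x [^]\<^bsub>T\<^esub> int (n1 x)) [^]\<^bsub>T\<^esub> r"
            unfolding r T.int_pow_pow[OF wx] ..
          then show "w1 x [^]\<^bsub>T\<^esub> c (m, x) = \<one>\<^bsub>T\<^esub>" using n1[OF x] T.int_pow_one[of r] by (simp add: int_pow_int)
        qed
        then have "?O = ?W \<otimes>\<^bsub>T\<^esub> ?O" using T.l_one[OF cl(2)] by simp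
        then show ?thesis using C' dvd by simp
      next
        case False
        \<comment> \<open>Here \<open>below e\<close> is one of the ideals intersected in
          \<open>stratum m\<close>, so \<open>?W\<close> itself comes from \<open>below e\<close>
          and can be subtracted.\<close>
        then have "I \<subseteq> below e" unfolding I_def stratum_def above_def using e by blast
        then have "?W \<in> translate t (below e)" using W unfolding translate_def by blast
        then have "inv\<^bsub>T\<^esub> ?W \<otimes>\<^bsub>T\<^esub> (?W \<otimes>\<^bsub>T\<^esub> ?O) \<in> translate t (below e)"
          using C' subgroup.m_closed[OF se] subgroup.m_inv_closed[OF se] by blast
        moreover have "inv\<^bsub>T\<^esub> ?W \<otimes>\<^bsub>T\<^esub> (?W \<otimes>\<^bsub>T\<^esub> ?O) = ?O"
          using T.m_assoc[OF T.inv_closed[OF cl(1)] cl] T.l_inv[OF cl(1)] T.l_one[OF cl(2)] by simp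
        ultimately show ?thesis using False by simp
      qed
      then show ?thesis
        using ind0[OF e _ _ x ek, of c] k ek x wm wk unfolding D_eq by auto
    qed
    ultimately show ?thesis by (intro exI[of _ w] exI[of _ n]) blast
  qed
qed

end

section \<open>Factoring a finite submonoid through a sum of cyclic monoids\<close>

lemma (in group) int_pow_mod:
  assumes "g \<in> carrier G" "g [^] (n::nat) = \<one>"
  shows "g [^] (c mod int n) = g [^] (c::int)"
proof -
  have "g [^] (int n * (c div int n)) = (g [^] int n) [^] (c div int n)"
    using int_pow_pow[OF assms(1)] by simp
  then have "g [^] (int n * (c div int n)) = \<one>" using assms(2) by (simp add: int_pow_int)
  then show ?thesis
    using int_pow_mult[OF assms(1), of "int n * (c div int n)" "c mod int n"] assms(1) by simp
qed

lemma adjoin_identity_simps [simp]: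
  "carrier (adjoin_identity H) = insert None (Some ` carrier H)"
  "\<one>\<^bsub>adjoin_identity H\<^esub> = None"
  "None \<otimes>\<^bsub>adjoin_identity H\<^esub> z = z"
  "z \<otimes>\<^bsub>adjoin_identity H\<^esub> None = z"
  "Some a \<otimes>\<^bsub>adjoin_identity H\<^esub> Some b = Some (a \<otimes>\<^bsub>H\<^esub> b)"
  by (simp_all add: adjoin_identity_def split: option.split)

context comm_monoid
begin

definition cyclic_map :: "'a \<Rightarrow> 'a \<Rightarrow> int option \<Rightarrow> 'a"
  where "cyclic_map e b z = (case z of None \<Rightarrow> \<one> | Some a \<Rightarrow> b [^]\<^bsub>idem_group G e\<^esub> a)"

lemma cyclic_map_hom:
  assumes e: "e \<in> idempotents G" and b: "b \<in> carrier (idem_group G e)"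
    and n: "0 < n" "b [^]\<^bsub>idem_group G e\<^esub> (n::nat) = \<one>\<^bsub>idem_group G e\<^esub>"
  shows "cyclic_map e b \<in> monoid_homs (adjoin_identity (integer_mod_group n)) G"
proof -
  interpret E: comm_group "idem_group G e" by (rule comm_group_idem_group[OF e])
  have c: "b [^]\<^bsub>idem_group G e\<^esub> a \<in> carrier G" for a :: int
    by (rule idem_group_closed(1)[OF e E.int_pow_closed[OF b]])
  have m: "b [^]\<^bsub>idem_group G e\<^esub> ((a + a') mod int n) = b [^]\<^bsub>idem_group G e\<^esub> a \<otimes> b [^]\<^bsub>idem_group G e\<^esub> a'"
    for a a' :: int
    unfolding E.int_pow_mod[OF b n(2)] using E.int_pow_mult[OF b, of a a'] by simp
  show ?thesis
    unfolding monoid_homs_def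
  proof (intro CollectI conjI homI)
    fix x assume "x \<in> carrier (adjoin_identity (integer_mod_group n))"
    then show "cyclic_map e b x \<in> carrier G" using c by (auto simp: cyclic_map_def split: option.split)
    fix y
    show "cyclic_map e b (x \<otimes>\<^bsub>adjoin_identity (integer_mod_group n)\<^esub> y) = cyclic_map e b x \<otimes> cyclic_map e b y"
      using c m by (cases x; cases y) (simp_all add: cyclic_map_def)
  qed (simp add: cyclic_map_def)
qed

text \<open>A finite direct product of commutative monoids is also their coproduct, so homomorphisms
  out of the factors combine into one.\<close>

lemma product_hom:
  assumes I: "finite I" and v: "\<And>i. i \<in> I \<Longrightarrow> v i \<in> monoid_homs (N i) G"
  shows "(\<lambda>\<beta>. finprod G (\<lambda>i. v i (\<beta> i)) I) \<in> monoid_homs (product_group I N) G"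
proof -
  have c: "v i (\<beta> i) \<in> carrier G" if "\<beta> \<in> carrier (product_group I N)" "i \<in> I" for \<beta> i
    using v[OF that(2)] that by (auto simp: monoid_homs_def hom_def)
  show ?thesis
    unfolding monoid_homs_def
  proof (intro CollectI conjI homI)
    fix \<beta> assume b: "\<beta> \<in> carrier (product_group I N)"
    then show "finprod G (\<lambda>i. v i (\<beta> i)) I \<in> carrier G" using c by (intro finprod_closed) auto
    fix \<gamma> assume g: "\<gamma> \<in> carrier (product_group I N)"
    have "v i ((\<beta> \<otimes>\<^bsub>product_group I N\<^esub> \<gamma>) i) = v i (\<beta> i) \<otimes> v i (\<gamma> i)" if "i \<in> I" for i
      using v[OF that] b g that by (auto simp: monoid_homs_def hom_def PiE_iff)
    then have "finprod G (\<lambda>i. v i ((\<beta> \<otimes>\<^bsub>product_group I N\<^esub> \<gamma>) i)) I = finprod G (\<lambda>i. v i (\<beta> i) \<otimes> v i (\<gamma> i)) I"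
      using c[OF b] c[OF g] by (intro finprod_cong') auto
    also have "\<dots> = finprod G (\<lambda>i. v i (\<beta> i)) I \<otimes> finprod G (\<lambda>i. v i (\<gamma> i)) I"
      using c[OF b] c[OF g] by (intro finprod_multf) auto
    finally show "finprod G (\<lambda>i. v i ((\<beta> \<otimes>\<^bsub>product_group I N\<^esub> \<gamma>) i)) I =
      finprod G (\<lambda>i. v i (\<beta> i)) I \<otimes> finprod G (\<lambda>i. v i (\<gamma> i)) I" .
  next
    show "finprod G (\<lambda>i. v i (\<one>\<^bsub>product_group I N\<^esub> i)) I = \<one>"
      using v by (intro finprod_one_eqI) (auto simp: monoid_homs_def)
  qed
qed

end

context periodic_refinement_monoid
begin

text \<open>The group of \<open>supp x\<close> is torsion, so some power of \<open>x\<close> is its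
  neutral element. Consequently a submonoid contains the supports of its elements.\<close>

lemma supp_eq_pow:
  assumes x: "x \<in> carrier G"
  shows "\<exists>m::nat. supp x = x [^] m"
proof -
  obtain n :: nat where n: "0 < n" "x [^]\<^bsub>idem_group G (supp x)\<^esub> n = \<one>\<^bsub>idem_group G (supp x)\<^esub>"
    using idem_group_torsion[OF supp[OF x]] by blast
  then have "supp x = x [^] n" using idem_group_pow[OF supp[OF x] n(1)] by simp
  then show ?thesis by blast
qed

lemma translate_finprod:
  assumes t: "t \<in> idempotents G" and "finite Q" "u \<in> Q \<rightarrow> below t"
  shows "finprod G u Q \<otimes> t = finprod (idem_group G t) (\<lambda>q. u q \<otimes> t) Q"
  using assms(2,3)
proof (induction Q)
  case empty
  interpret T: comm_group "idem_group G t" by (rule comm_group_idem_group[OF t])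
  show ?case using idempotents_closed[OF t] by simp
next
  case (insert q Q)
  interpret T: comm_group "idem_group G t" by (rule comm_group_idem_group[OF t])
  have u: "u \<in> Q \<rightarrow> carrier G" "u q \<in> carrier G" using insert.prems by (auto simp: below_def)
  have ut: "(\<lambda>q. u q \<otimes> t) \<in> Q \<rightarrow> carrier (idem_group G t)" "u q \<otimes> t \<in> carrier (idem_group G t)"
    using insert.prems below_translate[OF t] by auto
  have "finprod G u (insert q Q) \<otimes> t = (u q \<otimes> t) \<otimes> (finprod G u Q \<otimes> t)"
    using insert.hyps u translate_mult[OF t u(2) finprod_closed[OF u(1)]] by simp
  also have "\<dots> = (u q \<otimes> t) \<otimes> finprod (idem_group G t) (\<lambda>q. u q \<otimes> t) Q"
    using insert by simp
  finally show ?case using T.finprod_insert[OF insert.hyps ut] by simp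
qed

lemma supp_int_pow:
  assumes x: "x \<in> carrier G"
  shows "x [^]\<^bsub>idem_group G (supp x)\<^esub> (a::int) \<in> carrier G"
    "supp (x [^]\<^bsub>idem_group G (supp x)\<^esub> a) = supp x"
proof -
  interpret E: comm_group "idem_group G (supp x)" by (rule comm_group_idem_group[OF supp(1)[OF x]])
  have "x [^]\<^bsub>idem_group G (supp x)\<^esub> a \<in> carrier (idem_group G (supp x))"
    by (rule E.int_pow_closed[OF supp(2)[OF x]])
  then show "x [^]\<^bsub>idem_group G (supp x)\<^esub> a \<in> carrier G"
    "supp (x [^]\<^bsub>idem_group G (supp x)\<^esub> a) = supp x"
    using mem_idem_group_iff[OF supp(1)[OF x]] by simp_all
qed

text \<open>
  The cyclic summands are indexed by pairs \<open>(m, x)\<close>.  An element \<open>x\<close> is sent to its coordinates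
  with respect to the independent generators; the coordinate of a generator in \<open>stratum m\<close> is the
  adjoined identity exactly if \<open>supp x \<le> m\<close>.
\<close>

theorem finite_submonoid_factors:
  assumes A: "A \<subseteq> carrier G" "finite A" "\<one> \<in> A" "\<And>x y. x \<in> A \<Longrightarrow> y \<in> A \<Longrightarrow> x \<otimes> y \<in> A"
  shows "\<exists>k n \<iota> \<psi>. (\<forall>i<(k::nat). 0 < n i) \<and>
    \<iota> \<in> monoid_homs (G\<lparr>carrier := A\<rparr>) (product_group {..<k} (\<lambda>i. adjoin_identity (integer_mod_group (n i)))) \<and>
    \<psi> \<in> monoid_homs (product_group {..<k} (\<lambda>i. adjoin_identity (integer_mod_group (n i)))) G \<and>
    (\<forall>x\<in>A. \<psi> (\<iota> x) = x)"
proof -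
  define E where "E = A \<inter> idempotents G"
  define t where "t = finprod G (\<lambda>e. e) E"
  have E: "finite E" "(\<lambda>e. e) \<in> E \<rightarrow> idempotents G" using A(2) by (auto simp: E_def)
  have tE: "t \<in> E"
  proof -
    have "finprod G (\<lambda>e. e) F \<in> A" if "finite F" "F \<subseteq> E" for F
      using that
    proof (induction F)
      case (insert e F)
      then have "e \<in> A" "(\<lambda>e. e) \<in> F \<rightarrow> carrier G" "e \<in> carrier G" using A(1) by (auto simp: E_def)
      then show ?case using insert A(4) by simp
    qed (simp add: A(3))
    then show ?thesis unfolding t_def using finprod_idempotents[OF E] E(1) by (simp add: E_def)
  qed
  interpret idempotent_stratification G E t
  proof unfold_locales
    show "\<one> \<in> E" using A(3) one_idempotent by (simp add: E_def)
    show "e \<otimes> f \<in> E" if "e \<in> E" "f \<in> E" for e f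
      using that A(4) idempotents_mult by (simp add: E_def)
    show "e \<otimes> t = t" if "e \<in> E" for e
      using idempotent_finprod_absorb[OF E that] by (simp add: t_def)
  qed (use E(1) tE in \<open>simp_all add: E_def\<close>)
  interpret T: comm_group T by (rule comm_group_idem_group[OF t_idem])
  have Ac: "x \<in> carrier G" if "x \<in> A" for x using A(1) that by blast
  have suppE: "supp x \<in> E" if x: "x \<in> A" for x
  proof -
    obtain m :: nat where m: "supp x = x [^] m" using supp_eq_pow[OF Ac[OF x]] by blast
    have "x [^] k \<in> A" for k :: nat by (induction k) (simp_all add: A(3,4) x)
    then show ?thesis using m supp(1)[OF Ac[OF x]] by (simp add: E_def)
  qed
  define D where "D = E - {t}"
  have mt: "t \<otimes> m \<noteq> m" if "m \<in> D" for m
    using that t_top[of m] m_comm[OF E_closed E_closed, of m t] t_mem by (auto simp: D_def)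
  have D: "lower_set D" unfolding lower_set_def D_def using mt by (auto simp: D_def)
  have finD: "finite D" using E(1) by (simp add: D_def)
  have oD: "order_ideal (ideal_sum stratum D)" by (rule order_ideal_ideal_sum[OF finD order_ideal_stratum])
  have strata_D: "strata e \<subseteq> D" if "e \<in> E" for e using t_top[OF that] by (auto simp: strata_def D_def)
  have below_E_t: "below e \<subseteq> below t" if e: "e \<in> E" for e
    by (rule below_subset_order_ideal[OF order_ideal_below[OF t_idem]])
      (use e E_idem t_top[OF e] idempotent_mem_below_iff[OF _ t_idem] in \<open>auto simp: E_def\<close>)
  have supp_t: "x \<in> below t" "supp x \<otimes> t = t" if "x \<in> A" for x
    using t_top[OF suppE[OF that]] Ac[OF that] by (simp_all add: below_def)
  have "(\<lambda>x. x \<otimes> t) \<in> A \<rightarrow> translate t (ideal_sum stratum D)"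
  proof
    fix x assume x: "x \<in> A"
    have "stratum m \<subseteq> ideal_sum stratum D" if "m \<in> strata (supp x)" for m
      by (rule ideal_sum_contains[OF finD order_ideal_stratum subsetD[OF strata_D[OF suppE[OF x]] that]])
    then have "ideal_sum stratum (strata (supp x)) \<subseteq> ideal_sum stratum D"
      by (rule ideal_sum_least[OF finite_strata order_ideal_stratum _ oD])
    then have "supp x \<in> ideal_sum stratum D" using mem_strata_sum[OF suppE[OF x]] by blast
    then have "x \<in> ideal_sum stratum D" using order_ideal_supp_iff[OF oD Ac[OF x]] by simp
    then show "x \<otimes> t \<in> translate t (ideal_sum stratum D)" by (simp add: translate_def)
  qed
  from stratified_generators[OF D A(2) this] obtain w n
    where w': "\<forall>m\<in>D. \<forall>x\<in>A. w (m, x) \<in> translate t (stratum m) \<and> 0 < n (m, x) \<and>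
        w (m, x) [^]\<^bsub>T\<^esub> (n (m, x) :: nat) = \<one>\<^bsub>T\<^esub>"
      and c': "\<forall>x\<in>A. \<exists>c. x \<otimes> t = int_comb T w c (D \<times> A)"
      and ind': "\<forall>c e. e \<in> E \<longrightarrow> int_comb T w c (D \<times> A) \<in> translate t (below e) \<longrightarrow>
        (\<forall>m\<in>D. \<forall>x\<in>A. e \<otimes> m = m \<longrightarrow> int (n (m, x)) dvd c (m, x))"
    by (elim exE conjE) (rule that)
  let ?Q = "D \<times> A"
  have finQ: "finite ?Q" using finD A(2) by simp
  have w: "w q \<in> translate t (stratum (fst q))" "0 < n q" "w q [^]\<^bsub>T\<^esub> n q = \<one>\<^bsub>T\<^esub>" if "q \<in> ?Q" for q
    using that w' by auto
  have ind: "int (n q) dvd c q"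
    if "e \<in> E" "int_comb T w c ?Q \<in> translate t (below e)" "q \<in> ?Q" "e \<otimes> fst q = fst q" for c e q
    using that ind' by auto
  obtain c where c: "\<And>x. x \<in> A \<Longrightarrow> x \<otimes> t = int_comb T w (c x) ?Q" using c' by metis
  have DE: "m \<in> E" "m \<noteq> t" if "m \<in> D" for m using that by (simp_all add: D_def)
  have st: "stratum m \<subseteq> below t" if "m \<in> D" for m using stratum_below_t DE[OF that] by blast
  have wc: "w \<in> ?Q \<rightarrow> carrier T"
    using w(1) subgroup.mem_carrier[OF translate_subgroup[OF t_idem order_ideal_stratum st]] by fastforce
  have "\<exists>b. b \<in> stratum (fst q) \<and> w q = b \<otimes> t" if "q \<in> ?Q" for q
    using w(1)[OF that] unfolding translate_def by blast
  then obtain b0 where b0: "\<And>q. q \<in> ?Q \<Longrightarrow> b0 q \<in> stratum (fst q) \<and> w q = b0 q \<otimes> t" by metis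
  have "\<exists>g. g \<in> Pi (strata e) stratum \<and> e = finprod G g (strata e)" if "e \<in> E" for e
    using mem_strata_sum[OF that] unfolding ideal_sum_def by blast
  then obtain g where g: "\<And>e. e \<in> E \<Longrightarrow> g e \<in> Pi (strata e) stratum \<and> e = finprod G (g e) (strata e)"
    by metis
  \<comment> \<open>A lift \<open>b0 q\<close> may have too small a support. \<open>F m\<close>
    gathers the components in \<open>stratum m\<close> of all idempotents in \<open>E\<close>;
    adding its support makes the generators at \<open>m\<close> dominate these components. The
    translates do not change, because \<open>F m\<close> lies below \<open>t\<close> for
    \<open>m\<close> in \<open>D\<close>.\<close>
  define F where "F m = finprod G (\<lambda>e. if m \<in> strata e then g e m else \<one>) E" for m
  have gS: "(if m \<in> strata e then g e m else \<one>) \<in> stratum m" if "e \<in> E" for e m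
    using g[OF that] order_ideal_one[OF order_ideal_stratum] by auto
  have gC: "(\<lambda>e. if m \<in> strata e then g e m else \<one>) \<in> E \<rightarrow> carrier G" for m
    using gS order_ideal_closed[OF order_ideal_stratum] by blast
  have F: "F m \<in> stratum m" for m
    unfolding F_def using order_ideal_finprod_iff[OF order_ideal_stratum E(1) gC] gS by blast
  have Fc: "F m \<in> carrier G" for m using F order_ideal_closed[OF order_ideal_stratum] by blast
  define b where "b q = b0 q \<otimes> supp (F (fst q))" for q
  have b0c: "b0 q \<in> carrier G" if "q \<in> ?Q" for q
    using b0[OF that] order_ideal_closed[OF order_ideal_stratum] by blast
  have bc: "b q \<in> carrier G" if "q \<in> ?Q" for q using b0c[OF that] Fc by (simp add: b_def)
  have bS: "b q \<in> stratum (fst q)" if q: "q \<in> ?Q" for q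
    unfolding b_def using order_ideal_mult_iff[OF order_ideal_stratum b0c[OF q] supp_closed[OF Fc]]
      b0[OF q] F order_ideal_supp_iff[OF order_ideal_stratum Fc] by simp
  have bt: "b q \<in> below t" if q: "q \<in> ?Q" for q using bS[OF q] st[of "fst q"] q by auto
  have b_supp_t: "supp (b q) \<otimes> t = t" if "q \<in> ?Q" for q using bt[OF that] by (simp add: below_def)
  have bw: "b q \<otimes> t = w q" if q: "q \<in> ?Q" for q
  proof -
    have "F (fst q) \<in> below t" by (rule subsetD[OF st F]) (use q in auto)
    then have "supp (F (fst q)) \<otimes> t = t" by (simp add: below_def)
    then show ?thesis unfolding b_def
      using b0[OF q] m_assoc[OF b0c[OF q] supp_closed[OF Fc] E_closed[OF t_mem]] by simp
  qed
  define C where "C q = idem_group G (supp (b q))" for q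
  have hom: "group_hom (C q) T (\<lambda>x. x \<otimes> t)" if "q \<in> ?Q" for q
    unfolding C_def by (rule translation_hom[OF supp(1)[OF bc[OF that]] t_idem b_supp_t[OF that]])
  have b_pow: "(b q [^]\<^bsub>C q\<^esub> (a::int)) \<otimes> t = w q [^]\<^bsub>T\<^esub> a" if q: "q \<in> ?Q" for q a
    using group_hom.hom_int_pow[OF hom[OF q], of "b q" a] supp(2)[OF bc[OF q]] bw[OF q] by (simp add: C_def)
  have b_pow_mem: "b q [^]\<^bsub>C q\<^esub> (a::int) \<in> carrier G" "supp (b q [^]\<^bsub>C q\<^esub> a) = supp (b q)"
    if "q \<in> ?Q" for q a
    unfolding C_def by (rule supp_int_pow[OF bc[OF that]])+
  \<comment> \<open>Translation by \<open>t\<close> is injective on the group of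
    \<open>supp (b q)\<close>, so the order relation of \<open>w q\<close> descends to
    \<open>b q\<close>.\<close>
  have b_ord: "b q [^]\<^bsub>C q\<^esub> n q = \<one>\<^bsub>C q\<^esub>" if q: "q \<in> ?Q" for q
  proof -
    have "b q [^]\<^bsub>C q\<^esub> int (n q) = supp (b q)"
    proof (rule translation_inject[OF b_pow_mem(1)[OF q] supp_closed[OF bc[OF q]] _ t_idem])
      show "supp (b q [^]\<^bsub>C q\<^esub> int (n q)) = supp (supp (b q))"
        using b_pow_mem(2)[OF q] supp_of_idempotent[OF supp(1)[OF bc[OF q]]] by simp
      show "supp (b q [^]\<^bsub>C q\<^esub> int (n q)) \<otimes> t = t" using b_pow_mem(2)[OF q] b_supp_t[OF q] by simp
      show "b q [^]\<^bsub>C q\<^esub> int (n q) \<otimes> t = supp (b q) \<otimes> t"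
        unfolding b_pow[OF q] using w(3)[OF q] b_supp_t[OF q] by (simp add: int_pow_int)
    qed
    then show ?thesis by (simp add: int_pow_int C_def)
  qed
  obtain h where h: "bij_betw h {..<card ?Q} ?Q"
    using ex_bij_betw_nat_finite[OF finQ] by (auto simp: atLeast0LessThan)
  have hQ: "h i \<in> ?Q" if "i < card ?Q" for i using h that by (auto simp: bij_betw_def)
  let ?k = "card ?Q"
  let ?B = "product_group {..<?k} (\<lambda>i. adjoin_identity (integer_mod_group (n (h i))))"
  define co where "co x q = (if supp x \<otimes> fst q = fst q then None else Some (c x q mod int (n q)))" for x q
  define \<iota> where "\<iota> x = (\<lambda>i\<in>{..<?k}. co x (h i))" for x
  define \<psi> where "\<psi> \<beta> = finprod G (\<lambda>i. cyclic_map (supp (b (h i))) (b (h i)) (\<beta> i)) {..<?k}" for \<beta>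
  have \<psi>: "\<psi> \<in> monoid_homs ?B G"
    unfolding \<psi>_def
  proof (rule product_hom)
    fix i assume "i \<in> {..<?k}"
    then have q: "h i \<in> ?Q" using hQ by simp
    show "cyclic_map (supp (b (h i))) (b (h i)) \<in> monoid_homs (adjoin_identity (integer_mod_group (n (h i)))) G"
      using b_ord[OF q] w(2)[OF q] by (intro cyclic_map_hom supp[OF bc[OF q]]) (simp_all add: C_def)
  qed simp
  \<comment> \<open>\<open>x \<otimes> t\<close> comes from \<open>below (supp x)\<close>, so graded
    independence applies with \<open>e = supp x\<close>. The coordinates that are replaced by
    \<open>None\<close> are therefore trivial and carry no information.\<close>
  have absorbed: "int (n q) dvd c x q" if x: "x \<in> A" and q: "q \<in> ?Q" and s: "supp x \<otimes> fst q = fst q" for x q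
  proof (rule ind[OF suppE[OF x] _ q s])
    have "x \<in> below (supp x)" using Ac[OF x] by (simp add: below_def)
    then show "int_comb T w (c x) ?Q \<in> translate t (below (supp x))"
      unfolding c[OF x, symmetric] translate_def by (rule imageI)
  qed
  have additive: "c (x \<otimes> y) q mod int (n q) = (c x q + c y q) mod int (n q)"
    if x: "x \<in> A" and y: "y \<in> A" and q: "q \<in> ?Q" for x y q
  proof -
    \<comment> \<open>The defect of additivity is a relation among the generators. Its value comes
      from \<open>below \<one>\<close>, and \<open>\<one>\<close> is below every index, so all its
      coefficients are divisible by the orders.\<close>
    let ?d = "\<lambda>q. c (x \<otimes> y) q + (-1) * (c x q + c y q)"
    have "int_comb T w (\<lambda>q. c x q + c y q) ?Q = (x \<otimes> t) \<otimes> (y \<otimes> t)"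
      using T.int_comb_add[OF wc, of "c x" "c y"] c[OF x] c[OF y] by simp
    also have "\<dots> = int_comb T w (c (x \<otimes> y)) ?Q"
      using translate_mult[OF t_idem Ac[OF x] Ac[OF y]] c[OF A(4)[OF x y]] by simp
    finally have e: "int_comb T w (\<lambda>q. c x q + c y q) ?Q = int_comb T w (c (x \<otimes> y)) ?Q" .
    have "int_comb T w ?d ?Q = int_comb T w (c (x \<otimes> y)) ?Q \<otimes>\<^bsub>T\<^esub> int_comb T w (\<lambda>q. (-1) * (c x q + c y q)) ?Q"
      by (rule T.int_comb_add[OF wc])
    also have "\<dots> = int_comb T w (c (x \<otimes> y)) ?Q \<otimes>\<^bsub>T\<^esub> int_comb T w (c (x \<otimes> y)) ?Q [^]\<^bsub>T\<^esub> (-1 :: int)"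
      unfolding T.int_comb_scale[OF finQ wc] e ..
    also have "\<dots> = \<one>\<^bsub>T\<^esub>"
      using T.int_comb_closed[OF wc] by (simp only: T.int_pow_neg T.int_pow_1 T.r_inv)
    finally have "int_comb T w ?d ?Q = \<one> \<otimes> t" using E_closed[OF t_mem] by simp
    moreover have "\<one> \<in> below \<one>" by (rule idempotent_mem_below[OF one_idempotent])
    ultimately have "int_comb T w ?d ?Q \<in> translate t (below \<one>)" unfolding translate_def by simp
    then have "int (n q) dvd ?d q"
      using ind[OF E_one _ q] E_closed[OF DE(1), of "fst q"] q by auto
    moreover have "?d q = c (x \<otimes> y) q - (c x q + c y q)" by simp
    ultimately show ?thesis by (simp only: mod_eq_dvd_iff)
  qed
  have supp_le: "supp (x \<otimes> y) \<otimes> m = m \<longleftrightarrow> supp x \<otimes> m = m \<and> supp y \<otimes> m = m"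
    if "x \<in> A" "y \<in> A" "m \<in> D" for x y m
    using order_ideal_mult_iff[OF order_ideal_below[of m] Ac[OF that(1)] Ac[OF that(2)]]
      Ac[OF that(1)] Ac[OF that(2)] DE[OF that(3)] by (simp add: below_def E_def)
  have \<iota>: "\<iota> \<in> monoid_homs (G\<lparr>carrier := A\<rparr>) ?B"
    unfolding monoid_homs_def
  proof (intro CollectI conjI homI)
    fix x assume "x \<in> carrier (G\<lparr>carrier := A\<rparr>)"
    then have x: "x \<in> A" by simp
    have "co x q \<in> carrier (adjoin_identity (integer_mod_group (n q)))" if "q \<in> ?Q" for q
      using w(2)[OF that] by (simp add: co_def carrier_integer_mod_group)
    then show "\<iota> x \<in> carrier ?B" using hQ by (simp add: \<iota>_def)
    fix y assume "y \<in> carrier (G\<lparr>carrier := A\<rparr>)"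
    then have y: "y \<in> A" by simp
    have "co (x \<otimes> y) q = co x q \<otimes>\<^bsub>adjoin_identity (integer_mod_group (n q))\<^esub> co y q" if q: "q \<in> ?Q" for q
    proof -
      have sl: "supp (x \<otimes> y) \<otimes> fst q = fst q \<longleftrightarrow> supp x \<otimes> fst q = fst q \<and> supp y \<otimes> fst q = fst q"
        using supp_le[OF x y] q by auto
      \<comment> \<open>If exactly one of the two coordinates is \<open>None\<close>, the
        corresponding residue is 0, and adding it does not change the residue of the other.\<close>
      have "c x q mod int (n q) = 0" if "supp x \<otimes> fst q = fst q" using absorbed[OF x q that] by simp
      moreover have "c y q mod int (n q) = 0" if "supp y \<otimes> fst q = fst q" using absorbed[OF y q that] by simp
      moreover have "c (x \<otimes> y) q mod int (n q) = (c x q mod int (n q) + c y q mod int (n q)) mod int (n q)"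
        using additive[OF x y q] by (simp add: mod_add_eq)
      ultimately show ?thesis unfolding co_def sl by simp
    qed
    from this[OF hQ] show "\<iota> (x \<otimes>\<^bsub>G\<lparr>carrier := A\<rparr>\<^esub> y) = \<iota> x \<otimes>\<^bsub>?B\<^esub> \<iota> y"
      by (intro ext) (simp add: \<iota>_def restrict_def)
  next
    have "supp \<one> = \<one>" by (rule supp_of_idempotent[OF one_idempotent])
    then have "co \<one> q = None" if "q \<in> ?Q" for q
      using that E_closed[OF DE(1), of "fst q"] by (auto simp: co_def)
    from this[OF hQ] show "\<iota> \<one>\<^bsub>G\<lparr>carrier := A\<rparr>\<^esub> = \<one>\<^bsub>?B\<^esub>"
      by (intro ext) (simp add: \<iota>_def restrict_def)
  qed
  have "\<psi> (\<iota> x) = x" if x: "x \<in> A" for x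
  proof -
    let ?e = "supp x"
    define u where "u q = cyclic_map (supp (b q)) (b q) (co x q)" for q
    define z where "z = finprod G u ?Q"
    have u: "u q = (if ?e \<otimes> fst q = fst q then \<one> else b q [^]\<^bsub>C q\<^esub> (c x q mod int (n q)))" for q
      by (simp add: u_def cyclic_map_def co_def C_def)
    have ub: "u q \<in> below ?e" if q: "q \<in> ?Q" for q
    proof (cases "?e \<otimes> fst q = fst q")
      case True
      then show ?thesis using u order_ideal_one[OF order_ideal_below[OF supp(1)[OF Ac[OF x]]]] by simp
    next
      case False
      then have "stratum (fst q) \<subseteq> below ?e"
        using suppE[OF x] unfolding stratum_def above_def by blast
      then have "b q \<in> below ?e" using bS[OF q] by blast
      then show ?thesis using False u b_pow_mem[OF q] by (simp add: below_def)
    qed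
    have uQ: "u \<in> ?Q \<rightarrow> below ?e" using ub by blast
    have uC: "u \<in> ?Q \<rightarrow> carrier G" using ub by (auto simp: below_def)
    have uT: "u \<in> ?Q \<rightarrow> below t" using ub below_E_t[OF suppE[OF x]] by blast
    have \<psi>z: "\<psi> (\<iota> x) = z"
    proof -
      have "z = finprod G u (h ` {..<?k})" using h by (simp add: z_def bij_betw_def)
      also have "\<dots> = finprod G (\<lambda>i. u (h i)) {..<?k}"
        by (rule finprod_reindex) (use h uC in \<open>auto simp: bij_betw_def\<close>)
      also have "\<dots> = \<psi> (\<iota> x)" unfolding \<psi>_def
        by (rule finprod_cong') (use uC hQ in \<open>auto simp: u_def \<iota>_def\<close>)
      finally show ?thesis by simp
    qed
    have zc: "z \<in> carrier G" unfolding z_def by (rule finprod_closed[OF uC])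
    have ze: "z \<in> below ?e"
      unfolding z_def using order_ideal_finprod_iff[OF order_ideal_below[OF supp(1)[OF Ac[OF x]]] finQ uC] ub by blast
    have oz: "order_ideal (below (supp z))" by (rule order_ideal_below[OF supp(1)[OF zc]])
    have zz: "z \<in> below (supp z)" using zc by (simp add: below_def)
    have "g ?e m \<in> below (supp z)" if m: "m \<in> strata ?e" for m
    proof -
      have mD: "m \<in> D" using strata_D[OF suppE[OF x]] m by blast
      \<comment> \<open>A generator at \<open>m\<close> is present because
        \<open>\<one> \<in> A\<close>. Its entry in \<open>\<iota> x\<close> is not
        \<open>None\<close>, so it contributes its full support to \<open>z\<close> even if its
        coordinate is 0.\<close>
      have q: "(m, \<one>) \<in> ?Q" using mD A(3) by simp
      have "u (m, \<one>) \<in> below (supp z)"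
        using zz order_ideal_finprod_iff[OF oz finQ uC] q unfolding z_def by blast
      moreover have "?e \<otimes> m \<noteq> m" using m by (simp add: strata_def)
      ultimately have "b (m, \<one>) \<in> below (supp z)"
        using u[of "(m, \<one>)"] b_pow_mem[OF q] bc[OF q] by (simp add: below_def)
      then have "supp (F m) \<in> below (supp z)"
        using order_ideal_mult_iff[OF oz b0c[OF q] supp_closed[OF Fc]] by (simp add: b_def)
      then have "F m \<in> below (supp z)" using order_ideal_supp_iff[OF oz Fc] by simp
      then have "(if m \<in> strata ?e then g ?e m else \<one>) \<in> below (supp z)"
        using order_ideal_finprod_iff[OF oz E(1) gC] suppE[OF x] unfolding F_def by blast
      then show ?thesis using m by simp
    qed
    moreover have gx: "g ?e \<in> Pi (strata ?e) stratum" "?e = finprod G (g ?e) (strata ?e)"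
      using g[OF suppE[OF x]] by blast+
    moreover have "g ?e \<in> strata ?e \<rightarrow> carrier G"
      using gx(1) order_ideal_closed[OF order_ideal_stratum] by blast
    ultimately have "?e \<in> below (supp z)"
      using order_ideal_finprod_iff[OF oz finite_strata] by metis
    then have 1: "?e \<otimes> supp z = supp z"
      using idempotent_mem_below_iff[OF supp(1)[OF Ac[OF x]] supp(1)[OF zc]] by simp
    have 2: "supp z \<otimes> ?e = ?e" using ze by (simp add: below_def)
    have sz: "supp z = ?e" using 1 2 m_comm[OF supp_closed[OF zc] supp_closed[OF Ac[OF x]]] by simp
    \<comment> \<open>With equal supports it remains to compare the images of \<open>z\<close> and
      \<open>x\<close> in the group of \<open>t\<close>, where the coordinates reproduce
      \<open>x \<otimes> t\<close>.\<close>
    have "z \<otimes> t = finprod T (\<lambda>q. u q \<otimes> t) ?Q"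
      unfolding z_def by (rule translate_finprod[OF t_idem finQ uT])
    also have "\<dots> = int_comb T w (c x) ?Q"
      unfolding int_comb_def
    proof (rule T.finprod_cong')
      show "(\<lambda>q. w q [^]\<^bsub>T\<^esub> c x q) \<in> ?Q \<rightarrow> carrier T" using wc T.int_pow_closed by blast
      fix q assume q: "q \<in> ?Q"
      have wq: "w q \<in> carrier T" using wc q by blast
      note md = T.int_pow_mod[OF wq w(3)[OF q], of "c x q"]
      show "u q \<otimes> t = w q [^]\<^bsub>T\<^esub> c x q"
      proof (cases "?e \<otimes> fst q = fst q")
        case True
        then have "w q [^]\<^bsub>T\<^esub> c x q = w q [^]\<^bsub>T\<^esub> (0::int)" using md absorbed[OF x q True] by simp
        then show ?thesis using True u E_closed[OF t_mem] by simp
      next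
        case False
        then show ?thesis using u b_pow[OF q] md by simp
      qed
    qed simp
    finally have "z \<otimes> t = x \<otimes> t" using c[OF x] by simp
    then have "z = x"
      using translation_inject[OF zc Ac[OF x] sz t_idem] sz supp_t(2)[OF x] by simp
    then show ?thesis using \<psi>z by simp
  qed
  then show ?thesis
    using \<psi> \<iota> w(2)[OF hQ]
    by (intro exI[of _ ?k] exI[of _ "\<lambda>i. n (h i)"] exI[of _ \<iota>] exI[of _ \<psi>]) blast
qed

end

section \<open>Direct limits of finite sums of cyclic monoids\<close>

lemma monoid_homsD:
  assumes "h \<in> monoid_homs G H"
  shows "x \<in> carrier G \<Longrightarrow> h x \<in> carrier H"
    "x \<in> carrier G \<Longrightarrow> y \<in> carrier G \<Longrightarrow> h (x \<otimes>\<^bsub>G\<^esub> y) = h x \<otimes>\<^bsub>H\<^esub> h y"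
    "h \<one>\<^bsub>G\<^esub> = \<one>\<^bsub>H\<^esub>"
  using assms unfolding monoid_homs_def hom_def by auto

lemma monoid_homs_pow:
  assumes h: "h \<in> monoid_homs G H" and G: "comm_monoid G" and H: "comm_monoid H" and x: "x \<in> carrier G"
  shows "h (x [^]\<^bsub>G\<^esub> (n::nat)) = h x [^]\<^bsub>H\<^esub> n"
proof -
  interpret G: comm_monoid G by (rule G)
  interpret H: comm_monoid H by (rule H)
  show ?thesis
  proof (induction n)
    case (Suc n)
    then show ?case using monoid_homsD(2)[OF h G.nat_pow_closed[OF x] x] by simp
  qed (simp add: monoid_homsD(3)[OF h])
qed

text \<open>\<open>g\<close> has to respect only the sums that stay inside \<open>S\<close>: from a
  direct limit to one of its stages, finitely many equations can be lifted at a time.\<close>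

definition partial_section ::
    "('a, 'm) monoid_scheme \<Rightarrow> ('b, 'n) monoid_scheme \<Rightarrow> 'a set \<Rightarrow> ('b \<Rightarrow> 'a) \<Rightarrow> ('a \<Rightarrow> 'b) \<Rightarrow> bool"
  where "partial_section M N S \<psi> g \<longleftrightarrow> \<psi> \<in> monoid_homs N M \<and>
    (\<forall>x\<in>S. g x \<in> carrier N \<and> \<psi> (g x) = x) \<and>
    (\<forall>x\<in>S. \<forall>y\<in>S. x \<otimes>\<^bsub>M\<^esub> y \<in> S \<longrightarrow> g (x \<otimes>\<^bsub>M\<^esub> y) = g x \<otimes>\<^bsub>N\<^esub> g y) \<and>
    (\<one>\<^bsub>M\<^esub> \<in> S \<longrightarrow> g \<one>\<^bsub>M\<^esub> = \<one>\<^bsub>N\<^esub>)"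

lemma partial_sectionD:
  assumes "partial_section M N S \<psi> g"
  shows "\<psi> \<in> monoid_homs N M" "\<forall>a\<in>S. g a \<in> carrier N" "\<forall>a\<in>S. \<psi> (g a) = a"
    "a \<in> S \<Longrightarrow> b \<in> S \<Longrightarrow> c \<in> S \<Longrightarrow> a \<otimes>\<^bsub>M\<^esub> b = c \<Longrightarrow> g a \<otimes>\<^bsub>N\<^esub> g b = g c"
    "\<one>\<^bsub>M\<^esub> \<in> S \<Longrightarrow> g \<one>\<^bsub>M\<^esub> = \<one>\<^bsub>N\<^esub>"
  using assms unfolding partial_section_def by auto

text \<open>Each condition says that equations between given elements entail further equations,
  possibly with new elements. The given equations are copied to \<open>N\<close> by
  \<open>g\<close>, solved there, and the solution is carried back by \<open>\<psi>\<close>. This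
  covers isomorphisms and direct limits alike.\<close>

theorem periodic_refinement_monoid_by_lifting:
  fixes M :: "('a, 'm) monoid_scheme"
  assumes M: "comm_monoid M"
    and lift: "\<And>S. finite S \<Longrightarrow> S \<subseteq> carrier M \<Longrightarrow> \<exists>(N :: ('b, 'n) monoid_scheme) \<psi> g.
      periodic_refinement_monoid N \<and> partial_section M N S \<psi> g"
  shows "periodic_refinement_monoid M"
proof -
  interpret M: comm_monoid M by (rule M)
  show ?thesis
  proof (intro periodic_refinement_monoid.intro periodic_refinement_monoid_axioms.intro)
    show "comm_monoid M" by (rule M)
    show "strongly_periodic M"
      unfolding strongly_periodic_def
    proof
      fix x assume x: "x \<in> carrier M"
      obtain N :: "('b, 'n) monoid_scheme" and \<psi> g where N: "periodic_refinement_monoid N"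
        and sec: "partial_section M N {x} \<psi> g" using lift[of "{x}"] x by blast
      note \<psi> = partial_sectionD(1)[OF sec]
      have g: "g x \<in> carrier N" "\<psi> (g x) = x" using partial_sectionD(2,3)[OF sec] by simp_all
      interpret N: periodic_refinement_monoid N by (rule N)
      obtain m :: nat where m: "0 < m" "g x [^]\<^bsub>N\<^esub> (m + 1) = g x"
        using N.strongly_periodic g(1) unfolding strongly_periodic_def by blast
      have "x [^]\<^bsub>M\<^esub> (m + 1) = x"
        using monoid_homs_pow[OF \<psi> N.comm_monoid_axioms M g(1), of "m + 1"] m(2) g(2) by simp
      then show "\<exists>m::nat. 0 < m \<and> x [^]\<^bsub>M\<^esub> (m + 1) = x" using m(1) by blast
    qed
    show "conical M"
      unfolding conical_def
    proof (intro ballI impI)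
      fix x y assume x: "x \<in> carrier M" and y: "y \<in> carrier M" and xy: "x \<otimes>\<^bsub>M\<^esub> y = \<one>\<^bsub>M\<^esub>"
      have "finite {x, y, \<one>\<^bsub>M\<^esub>}" "{x, y, \<one>\<^bsub>M\<^esub>} \<subseteq> carrier M" using x y by auto
      from lift[OF this] obtain N :: "('b, 'n) monoid_scheme" and \<psi> g where N: "periodic_refinement_monoid N"
        and sec: "partial_section M N {x, y, \<one>\<^bsub>M\<^esub>} \<psi> g" by blast
      note \<psi> = partial_sectionD(1)[OF sec] and gc = partial_sectionD(2)[OF sec] and g = partial_sectionD(3)[OF sec]
        and gm = partial_sectionD(4)[OF sec] and g1 = partial_sectionD(5)[OF sec]
      interpret N: periodic_refinement_monoid N by (rule N)
      have "g x \<otimes>\<^bsub>N\<^esub> g y = \<one>\<^bsub>N\<^esub>" using gm[OF _ _ _ xy] g1 by simp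
      then have "g x = \<one>\<^bsub>N\<^esub>" "g y = \<one>\<^bsub>N\<^esub>" using N.conical gc unfolding conical_def by blast+
      then show "x = \<one>\<^bsub>M\<^esub> \<and> y = \<one>\<^bsub>M\<^esub>" using g g1 by (metis insertI1 insertI2)
    qed
    show "refinement_monoid M"
      unfolding refinement_monoid_def
    proof (intro ballI impI)
      fix x1 x2 y1 y2
      assume c: "x1 \<in> carrier M" "x2 \<in> carrier M" "y1 \<in> carrier M" "y2 \<in> carrier M"
        and eq: "x1 \<otimes>\<^bsub>M\<^esub> x2 = y1 \<otimes>\<^bsub>M\<^esub> y2"
      let ?S = "{x1, x2, y1, y2, x1 \<otimes>\<^bsub>M\<^esub> x2}"
      have "finite ?S" "?S \<subseteq> carrier M" using c by auto
      from lift[OF this] obtain N :: "('b, 'n) monoid_scheme" and \<psi> g where N: "periodic_refinement_monoid N"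
        and sec: "partial_section M N ?S \<psi> g" by blast
      note \<psi> = partial_sectionD(1)[OF sec] and gc = partial_sectionD(2)[OF sec] and g = partial_sectionD(3)[OF sec]
        and gm = partial_sectionD(4)[OF sec] and g1 = partial_sectionD(5)[OF sec]
      interpret N: periodic_refinement_monoid N by (rule N)
      have "g x1 \<otimes>\<^bsub>N\<^esub> g x2 = g y1 \<otimes>\<^bsub>N\<^esub> g y2"
        using gm[OF _ _ _ eq[symmetric]] gm[OF _ _ _ refl, of x1 x2] by simp
      then obtain z11 z12 z21 z22 where z: "z11 \<in> carrier N" "z12 \<in> carrier N" "z21 \<in> carrier N" "z22 \<in> carrier N"
        and e: "g x1 = z11 \<otimes>\<^bsub>N\<^esub> z12" "g x2 = z21 \<otimes>\<^bsub>N\<^esub> z22" "g y1 = z11 \<otimes>\<^bsub>N\<^esub> z21" "g y2 = z12 \<otimes>\<^bsub>N\<^esub> z22"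
        using N.refine[of "g x1" "g x2" "g y1" "g y2"] gc by (metis insertI1 insertI2)
      have "x1 = \<psi> z11 \<otimes>\<^bsub>M\<^esub> \<psi> z12" "x2 = \<psi> z21 \<otimes>\<^bsub>M\<^esub> \<psi> z22"
        "y1 = \<psi> z11 \<otimes>\<^bsub>M\<^esub> \<psi> z21" "y2 = \<psi> z12 \<otimes>\<^bsub>M\<^esub> \<psi> z22"
        using g z e monoid_homsD(2)[OF \<psi>] by (metis insertI1 insertI2)+
      then show "\<exists>z11\<in>carrier M. \<exists>z12\<in>carrier M. \<exists>z21\<in>carrier M. \<exists>z22\<in>carrier M.
         x1 = z11 \<otimes>\<^bsub>M\<^esub> z12 \<and> x2 = z21 \<otimes>\<^bsub>M\<^esub> z22 \<and> y1 = z11 \<otimes>\<^bsub>M\<^esub> z21 \<and> y2 = z12 \<otimes>\<^bsub>M\<^esub> z22"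
        using z monoid_homsD(1)[OF \<psi>] by blast
    qed
    show "groups_embed_purely M"
      unfolding M.groups_embed_purely_iff
    proof (intro ballI impI conjI allI)
      fix e f assume e: "e \<in> idempotents M" and f: "f \<in> idempotents M" and ef: "e \<otimes>\<^bsub>M\<^esub> f = f"
      have ec: "e \<in> carrier M" "f \<in> carrier M" "e \<otimes>\<^bsub>M\<^esub> e = e" "f \<otimes>\<^bsub>M\<^esub> f = f"
        using e f by (simp_all add: idempotents_def)
      {
        fix x y assume "x \<in> carrier (idem_group M e)" "y \<in> carrier (idem_group M e)"
          and eq: "x \<otimes>\<^bsub>M\<^esub> f = y \<otimes>\<^bsub>M\<^esub> f"
        then obtain w v where x: "x \<in> carrier M" "e \<otimes>\<^bsub>M\<^esub> x = x" "w \<in> carrier M" "x \<otimes>\<^bsub>M\<^esub> w = e"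
          and y: "y \<in> carrier M" "e \<otimes>\<^bsub>M\<^esub> y = y" "v \<in> carrier M" "y \<otimes>\<^bsub>M\<^esub> v = e"
          unfolding M.idem_group_carrier_iff[OF e] by blast
        \<comment> \<open>The local inverses \<open>w\<close> and \<open>v\<close> turn membership
          in the group of \<open>e\<close> into equations. The common translate is listed so that
          \<open>g\<close> respects both sums leading to it.\<close>
        let ?S = "{e, f, x, y, w, v, x \<otimes>\<^bsub>M\<^esub> f}"
        have "finite ?S" "?S \<subseteq> carrier M" using ec x y by auto
        from lift[OF this] obtain N :: "('b, 'n) monoid_scheme" and \<psi> g where N: "periodic_refinement_monoid N"
          and sec: "partial_section M N ?S \<psi> g" by blast
        note \<psi> = partial_sectionD(1)[OF sec] and gc = partial_sectionD(2)[OF sec] and g = partial_sectionD(3)[OF sec]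
          and gm = partial_sectionD(4)[OF sec] and g1 = partial_sectionD(5)[OF sec]
        interpret N: periodic_refinement_monoid N by (rule N)
        have ge: "g e \<in> idempotents N" and gf: "g f \<in> idempotents N"
          using gm[OF _ _ _ ec(3)] gm[OF _ _ _ ec(4)] gc by (simp_all add: idempotents_def)
        have "g x \<in> carrier (idem_group N (g e))" "g y \<in> carrier (idem_group N (g e))"
          using gm[OF _ _ _ x(2)] gm[OF _ _ _ y(2)] gm[OF _ _ _ x(4)] gm[OF _ _ _ y(4)] gc
          unfolding N.idem_group_carrier_iff[OF ge] by auto
        moreover have "g e \<otimes>\<^bsub>N\<^esub> g f = g f" using gm[OF _ _ _ ef] by simp
        moreover have "g x \<otimes>\<^bsub>N\<^esub> g f = g y \<otimes>\<^bsub>N\<^esub> g f"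
          using gm[OF _ _ _ eq[symmetric]] gm[OF _ _ _ refl, of x f] by simp
        ultimately have "g x = g y" using N.embed ge gf unfolding N.groups_embed_purely_iff by blast
        then show "x = y" using g by (metis insertI1 insertI2)
      next
        fix x y and n :: nat
        assume "x \<in> carrier (idem_group M e)" "y \<in> carrier (idem_group M f)"
          and n: "0 < n" and eq: "y [^]\<^bsub>M\<^esub> n = x \<otimes>\<^bsub>M\<^esub> f"
        then obtain w v where x: "x \<in> carrier M" "e \<otimes>\<^bsub>M\<^esub> x = x" "w \<in> carrier M" "x \<otimes>\<^bsub>M\<^esub> w = e"
          and y: "y \<in> carrier M" "f \<otimes>\<^bsub>M\<^esub> y = y" "v \<in> carrier M" "y \<otimes>\<^bsub>M\<^esub> v = f"
          unfolding M.idem_group_carrier_iff[OF e] M.idem_group_carrier_iff[OF f] by blast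
        \<comment> \<open>All powers of \<open>y\<close> up to \<open>n\<close> are listed, since
          \<open>g\<close> reaches the \<open>n\<close>-th power only through successive products
          that stay inside the set.\<close>
        let ?S = "{e, f, x, y, w, v} \<union> (\<lambda>i. y [^]\<^bsub>M\<^esub> (i::nat)) ` {..n}"
        have "finite ?S" "?S \<subseteq> carrier M" using ec x y by auto
        from lift[OF this] obtain N :: "('b, 'n) monoid_scheme" and \<psi> g where N: "periodic_refinement_monoid N"
          and sec: "partial_section M N ?S \<psi> g" by blast
        note \<psi> = partial_sectionD(1)[OF sec] and gc = partial_sectionD(2)[OF sec] and g = partial_sectionD(3)[OF sec]
          and gm = partial_sectionD(4)[OF sec] and g1 = partial_sectionD(5)[OF sec]
        interpret N: periodic_refinement_monoid N by (rule N)
        have ge: "g e \<in> idempotents N" and gf: "g f \<in> idempotents N"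
          using gm[OF _ _ _ ec(3)] gm[OF _ _ _ ec(4)] gc by (simp_all add: idempotents_def)
        have gx: "g x \<in> carrier (idem_group N (g e))"
          using gm[OF _ _ _ x(2)] gm[OF _ _ _ x(4)] gc unfolding N.idem_group_carrier_iff[OF ge] by auto
        have gy: "g y \<in> carrier (idem_group N (g f))"
          using gm[OF _ _ _ y(2)] gm[OF _ _ _ y(4)] gc unfolding N.idem_group_carrier_iff[OF gf] by auto
        have gef: "g e \<otimes>\<^bsub>N\<^esub> g f = g f" using gm[OF _ _ _ ef] by simp
        have pow: "y [^]\<^bsub>M\<^esub> i \<in> ?S" if "i \<le> n" for i using that by simp
        have "g (y [^]\<^bsub>M\<^esub> i) = g y [^]\<^bsub>N\<^esub> i" if "i \<le> n" for i
          using that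
        proof (induction i)
          case 0
          have "\<one>\<^bsub>M\<^esub> \<in> ?S" using pow[of 0] by simp
          then have "g \<one>\<^bsub>M\<^esub> = \<one>\<^bsub>N\<^esub>" by (rule g1)
          then show ?case by simp
        next
          case (Suc i)
          have "g (y [^]\<^bsub>M\<^esub> i) \<otimes>\<^bsub>N\<^esub> g y = g (y [^]\<^bsub>M\<^esub> Suc i)"
            by (rule gm) (use pow[of i] pow[OF Suc.prems] Suc.prems in simp_all)
          then show ?case using Suc by simp
        qed
        then have "g y [^]\<^bsub>N\<^esub> n = g (y [^]\<^bsub>M\<^esub> n)" by simp
        also have "\<dots> = g x \<otimes>\<^bsub>N\<^esub> g f" by (rule gm[symmetric]) (use pow[of n] eq in simp_all)
        finally obtain z where z: "z \<in> carrier (idem_group N (g e))" "z [^]\<^bsub>N\<^esub> n = g x"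
          using N.embed ge gf gef gx gy n unfolding N.groups_embed_purely_iff by blast
        then obtain u where zu: "z \<in> carrier N" "g e \<otimes>\<^bsub>N\<^esub> z = z" "u \<in> carrier N" "z \<otimes>\<^bsub>N\<^esub> u = g e"
          unfolding N.idem_group_carrier_iff[OF ge] by blast
        have gg: "\<psi> (g e) = e" "\<psi> (g x) = x" "g e \<in> carrier N" using g gc by simp_all
        have "e \<otimes>\<^bsub>M\<^esub> \<psi> z = \<psi> z" using monoid_homsD(2)[OF \<psi> gg(3) zu(1)] zu(2) gg(1) by simp
        moreover have "\<psi> z \<otimes>\<^bsub>M\<^esub> \<psi> u = e" using monoid_homsD(2)[OF \<psi> zu(1,3)] zu(4) gg(1) by simp
        ultimately have "\<psi> z \<in> carrier (idem_group M e)"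
          unfolding M.idem_group_carrier_iff[OF e] using monoid_homsD(1)[OF \<psi>] zu(1,3) by blast
        moreover have "\<psi> z [^]\<^bsub>M\<^esub> n = x"
          using monoid_homs_pow[OF \<psi> N.comm_monoid_axioms M zu(1), of n] z(2) gg(2) by simp
        ultimately show "\<exists>z\<in>carrier (idem_group M e). z [^]\<^bsub>M\<^esub> n = x" by blast
      }
    qed
  qed
qed

section \<open>Invariance under isomorphism\<close>

lemma iso_one:
  assumes G: "comm_monoid G" and H: "comm_monoid H" and h: "h \<in> iso G H"
  shows "h \<one>\<^bsub>G\<^esub> = \<one>\<^bsub>H\<^esub>"
proof -
  interpret G: comm_monoid G by (rule G)
  interpret H: comm_monoid H by (rule H)
  have hh: "h \<in> hom G H" using h by (simp add: iso_def)
  have "\<one>\<^bsub>H\<^esub> \<in> h ` carrier G" using h by (simp add: iso_def bij_betw_def)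
  \<comment> \<open>Surjectivity provides a preimage \<open>a\<close> of the identity of
    \<open>H\<close>; multiplying it by the identity of \<open>G\<close> forces the two images to
    agree.\<close>
  then obtain a where a: "a \<in> carrier G" "\<one>\<^bsub>H\<^esub> = h a" by (rule imageE)
  have "h \<one>\<^bsub>G\<^esub> = h a \<otimes>\<^bsub>H\<^esub> h \<one>\<^bsub>G\<^esub>"
    unfolding a(2)[symmetric] by (rule H.l_one[OF hom_in_carrier[OF hh G.one_closed], symmetric])
  also have "\<dots> = h a" using hom_mult[OF hh a(1) G.one_closed] G.r_one[OF a(1)] by simp
  finally show ?thesis using a(2) by (rule trans[OF _ sym])
qed

lemma iso_monoid_homs:
  assumes "comm_monoid G" "comm_monoid H" "h \<in> iso G H"
  shows "h \<in> monoid_homs G H" "inv_into (carrier G) h \<in> monoid_homs H G"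
proof -
  interpret G: comm_monoid G by (rule assms(1))
  let ?i = "inv_into (carrier G) h"
  have hh: "h \<in> hom G H" and b: "bij_betw h (carrier G) (carrier H)" using assms(3) by (simp_all add: iso_def)
  show "h \<in> monoid_homs G H" using iso_one[OF assms] hh by (simp add: monoid_homs_def)
  have i: "?i y \<in> carrier G" "h (?i y) = y" if "y \<in> carrier H" for y
    using b that by (simp_all add: bij_betw_def inv_into_into f_inv_into_f)
  have hi: "?i (h x) = x" if "x \<in> carrier G" for x
    using b that by (simp add: bij_betw_def)
  show "?i \<in> monoid_homs H G"
    unfolding monoid_homs_def
  proof (intro CollectI conjI homI)
    fix x y assume x: "x \<in> carrier H" and y: "y \<in> carrier H"
    have "?i (h (?i x \<otimes>\<^bsub>G\<^esub> ?i y)) = ?i x \<otimes>\<^bsub>G\<^esub> ?i y" using i(1) x y by (intro hi) simp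
    moreover have "h (?i x \<otimes>\<^bsub>G\<^esub> ?i y) = x \<otimes>\<^bsub>H\<^esub> y"
      unfolding hom_mult[OF hh i(1)[OF x] i(1)[OF y]] i(2)[OF x] i(2)[OF y] ..
    ultimately show "?i (x \<otimes>\<^bsub>H\<^esub> y) = ?i x \<otimes>\<^bsub>G\<^esub> ?i y" by simp
  next
    show "?i \<one>\<^bsub>H\<^esub> = \<one>\<^bsub>G\<^esub>" using hi[OF G.one_closed] iso_one[OF assms] by simp
  qed (use i in simp)
qed

lemma periodic_refinement_monoid_iso:
  fixes G :: "('a, 'm) monoid_scheme" and H :: "('b, 'n) monoid_scheme"
  assumes G: "comm_monoid G" and H: "periodic_refinement_monoid H" and "G \<cong> H"
  shows "periodic_refinement_monoid G"
proof (rule periodic_refinement_monoid_by_lifting[OF G])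
  have Hc: "comm_monoid H" using H by (rule periodic_refinement_monoid.axioms)
  obtain h where h: "h \<in> iso G H" using assms(3) unfolding is_iso_def by blast
  fix S assume S: "finite S" "S \<subseteq> carrier G"
  note hom = monoid_homsD[OF iso_monoid_homs(1)[OF G Hc h]]
  have c: "x \<in> carrier G" if "x \<in> S" for x using S(2) that by blast
  have inv: "inv_into (carrier G) h (h x) = x" if "x \<in> S" for x
    using h c[OF that] by (simp add: iso_def bij_betw_def)
  have "partial_section G H S (inv_into (carrier G) h) h"
    unfolding partial_section_def
  proof (intro conjI ballI impI)
    show "inv_into (carrier G) h \<in> monoid_homs H G" by (rule iso_monoid_homs(2)[OF G Hc h])
    show "h \<one>\<^bsub>G\<^esub> = \<one>\<^bsub>H\<^esub>" by (rule hom(3))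
    fix x assume x: "x \<in> S"
    show "h x \<in> carrier H" by (rule hom(1)[OF c[OF x]])
    show "inv_into (carrier G) h (h x) = x" by (rule inv[OF x])
    fix y assume y: "y \<in> S"
    show "h (x \<otimes>\<^bsub>G\<^esub> y) = h x \<otimes>\<^bsub>H\<^esub> h y" by (rule hom(2)[OF c[OF x] c[OF y]])
  qed
  then show "\<exists>(N :: ('b, 'n) monoid_scheme) \<psi> g. periodic_refinement_monoid N \<and> partial_section G N S \<psi> g"
    using H by blast
qed

section \<open>Passage to direct limits\<close>

context directed_system
begin

lemma limit_lift_elements:
  assumes "finite S" "S \<subseteq> carrier (direct_limit I r N f)"
  shows "\<exists>k\<in>I. \<exists>g. \<forall>x\<in>S. g x \<in> carrier (N k) \<and> limit_map I r N f k (g x) = x"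
  using assms
proof (induction S)
  case empty
  then show ?case using nonempty by auto
next
  case (insert a S)
  have "\<exists>k\<in>I. \<exists>g. \<forall>x\<in>S. g x \<in> carrier (N k) \<and> limit_map I r N f k (g x) = x"
    by (rule insert.IH) (use insert.prems in simp)
  then obtain k g where k: "k \<in> I" and g: "\<And>x. x \<in> S \<Longrightarrow> g x \<in> carrier (N k) \<and> limit_map I r N f k (g x) = x"
    by blast
  obtain j b where j: "j \<in> I" "b \<in> carrier (N j)" "a = limit_map I r N f j b"
    using insert.prems unfolding carrier_direct_limit by blast
  obtain l where l: "l \<in> I" "(k, l) \<in> r" "(j, l) \<in> r" using directed[OF k j(1)] by blast
  let ?g = "\<lambda>x. if x = a then f j l b else f k l (g x)"
  have "?g x \<in> carrier (N l) \<and> limit_map I r N f l (?g x) = x" if "x \<in> insert a S" for x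
  proof (cases "x = a")
    case True
    then show ?thesis using f_closed[OF l(3) j(2)] limit_map_compat[OF l(3) j(2)] j(3) by simp
  next
    case False
    then have "g x \<in> carrier (N k)" "limit_map I r N f k (g x) = x" using g[of x] that by simp_all
    then show ?thesis using False f_closed[OF l(2)] limit_map_compat[OF l(2)] by simp
  qed
  then have "\<forall>x\<in>insert a S. ?g x \<in> carrier (N l) \<and> limit_map I r N f l (?g x) = x" by (rule ballI)
  then show ?case by (intro bexI[OF _ l(1)] exI[of _ ?g])
qed

lemma limit_lift_equations:
  assumes "finite R" and k: "k \<in> I"
    and "\<And>a b. (a, b) \<in> R \<Longrightarrow> a \<in> carrier (N k) \<and> b \<in> carrier (N k) \<and>
      limit_map I r N f k a = limit_map I r N f k b"
  shows "\<exists>l\<in>I. (k, l) \<in> r \<and> (\<forall>(a, b)\<in>R. f k l a = f k l b)"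
  using assms(1,3)
proof (induction R)
  case empty
  then show ?case using k r_refl by auto
next
  case (insert p R)
  obtain a b where p: "p = (a, b)" by (cases p)
  have "\<exists>l\<in>I. (k, l) \<in> r \<and> (\<forall>(a, b)\<in>R. f k l a = f k l b)"
    by (rule insert.IH) (use insert.prems in blast)
  then obtain l where l: "l \<in> I" "(k, l) \<in> r" "\<forall>(a, b)\<in>R. f k l a = f k l b" by blast
  have ab: "a \<in> carrier (N k)" "b \<in> carrier (N k)" "limit_map I r N f k a = limit_map I r N f k b"
    using insert.prems[of a b] p by auto
  then obtain j where j: "j \<in> I" "(k, j) \<in> r" "f k j a = f k j b"
    using limit_map_eq_iff[OF k ab(1) k ab(2)] by blast
  obtain q where q: "q \<in> I" "(l, q) \<in> r" "(j, q) \<in> r" using directed[OF l(1) j(1)] by blast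
  have "f k q a = f k q b"
    using composition[OF j(2) q(3) ab(1)] composition[OF j(2) q(3) ab(2)] j(3) by simp
  moreover have "f k q c = f k q d" if cd: "(c, d) \<in> R" for c d
  proof -
    have "c \<in> carrier (N k)" "d \<in> carrier (N k)" using insert.prems[of c d] cd by auto
    from composition[OF l(2) q(2) this(1)] composition[OF l(2) q(2) this(2)] show ?thesis
      using l(3) cd by auto
  qed
  ultimately show ?case using q(1) r_trans[OF l(2) q(2)] p by auto
qed

lemma periodic_refinement_monoid_direct_limit:
  assumes N: "\<And>i. i \<in> I \<Longrightarrow> periodic_refinement_monoid (N i)"
  shows "periodic_refinement_monoid (direct_limit I r N f)"
proof (rule periodic_refinement_monoid_by_lifting[OF comm_monoid_direct_limit])
  let ?L = "direct_limit I r N f" and ?l = "limit_map I r N f"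
  fix S assume S: "finite S" "S \<subseteq> carrier ?L"
  obtain k g where k: "k \<in> I" and g: "\<And>x. x \<in> S \<Longrightarrow> g x \<in> carrier (N k) \<and> ?l k (g x) = x"
    using limit_lift_elements[OF S] by blast
  \<comment> \<open>These are the finitely many equations that may still fail for \<open>g\<close>
    at stage \<open>k\<close>. They hold in the limit and hence at a later stage
    \<open>l\<close>.\<close>
  let ?R = "(\<lambda>(x, y). (g (x \<otimes>\<^bsub>?L\<^esub> y), g x \<otimes>\<^bsub>N k\<^esub> g y)) ` {(x, y) \<in> S \<times> S. x \<otimes>\<^bsub>?L\<^esub> y \<in> S} \<union>
    (if \<one>\<^bsub>?L\<^esub> \<in> S then {(g \<one>\<^bsub>?L\<^esub>, \<one>\<^bsub>N k\<^esub>)} else {})"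
  have "finite {(x, y) \<in> S \<times> S. x \<otimes>\<^bsub>?L\<^esub> y \<in> S}"
    by (rule finite_subset[of _ "S \<times> S"]) (use S(1) in auto)
  then have "finite ?R" by simp
  moreover have "a \<in> carrier (N k) \<and> b \<in> carrier (N k) \<and> ?l k a = ?l k b" if "(a, b) \<in> ?R" for a b
  proof -
    consider x y where "x \<in> S" "y \<in> S" "x \<otimes>\<^bsub>?L\<^esub> y \<in> S" "a = g (x \<otimes>\<^bsub>?L\<^esub> y)" "b = g x \<otimes>\<^bsub>N k\<^esub> g y"
      | "\<one>\<^bsub>?L\<^esub> \<in> S" "a = g \<one>\<^bsub>?L\<^esub>" "b = \<one>\<^bsub>N k\<^esub>"
      using \<open>(a, b) \<in> ?R\<close> by (auto split: if_splits)
    then show ?thesis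
    proof cases
      case 1
      then show ?thesis
        using g[OF 1(1)] g[OF 1(2)] g[OF 1(3)] m_closed[OF k] limit_mult_same[OF k, of "g x" "g y"] by simp
    next
      case 2
      then show ?thesis using g[OF 2(1)] one_closed[OF k] limit_one[OF k] by simp
    qed
  qed
  ultimately obtain l where l: "l \<in> I" "(k, l) \<in> r" "\<forall>(a, b)\<in>?R. f k l a = f k l b"
    using limit_lift_equations[OF _ k, of ?R] by blast
  have 1: "f k l (g (x \<otimes>\<^bsub>?L\<^esub> y)) = f k l (g x) \<otimes>\<^bsub>N l\<^esub> f k l (g y)"
    if "x \<in> S" "y \<in> S" "x \<otimes>\<^bsub>?L\<^esub> y \<in> S" for x y
  proof -
    have "(g (x \<otimes>\<^bsub>?L\<^esub> y), g x \<otimes>\<^bsub>N k\<^esub> g y) \<in> ?R" using that by auto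
    then have "f k l (g (x \<otimes>\<^bsub>?L\<^esub> y)) = f k l (g x \<otimes>\<^bsub>N k\<^esub> g y)" using l(3) by blast
    then show ?thesis using f_mult[OF l(2)] g that by simp
  qed
  have 2: "f k l (g \<one>\<^bsub>?L\<^esub>) = \<one>\<^bsub>N l\<^esub>" if "\<one>\<^bsub>?L\<^esub> \<in> S"
  proof -
    have "(g \<one>\<^bsub>?L\<^esub>, \<one>\<^bsub>N k\<^esub>) \<in> ?R" using that by simp
    then have "f k l (g \<one>\<^bsub>?L\<^esub>) = f k l \<one>\<^bsub>N k\<^esub>" using l(3) by blast
    then show ?thesis using f_one[OF l(2)] by simp
  qed
  have 3: "f k l (g x) \<in> carrier (N l) \<and> ?l l (f k l (g x)) = x" if "x \<in> S" for x
    using g[OF that] f_closed[OF l(2)] limit_map_compat[OF l(2)] by simp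
  have "partial_section ?L (N l) S (?l l) (\<lambda>x. f k l (g x))"
    unfolding partial_section_def using limit_map_hom[OF l(1)] 1 2 3 by simp
  then show "\<exists>(K :: 'b monoid) \<psi> h. periodic_refinement_monoid K \<and> partial_section ?L K S \<psi> h"
    using N[OF l(1)] by blast
qed

end

section \<open>Finite direct products, treated componentwise\<close>

lemma (in monoid) periodic_pow:
  assumes "x \<in> carrier G" "x [^] (m + 1) = x"
  shows "x [^] (m * k + 1 :: nat) = x"
proof (induction k)
  case 0
  then show ?case using assms(1) by simp
next
  case (Suc k)
  have "x [^] (m * Suc k + 1) = x [^] (m * k) \<otimes> x [^] (m + 1)"
    using nat_pow_mult[OF assms(1), of "m * k" "m + 1"] by (simp add: ac_simps)
  also have "\<dots> = x [^] (m * k + 1)" using assms by simp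
  finally show ?case using Suc by simp
qed

lemma comm_monoid_product_group:
  assumes N: "\<And>i. i \<in> I \<Longrightarrow> comm_monoid (N i)"
  shows "comm_monoid (product_group I N)"
proof -
  note mon = comm_monoid.axioms(1)[OF N]
  note c = monoid.m_closed[OF mon] monoid.one_closed[OF mon]
  show ?thesis
  proof (rule comm_monoidI)
    fix x assume x: "x \<in> carrier (product_group I N)"
    show "\<one>\<^bsub>product_group I N\<^esub> \<otimes>\<^bsub>product_group I N\<^esub> x = x"
      by (rule PiE_ext[where k = I and s = "\<lambda>i. carrier (N i)"])
        (use x c in \<open>auto simp: PiE_iff monoid.l_one[OF mon]\<close>)
    fix y assume y: "y \<in> carrier (product_group I N)"
    show "x \<otimes>\<^bsub>product_group I N\<^esub> y \<in> carrier (product_group I N)"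
      using x y c by (auto simp: PiE_iff)
    show "x \<otimes>\<^bsub>product_group I N\<^esub> y = y \<otimes>\<^bsub>product_group I N\<^esub> x"
      using x y by (auto simp: PiE_iff comm_monoid.m_comm[OF N] intro!: restrict_ext)
    fix z assume z: "z \<in> carrier (product_group I N)"
    show "x \<otimes>\<^bsub>product_group I N\<^esub> y \<otimes>\<^bsub>product_group I N\<^esub> z = x \<otimes>\<^bsub>product_group I N\<^esub> (y \<otimes>\<^bsub>product_group I N\<^esub> z)"
      using x y z by (auto simp: PiE_iff monoid.m_assoc[OF mon] intro!: restrict_ext)
  qed (use c in auto)
qed

lemma product_group_eqI:
  assumes "x \<in> carrier (product_group I N)" "y \<in> carrier (product_group I N)" "\<And>i. i \<in> I \<Longrightarrow> x i = y i"
  shows "x = y"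
  using assms by (auto intro: PiE_ext)

lemma product_group_pow:
  "i \<in> I \<Longrightarrow> (x [^]\<^bsub>product_group I N\<^esub> (n::nat)) i = x i [^]\<^bsub>N i\<^esub> n"
  by (induction n) simp_all

theorem periodic_refinement_monoid_product:
  assumes I: "finite I" and N: "\<And>i. i \<in> I \<Longrightarrow> periodic_refinement_monoid (N i)"
  shows "periodic_refinement_monoid (product_group I N)"
proof -
  let ?P = "product_group I N"
  note cm = periodic_refinement_monoid.axioms(1)[OF N]
  have P: "comm_monoid ?P" by (rule comm_monoid_product_group[OF cm])
  interpret P: comm_monoid ?P by (rule P)
  have comp: "x i \<in> carrier (N i)" if "x \<in> carrier ?P" "i \<in> I" for x i using that by auto
  have mul: "(x \<otimes>\<^bsub>?P\<^esub> y) i = x i \<otimes>\<^bsub>N i\<^esub> y i" if "i \<in> I" for x y i using that by simp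
  have tup: "(\<lambda>i\<in>I. z i) \<in> carrier ?P" if "\<And>i. i \<in> I \<Longrightarrow> z i \<in> carrier (N i)" for z using that by auto
  note eqI = product_group_eqI[of _ I N]
  show ?thesis
  proof (intro periodic_refinement_monoid.intro periodic_refinement_monoid_axioms.intro)
    show "comm_monoid ?P" by (rule P)
    show "strongly_periodic ?P"
      unfolding strongly_periodic_def
    proof
      fix x assume x: "x \<in> carrier ?P"
      have "\<exists>m::nat. 0 < m \<and> x i [^]\<^bsub>N i\<^esub> (m + 1) = x i" if "i \<in> I" for i
        using periodic_refinement_monoid.strongly_periodic[OF N[OF that]] comp[OF x that]
        unfolding strongly_periodic_def by blast
      then obtain m :: "_ \<Rightarrow> nat" where m: "\<And>i. i \<in> I \<Longrightarrow> 0 < m i \<and> x i [^]\<^bsub>N i\<^esub> (m i + 1) = x i" by metis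
      have "x [^]\<^bsub>?P\<^esub> ((\<Prod>i\<in>I. m i) + 1) = x"
      proof (rule eqI[OF P.nat_pow_closed[OF x] x])
        fix i assume i: "i \<in> I"
        \<comment> \<open>The product of the component periods is a multiple of each of them, and
          multiples of a period are again periods.\<close>
        obtain k where k: "(\<Prod>i\<in>I. m i) = m i * k" using I i by (meson dvdE dvd_prod_eqI)
        show "(x [^]\<^bsub>?P\<^esub> ((\<Prod>i\<in>I. m i) + 1)) i = x i"
          unfolding product_group_pow[OF i] k
          using monoid.periodic_pow[OF comm_monoid.axioms(1)[OF cm[OF i]] comp[OF x i]] m[OF i] by blast
      qed
      moreover have "0 < (\<Prod>i\<in>I. m i)" using m by (intro prod_pos) simp
      ultimately show "\<exists>m::nat. 0 < m \<and> x [^]\<^bsub>?P\<^esub> (m + 1) = x" by blast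
    qed
    show "conical ?P"
      unfolding conical_def
    proof (intro ballI impI)
      fix x y assume x: "x \<in> carrier ?P" and y: "y \<in> carrier ?P" and xy: "x \<otimes>\<^bsub>?P\<^esub> y = \<one>\<^bsub>?P\<^esub>"
      have "x i = \<one>\<^bsub>?P\<^esub> i \<and> y i = \<one>\<^bsub>?P\<^esub> i" if i: "i \<in> I" for i
      proof -
        have one: "\<one>\<^bsub>?P\<^esub> i = \<one>\<^bsub>N i\<^esub>" using i by simp
        have "x i \<otimes>\<^bsub>N i\<^esub> y i = \<one>\<^bsub>N i\<^esub>" unfolding mul[OF i, symmetric] xy one ..
        then show ?thesis
          using periodic_refinement_monoid.conical[OF N[OF i]] comp[OF x i] comp[OF y i]
          unfolding conical_def one by blast
      qed
      then show "x = \<one>\<^bsub>?P\<^esub> \<and> y = \<one>\<^bsub>?P\<^esub>"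
        using eqI[OF x P.one_closed] eqI[OF y P.one_closed] by blast
    qed
    show "refinement_monoid ?P"
      unfolding refinement_monoid_def
    proof (intro ballI impI)
      fix x1 x2 y1 y2
      assume x1: "x1 \<in> carrier ?P" and x2: "x2 \<in> carrier ?P" and y1: "y1 \<in> carrier ?P" and y2: "y2 \<in> carrier ?P"
        and eq: "x1 \<otimes>\<^bsub>?P\<^esub> x2 = y1 \<otimes>\<^bsub>?P\<^esub> y2"
      let ?Q = "\<lambda>i a b c d. a \<in> carrier (N i) \<and> b \<in> carrier (N i) \<and> c \<in> carrier (N i) \<and> d \<in> carrier (N i) \<and>
        x1 i = a \<otimes>\<^bsub>N i\<^esub> b \<and> x2 i = c \<otimes>\<^bsub>N i\<^esub> d \<and> y1 i = a \<otimes>\<^bsub>N i\<^esub> c \<and> y2 i = b \<otimes>\<^bsub>N i\<^esub> d"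
      \<comment> \<open>The four entries of a refinement are packed into one tuple, so that a single
        choice over \<open>I\<close> supplies them for all components.\<close>
      let ?Q' = "\<lambda>i p. ?Q i (fst p) (fst (snd p)) (fst (snd (snd p))) (snd (snd (snd p)))"
      have "\<forall>i\<in>I. \<exists>p. ?Q' i p"
      proof
        fix i assume i: "i \<in> I"
        have "x1 i \<otimes>\<^bsub>N i\<^esub> x2 i = y1 i \<otimes>\<^bsub>N i\<^esub> y2 i"
          unfolding mul[OF i, symmetric] eq ..
        then obtain a b c d where "?Q i a b c d"
          using periodic_refinement_monoid.refine[OF N[OF i] comp[OF x1 i] comp[OF x2 i] comp[OF y1 i] comp[OF y2 i]]
          by metis
        then show "\<exists>p. ?Q' i p" by (intro exI[of _ "(a, b, c, d)"]) simp
      qed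
      from bchoice[OF this] obtain p where p: "\<forall>i\<in>I. ?Q' i (p i)" by (rule exE)
      define a b c d where "a i = fst (p i)" and "b i = fst (snd (p i))" and "c i = fst (snd (snd (p i)))"
        and "d i = snd (snd (snd (p i)))" for i
      have q: "?Q i (a i) (b i) (c i) (d i)" if "i \<in> I" for i
        using p that unfolding a_def b_def c_def d_def by (rule bspec)
      let ?a = "\<lambda>i\<in>I. a i" and ?b = "\<lambda>i\<in>I. b i" and ?c = "\<lambda>i\<in>I. c i" and ?d = "\<lambda>i\<in>I. d i"
      have cl: "?a \<in> carrier ?P" "?b \<in> carrier ?P" "?c \<in> carrier ?P" "?d \<in> carrier ?P"
        using q by (intro tup; blast)+
      have "x1 = ?a \<otimes>\<^bsub>?P\<^esub> ?b" by (rule eqI[OF x1 P.m_closed[OF cl(1,2)]]) (use q in simp)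
      moreover have "x2 = ?c \<otimes>\<^bsub>?P\<^esub> ?d" by (rule eqI[OF x2 P.m_closed[OF cl(3,4)]]) (use q in simp)
      moreover have "y1 = ?a \<otimes>\<^bsub>?P\<^esub> ?c" by (rule eqI[OF y1 P.m_closed[OF cl(1,3)]]) (use q in simp)
      moreover have "y2 = ?b \<otimes>\<^bsub>?P\<^esub> ?d" by (rule eqI[OF y2 P.m_closed[OF cl(2,4)]]) (use q in simp)
      ultimately show "\<exists>z11\<in>carrier ?P. \<exists>z12\<in>carrier ?P. \<exists>z21\<in>carrier ?P. \<exists>z22\<in>carrier ?P.
         x1 = z11 \<otimes>\<^bsub>?P\<^esub> z12 \<and> x2 = z21 \<otimes>\<^bsub>?P\<^esub> z22 \<and> y1 = z11 \<otimes>\<^bsub>?P\<^esub> z21 \<and> y2 = z12 \<otimes>\<^bsub>?P\<^esub> z22"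
        by (intro bexI[OF _ cl(1)] bexI[OF _ cl(2)] bexI[OF _ cl(3)] bexI[OF _ cl(4)] conjI)
    qed
    have idem: "e i \<in> idempotents (N i)" if "e \<in> idempotents ?P" "i \<in> I" for e i
    proof -
      have e: "e \<in> carrier ?P" "e \<otimes>\<^bsub>?P\<^esub> e = e" using that(1) unfolding idempotents_def by blast+
      have "e i \<otimes>\<^bsub>N i\<^esub> e i = e i" unfolding mul[OF that(2), symmetric] e(2) ..
      then show ?thesis using comp[OF e(1) that(2)] by (simp add: idempotents_def)
    qed
    have mem: "x i \<in> carrier (idem_group (N i) (e i))"
      if e: "e \<in> idempotents ?P" and x: "x \<in> carrier (idem_group ?P e)" and i: "i \<in> I" for e x i
    proof -
      obtain w where w: "x \<in> carrier ?P" "e \<otimes>\<^bsub>?P\<^esub> x = x" "w \<in> carrier ?P" "x \<otimes>\<^bsub>?P\<^esub> w = e"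
        using x unfolding P.idem_group_carrier_iff[OF e] by blast
      show ?thesis
        unfolding comm_monoid.idem_group_carrier_iff[OF cm[OF i] idem[OF e i]]
      proof (intro conjI bexI)
        show "e i \<otimes>\<^bsub>N i\<^esub> x i = x i" unfolding mul[OF i, symmetric] w(2) ..
        show "x i \<otimes>\<^bsub>N i\<^esub> w i = e i" unfolding mul[OF i, symmetric] w(4) ..
      qed (rule comp[OF w(1) i] comp[OF w(3) i])+
    qed
    show "groups_embed_purely ?P"
      unfolding P.groups_embed_purely_iff
    proof (intro ballI impI conjI allI)
      fix e f assume e: "e \<in> idempotents ?P" and f: "f \<in> idempotents ?P" and ef: "e \<otimes>\<^bsub>?P\<^esub> f = f"
      have efi: "e i \<otimes>\<^bsub>N i\<^esub> f i = f i" if "i \<in> I" for i unfolding mul[OF that, symmetric] ef ..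
      note emb = comm_monoid.groups_embed_purely_iff[OF cm, THEN iffD1, OF _ periodic_refinement_monoid.embed[OF N]]
      {
        fix x y assume x: "x \<in> carrier (idem_group ?P e)" and y: "y \<in> carrier (idem_group ?P e)"
          and eq: "x \<otimes>\<^bsub>?P\<^esub> f = y \<otimes>\<^bsub>?P\<^esub> f"
        show "x = y"
        proof (rule eqI[OF P.idem_group_closed(1)[OF e x] P.idem_group_closed(1)[OF e y]])
          fix i assume i: "i \<in> I"
          have "x i \<otimes>\<^bsub>N i\<^esub> f i = y i \<otimes>\<^bsub>N i\<^esub> f i" unfolding mul[OF i, symmetric] eq ..
          then show "x i = y i"
            using emb[OF i i] idem[OF e i] idem[OF f i] efi[OF i] mem[OF e x i] mem[OF e y i] by blast
        qed
      next
        fix x y and n :: nat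
        assume x: "x \<in> carrier (idem_group ?P e)" and y: "y \<in> carrier (idem_group ?P f)"
          and n: "0 < n" and eq: "y [^]\<^bsub>?P\<^esub> n = x \<otimes>\<^bsub>?P\<^esub> f"
        let ?Q = "\<lambda>i z w. z \<in> carrier (N i) \<and> e i \<otimes>\<^bsub>N i\<^esub> z = z \<and> w \<in> carrier (N i) \<and>
            z \<otimes>\<^bsub>N i\<^esub> w = e i \<and> z [^]\<^bsub>N i\<^esub> n = x i"
        have "\<forall>i\<in>I. \<exists>p. ?Q i (fst p) (snd p)"
        proof
          fix i assume i: "i \<in> I"
          have "y i [^]\<^bsub>N i\<^esub> n = x i \<otimes>\<^bsub>N i\<^esub> f i"
            unfolding mul[OF i, symmetric] product_group_pow[OF i, symmetric] eq ..
          then obtain z where "z \<in> carrier (idem_group (N i) (e i))" "z [^]\<^bsub>N i\<^esub> n = x i"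
            using emb[OF i i] idem[OF e i] idem[OF f i] efi[OF i] mem[OF e x i] mem[OF f y i] n by blast
          then obtain w where "?Q i z w"
            unfolding comm_monoid.idem_group_carrier_iff[OF cm[OF i] idem[OF e i]] by blast
          then show "\<exists>p. ?Q i (fst p) (snd p)" by (intro exI[of _ "(z, w)"]) simp
        qed
        from bchoice[OF this] obtain p where p: "\<forall>i\<in>I. ?Q i (fst (p i)) (snd (p i))" by (rule exE)
        define z w where "z i = fst (p i)" and "w i = snd (p i)" for i
        have z: "?Q i (z i) (w i)" if "i \<in> I" for i
          using p that unfolding z_def w_def by (rule bspec)
        let ?z = "\<lambda>i\<in>I. z i" and ?w = "\<lambda>i\<in>I. w i"
        have cl: "?z \<in> carrier ?P" "?w \<in> carrier ?P" using z by (intro tup; blast)+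
        have ec: "e \<in> carrier ?P" by (rule P.idempotents_closed[OF e])
        have "e \<otimes>\<^bsub>?P\<^esub> ?z = ?z" by (rule eqI[OF P.m_closed[OF ec cl(1)] cl(1)]) (use z in simp)
        moreover have "?z \<otimes>\<^bsub>?P\<^esub> ?w = e" by (rule eqI[OF P.m_closed[OF cl] ec]) (use z in simp)
        ultimately have "?z \<in> carrier (idem_group ?P e)"
          unfolding P.idem_group_carrier_iff[OF e] using cl by blast
        moreover have "?z [^]\<^bsub>?P\<^esub> n = x"
        proof (rule eqI[OF P.nat_pow_closed[OF cl(1)] P.idem_group_closed(1)[OF e x]])
          fix i assume i: "i \<in> I"
          show "(?z [^]\<^bsub>?P\<^esub> n) i = x i" unfolding product_group_pow[OF i] using z[OF i] i by simp
        qed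
        ultimately show "\<exists>z\<in>carrier (idem_group ?P e). z [^]\<^bsub>?P\<^esub> n = x" by blast
      }
    qed
  qed
qed

section \<open>Torsion groups with an adjoined identity\<close>

theorem periodic_refinement_monoid_adjoin_identity:
  assumes H: "comm_group H" and torsion: "\<And>a. a \<in> carrier H \<Longrightarrow> \<exists>m>0. a [^]\<^bsub>H\<^esub> (m::nat) = \<one>\<^bsub>H\<^esub>"
  shows "periodic_refinement_monoid (adjoin_identity H)"
proof -
  interpret H: comm_group H by (rule H)
  let ?A = "adjoin_identity H"
  have A: "comm_monoid ?A"
  proof (rule comm_monoidI)
    fix x y assume x: "x \<in> carrier ?A" and y: "y \<in> carrier ?A"
    show "x \<otimes>\<^bsub>?A\<^esub> y \<in> carrier ?A" using x y by (cases x; cases y) auto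
    show "x \<otimes>\<^bsub>?A\<^esub> y = y \<otimes>\<^bsub>?A\<^esub> x" using x y by (cases x; cases y) (auto simp: H.m_comm)
    fix z assume z: "z \<in> carrier ?A"
    show "x \<otimes>\<^bsub>?A\<^esub> y \<otimes>\<^bsub>?A\<^esub> z = x \<otimes>\<^bsub>?A\<^esub> (y \<otimes>\<^bsub>?A\<^esub> z)"
      using x y z by (cases x; cases y; cases z) (auto simp: H.m_assoc)
  qed simp_all
  interpret A: comm_monoid ?A by (rule A)
  have pow: "Some a [^]\<^bsub>?A\<^esub> n = Some (a [^]\<^bsub>H\<^esub> n)" if "a \<in> carrier H" "0 < n" for a and n :: nat
    using that(2)
  proof (induction n rule: nat_induct_non_zero)
    case 1
    then show ?case using that(1) by simp
  qed simp
  \<comment> \<open>With only these two idempotents, condition (b) concerns either a trivial source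
    group or the identity map of one group.\<close>
  have idem: "e = None \<or> e = Some \<one>\<^bsub>H\<^esub>" if e: "e \<in> idempotents ?A" for e
  proof (cases e)
    case (Some a)
    then have "a \<in> carrier H" "a \<otimes>\<^bsub>H\<^esub> a = a" using e by (auto simp: idempotents_def)
    then show ?thesis using Some H.l_cancel_one' by auto
  qed simp
  have None_group: "x = None" if "x \<in> carrier (idem_group ?A None)" for x
  proof -
    have "None \<in> idempotents ?A" using A.one_idempotent by simp
    from that[unfolded A.idem_group_carrier_iff[OF this]] obtain w where "x \<otimes>\<^bsub>?A\<^esub> w = None" by blast
    then show ?thesis by (cases x; cases w) simp_all
  qed
  have Some_group: "\<exists>a\<in>carrier H. x = Some a"
    if e: "Some \<one>\<^bsub>H\<^esub> \<in> idempotents ?A" and x: "x \<in> carrier (idem_group ?A (Some \<one>\<^bsub>H\<^esub>))" for x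
    using x unfolding A.idem_group_carrier_iff[OF e] by (cases x) auto
  show ?thesis
  proof (intro periodic_refinement_monoid.intro periodic_refinement_monoid_axioms.intro)
    show "comm_monoid ?A" by (rule A)
    show "strongly_periodic ?A"
      unfolding strongly_periodic_def
    proof
      fix x assume x: "x \<in> carrier ?A"
      show "\<exists>m::nat. 0 < m \<and> x [^]\<^bsub>?A\<^esub> (m + 1) = x"
      proof (cases x)
        case None
        then have "x [^]\<^bsub>?A\<^esub> (1 + 1 :: nat) = x" by simp
        then show ?thesis by (intro exI[of _ 1]) simp
      next
        case (Some a)
        then have a: "a \<in> carrier H" using x by auto
        then obtain m :: nat where m: "0 < m" "a [^]\<^bsub>H\<^esub> m = \<one>\<^bsub>H\<^esub>" using torsion by blast
        then have "x [^]\<^bsub>?A\<^esub> (m + 1) = x" using pow[OF a, of "m + 1"] a Some by simp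
        then show ?thesis using m(1) by blast
      qed
    qed
    show "conical ?A"
      unfolding conical_def
    proof (intro ballI impI)
      fix x y assume "x \<otimes>\<^bsub>?A\<^esub> y = \<one>\<^bsub>?A\<^esub>"
      then show "x = \<one>\<^bsub>?A\<^esub> \<and> y = \<one>\<^bsub>?A\<^esub>" by (cases x; cases y) simp_all
    qed
    show "refinement_monoid ?A"
      unfolding refinement_monoid_def
    proof (intro ballI impI)
      fix x1 x2 y1 y2
      assume x1: "x1 \<in> carrier ?A" and x2: "x2 \<in> carrier ?A" and y1: "y1 \<in> carrier ?A" and y2: "y2 \<in> carrier ?A"
        and eq: "x1 \<otimes>\<^bsub>?A\<^esub> x2 = y1 \<otimes>\<^bsub>?A\<^esub> y2"
      let ?R = "\<lambda>x1 x2 y1 y2. \<exists>z11\<in>carrier ?A. \<exists>z12\<in>carrier ?A. \<exists>z21\<in>carrier ?A. \<exists>z22\<in>carrier ?A.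
         x1 = z11 \<otimes>\<^bsub>?A\<^esub> z12 \<and> x2 = z21 \<otimes>\<^bsub>?A\<^esub> z22 \<and> y1 = z11 \<otimes>\<^bsub>?A\<^esub> z21 \<and> y2 = z12 \<otimes>\<^bsub>?A\<^esub> z22"
      have R: "?R (a \<otimes>\<^bsub>?A\<^esub> b) (c \<otimes>\<^bsub>?A\<^esub> d) (a \<otimes>\<^bsub>?A\<^esub> c) (b \<otimes>\<^bsub>?A\<^esub> d)"
        if "a \<in> carrier ?A" "b \<in> carrier ?A" "c \<in> carrier ?A" "d \<in> carrier ?A" for a b c d
        using that by blast
      have N: "None \<in> carrier ?A" by simp
      show "?R x1 x2 y1 y2"
      proof (cases "x1 = None \<or> x2 = None \<or> y1 = None \<or> y2 = None")
        \<comment> \<open>If one of the four elements is the adjoined identity, its row or column of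
          the refinement matrix is filled with \<open>None\<close>.\<close>
        case True
        then consider "x1 = None" | "x2 = None" | "y1 = None" | "y2 = None" by blast
        then show ?thesis
        proof cases
          case 1
          then show ?thesis using R[OF N N y1 y2] eq by simp
        next
          case 2
          then show ?thesis using R[OF y1 y2 N N] eq by simp
        next
          case 3
          then show ?thesis using R[OF N x1 N x2] eq by simp
        next
          case 4
          then show ?thesis using R[OF x1 N x2 N] eq by simp
        qed
      next
        case False
        then obtain a b c d where s: "x1 = Some a" "x2 = Some b" "y1 = Some c" "y2 = Some d" by auto
        then have cl: "a \<in> carrier H" "b \<in> carrier H" "c \<in> carrier H" "d \<in> carrier H"
          and ab: "a \<otimes>\<^bsub>H\<^esub> b = c \<otimes>\<^bsub>H\<^esub> d" using x1 x2 y1 y2 eq by auto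
        \<comment> \<open>In additive notation the matrix with rows \<open>a, 0\<close> and
          \<open>c - a, d\<close> is a refinement; its entry 0 is the zero of \<open>H\<close>, not
          the adjoined identity.\<close>
        let ?z = "inv\<^bsub>H\<^esub> a \<otimes>\<^bsub>H\<^esub> c"
        have zc: "?z \<in> carrier H" using cl by simp
        have "a \<otimes>\<^bsub>H\<^esub> ?z = c" using cl by (simp flip: H.m_assoc)
        moreover have "?z \<otimes>\<^bsub>H\<^esub> d = b"
        proof -
          have "?z \<otimes>\<^bsub>H\<^esub> d = inv\<^bsub>H\<^esub> a \<otimes>\<^bsub>H\<^esub> (a \<otimes>\<^bsub>H\<^esub> b)" using cl ab by (simp add: H.m_assoc)
          then show ?thesis using cl by (simp flip: H.m_assoc)
        qed
        ultimately show ?thesis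
          using R[of "Some a" "Some \<one>\<^bsub>H\<^esub>" "Some ?z" "Some d"] s cl zc by simp
      qed
    qed
    show "groups_embed_purely ?A"
      unfolding A.groups_embed_purely_iff
    proof (intro ballI impI conjI allI)
      fix e f assume e: "e \<in> idempotents ?A" and f: "f \<in> idempotents ?A" and ef: "e \<otimes>\<^bsub>?A\<^esub> f = f"
      {
        fix x y assume x: "x \<in> carrier (idem_group ?A e)" and y: "y \<in> carrier (idem_group ?A e)"
          and eq: "x \<otimes>\<^bsub>?A\<^esub> f = y \<otimes>\<^bsub>?A\<^esub> f"
        show "x = y"
        proof (cases "e = None")
          case True
          then show ?thesis using None_group x y by blast
        next
          case False
          then have es: "e = Some \<one>\<^bsub>H\<^esub>" using idem[OF e] by blast
          then have fs: "f = Some \<one>\<^bsub>H\<^esub>" using idem[OF f] ef by auto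
          obtain a b where "a \<in> carrier H" "x = Some a" "b \<in> carrier H" "y = Some b"
            using Some_group e x y unfolding es by blast
          then show ?thesis using eq fs by simp
        qed
      next
        fix x y and n :: nat
        assume x: "x \<in> carrier (idem_group ?A e)" and y: "y \<in> carrier (idem_group ?A f)"
          and n: "0 < n" and eq: "y [^]\<^bsub>?A\<^esub> n = x \<otimes>\<^bsub>?A\<^esub> f"
        show "\<exists>z\<in>carrier (idem_group ?A e). z [^]\<^bsub>?A\<^esub> n = x"
        proof (cases "e = None")
          case True
          then have "x = \<one>\<^bsub>?A\<^esub>" using None_group x by simp
          then show ?thesis using x A.nat_pow_one[of n] by metis
        next
          case False
          then have es: "e = Some \<one>\<^bsub>H\<^esub>" using idem[OF e] by blast
          then have "f = e" using idem[OF f] ef by auto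
          then show ?thesis using x y eq A.idem_group_closed(3)[OF e x] by auto
        qed
      }
    qed
  qed
qed

lemma periodic_refinement_monoid_cyclic_sum:
  assumes N: "comm_monoid N" "finite_sum_of_cyclic_with_identity N"
  shows "periodic_refinement_monoid N"
proof -
  obtain k :: nat and n where n: "\<And>i. i < k \<Longrightarrow> 0 < n i"
    and iso: "N \<cong> product_group {..<k} (\<lambda>i. adjoin_identity (integer_mod_group (n i)))"
    using N(2) unfolding finite_sum_of_cyclic_with_identity_def by blast
  have "periodic_refinement_monoid (adjoin_identity (integer_mod_group (n i)))" if "i < k" for i
  proof (rule periodic_refinement_monoid_adjoin_identity)
    fix a show "\<exists>m>0. a [^]\<^bsub>integer_mod_group (n i)\<^esub> (m::nat) = \<one>\<^bsub>integer_mod_group (n i)\<^esub>"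
      using n[OF that] by (intro exI[of _ "n i"]) simp
  qed simp
  then show ?thesis
    by (intro periodic_refinement_monoid_iso[OF N(1) _ iso] periodic_refinement_monoid_product) simp_all
qed

theorem periodic_refinement_monoid_if_direct_limit:
  fixes M :: "('a, 'm) monoid_scheme"
  assumes M: "comm_monoid M"
    and lim: "is_direct_limit_of TYPE('i) (finite_sum_of_cyclic_with_identity :: 'b monoid \<Rightarrow> bool) M"
  shows "periodic_refinement_monoid M"
proof -
  obtain I :: "'i set" and r and N :: "'i \<Rightarrow> 'b monoid" and f where sys: "directed_system I r N f"
    and C: "\<forall>i\<in>I. finite_sum_of_cyclic_with_identity (N i)" and iso: "M \<cong> direct_limit I r N f"
    using lim unfolding is_direct_limit_of_def by blast
  interpret directed_system I r N f by (rule sys)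
  have "periodic_refinement_monoid (N i)" if "i \<in> I" for i
    using periodic_refinement_monoid_cyclic_sum[OF monoids[OF that]] C that by blast
  then show ?thesis
    using periodic_refinement_monoid_iso[OF M _ iso] periodic_refinement_monoid_direct_limit by blast
qed

section \<open>Realisation as a direct limit\<close>

context periodic_refinement_monoid
begin

definition finite_submonoid :: "'a set \<Rightarrow> bool"
  where "finite_submonoid A \<longleftrightarrow> finite A \<and> A \<subseteq> carrier G \<and> \<one> \<in> A \<and> (\<forall>x\<in>A. \<forall>y\<in>A. x \<otimes> y \<in> A)"

lemma finite_submonoidD:
  assumes "finite_submonoid A"
  shows "finite A" "A \<subseteq> carrier G" "\<one> \<in> A" "x \<in> A \<Longrightarrow> y \<in> A \<Longrightarrow> x \<otimes> y \<in> A"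
  using assms unfolding finite_submonoid_def by blast+

text \<open>Periodicity bounds the exponents of \<open>y\<close> that are needed: a power above
  \<open>m\<close> can be reduced by \<open>y [^] (m + 1) = y\<close>.\<close>

lemma finite_submonoid_adjoin:
  assumes A: "finite_submonoid A" and y: "y \<in> carrier G"
  shows "\<exists>B. finite_submonoid B \<and> insert y A \<subseteq> B"
proof -
  note A = finite_submonoidD[OF A]
  obtain m :: nat where m: "0 < m" "y [^] (m + 1) = y"
    using strongly_periodic y unfolding strongly_periodic_def by blast
  let ?B = "(\<lambda>(a, i). a \<otimes> y [^] i) ` (A \<times> {..m})"
  have Ac: "a \<in> carrier G" if "a \<in> A" for a using A(2) that by blast
  have reduce: "\<exists>k\<le>m. y [^] (i + j) = y [^] k" if "i \<le> m" "j \<le> m" for i j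
  proof (cases "i + j \<le> m")
    case False
    \<comment> \<open>Replacing \<open>m + 1\<close> by 1 in the exponent leaves
      \<open>i + j - m\<close>, which is at most \<open>m\<close>.\<close>
    define s where "s = i + j - (m + 1)"
    have ij: "i + j = (m + 1) + s" and s: "1 + s \<le> m" using False that m(1) by (simp_all add: s_def)
    have "y [^] ((m + 1) + s) = y [^] (m + 1) \<otimes> y [^] s" by (rule nat_pow_mult[OF y, symmetric])
    also have "\<dots> = y [^] (1 + s)" unfolding m(2) using nat_pow_mult[OF y, of 1 s] y by simp
    finally show ?thesis unfolding ij using s by blast
  qed blast
  have "finite_submonoid ?B"
    unfolding finite_submonoid_def
  proof (intro conjI ballI)
    show "finite ?B" using A(1) by simp
    show "?B \<subseteq> carrier G" using Ac y by auto
    have "\<one> \<otimes> y [^] (0::nat) = \<one>" by simp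
    then show "\<one> \<in> ?B" using A(3) by (intro image_eqI[of _ _ "(\<one>, 0)"]) simp_all
    fix u v assume "u \<in> ?B" "v \<in> ?B"
    then obtain a i b j where u: "a \<in> A" "i \<le> m" "u = a \<otimes> y [^] i" and v: "b \<in> A" "j \<le> m" "v = b \<otimes> y [^] j"
      by auto
    obtain k where k: "k \<le> m" "y [^] (i + j) = y [^] k" using reduce[OF u(2) v(2)] by blast
    have "u \<otimes> v = (a \<otimes> b) \<otimes> (y [^] i \<otimes> y [^] j)"
      unfolding u(3) v(3) using Ac[OF u(1)] Ac[OF v(1)] y by (simp add: m_ac)
    also have "y [^] i \<otimes> y [^] j = y [^] k" using nat_pow_mult[OF y, of i j] k(2) by simp
    finally show "u \<otimes> v \<in> ?B"
      using A(4)[OF u(1) v(1)] k(1) by (intro image_eqI[of _ _ "(a \<otimes> b, k)"]) simp_all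
  qed
  moreover have "y \<in> ?B"
    using m(1) A(3) y by (intro image_eqI[of _ _ "(\<one>, 1)"]) simp_all
  moreover have "A \<subseteq> ?B"
  proof
    fix a assume "a \<in> A"
    then show "a \<in> ?B" using Ac by (intro image_eqI[of _ _ "(a, 0)"]) simp_all
  qed
  ultimately show ?thesis by blast
qed

lemma finite_submonoid_extends:
  assumes "finite Y" "Y \<subseteq> carrier G"
  shows "\<exists>A. finite_submonoid A \<and> Y \<subseteq> A"
  using assms
proof (induction Y)
  case empty
  have "finite_submonoid {\<one>}" by (simp add: finite_submonoid_def)
  then show ?case by blast
next
  case (insert y Y)
  then obtain A where A: "finite_submonoid A" "Y \<subseteq> A" by blast
  obtain B where "finite_submonoid B" "insert y A \<subseteq> B"
    using finite_submonoid_adjoin[OF A(1), of y] insert.prems by blast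
  then show ?case using A(2) by blast
qed

text \<open>
  The stages are the finite submonoids \<open>A\<close>, each with a factorisation of its inclusion through
  some \<open>B A\<close>; the transition map from \<open>A\<close> to \<open>A'\<close> is the composite \<open>B A \<rightarrow> A' \<rightarrow> B A'\<close>, defined when
  the image of \<open>B A\<close> in \<open>G\<close> lies in \<open>A'\<close>.  The second component of an index makes these relations
  strict, so that the reflexive ones can be given identity maps.
\<close>

theorem is_direct_limit_of_cyclic_sums:
  "is_direct_limit_of TYPE(('a \<times> nat) set)
    (finite_sum_of_cyclic_with_identity :: (nat \<Rightarrow> int option) monoid \<Rightarrow> bool) G"
proof -
  define P where "P k n = product_group {..<k} (\<lambda>i. adjoin_identity (integer_mod_group (n i)))"
    for k :: nat and n :: "nat \<Rightarrow> nat"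
  define Q where "Q A p \<longleftrightarrow> (case p of (k, n, \<iota>, \<psi>) \<Rightarrow> (\<forall>i<k. 0 < n i) \<and>
    \<iota> \<in> monoid_homs (G\<lparr>carrier := A\<rparr>) (P k n) \<and> \<psi> \<in> monoid_homs (P k n) G \<and> (\<forall>x\<in>A. \<psi> (\<iota> x) = x))" for A p
  have "\<exists>p. Q A p" if A: "finite_submonoid A" for A
  proof -
    have "\<exists>k n \<iota> \<psi>. (\<forall>i<(k::nat). 0 < n i) \<and>
      \<iota> \<in> monoid_homs (G\<lparr>carrier := A\<rparr>) (P k n) \<and> \<psi> \<in> monoid_homs (P k n) G \<and> (\<forall>x\<in>A. \<psi> (\<iota> x) = x)"
      unfolding P_def by (rule finite_submonoid_factors; rule finite_submonoidD[OF A]; assumption)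
    then obtain k n \<iota> \<psi> where
      "\<forall>i<k. 0 < n i" "\<iota> \<in> monoid_homs (G\<lparr>carrier := A\<rparr>) (P k n)" "\<psi> \<in> monoid_homs (P k n) G"
      "\<forall>x\<in>A. \<psi> (\<iota> x) = x"
      by (elim exE conjE) (rule that)
    then have "Q A (k, n, \<iota>, \<psi>)" by (simp add: Q_def)
    then show ?thesis by blast
  qed
  then have "\<forall>A\<in>Collect finite_submonoid. \<exists>p. Q A p" by blast
  \<comment> \<open>One factorisation is fixed for each finite submonoid. The choices need not be
    compatible with each other, since the strict transition maps pass through
    \<open>G\<close>.\<close>
  from bchoice[OF this] obtain p where p: "\<And>A. finite_submonoid A \<Longrightarrow> Q A (p A)" by blast
  define k n \<iota> \<psi> where "k A = fst (p A)" and "n A = fst (snd (p A))" and "\<iota> A = fst (snd (snd (p A)))"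
    and "\<psi> A = snd (snd (snd (p A)))" for A
  define B where "B A = P (k A) (n A)" for A
  have n: "\<forall>i<k A. 0 < n A i" and \<iota>: "\<iota> A \<in> monoid_homs (G\<lparr>carrier := A\<rparr>) (B A)"
    and \<psi>: "\<psi> A \<in> monoid_homs (B A) G" and \<psi>\<iota>: "\<And>x. x \<in> A \<Longrightarrow> \<psi> A (\<iota> A x) = x"
    if "finite_submonoid A" for A
    using p[OF that] unfolding Q_def B_def k_def n_def \<iota>_def \<psi>_def by (auto split: prod.splits)
  have B_monoid: "comm_monoid (B A)" if "finite_submonoid A" for A
    unfolding B_def P_def
  proof (rule comm_monoid_product_group)
    fix i assume "i \<in> {..<k A}"
    then have "0 < n A i" using n[OF that] by simp
    then have "\<exists>m>0. a [^]\<^bsub>integer_mod_group (n A i)\<^esub> (m::nat) = \<one>\<^bsub>integer_mod_group (n A i)\<^esub>" for a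
      by (intro exI[of _ "n A i"]) simp
    then show "comm_monoid (adjoin_identity (integer_mod_group (n A i)))"
      by (intro periodic_refinement_monoid.axioms(1) periodic_refinement_monoid_adjoin_identity) simp_all
  qed
  have B_finite: "finite (carrier (B A))" if "finite_submonoid A" for A
  proof -
    have "finite (carrier (adjoin_identity (integer_mod_group (n A i))))" if "i < k A" for i
      using n[OF \<open>finite_submonoid A\<close>] that by (simp add: carrier_integer_mod_group)
    then show ?thesis unfolding B_def P_def carrier_product_group by (intro finite_PiE) simp_all
  qed
  define im where "im A = \<psi> A ` carrier (B A)" for A
  have im: "finite (im A)" "im A \<subseteq> carrier G" "A \<subseteq> im A" if A: "finite_submonoid A" for A
  proof -
    show "finite (im A)" using B_finite[OF A] by (simp add: im_def)
    show "im A \<subseteq> carrier G" using monoid_homsD(1)[OF \<psi>[OF A]] by (auto simp: im_def)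
    show "A \<subseteq> im A"
    proof
      fix x assume x: "x \<in> A"
      then have "\<iota> A x \<in> carrier (B A)" using monoid_homsD(1)[OF \<iota>[OF A]] by simp
      then show "x \<in> im A" unfolding im_def using \<psi>\<iota>[OF A x] by (metis imageI)
    qed
  qed
  \<comment> \<open>The submonoid \<open>A\<close> and the level \<open>j\<close> are encoded
    together as the set \<open>A \<times> {j}\<close>. Both can be read off, because
    \<open>A\<close> contains \<open>\<one>\<close> and so is not empty.\<close>
  define I :: "('a \<times> nat) set set" where "I = {A \<times> {j} | A j. finite_submonoid A}"
  define base where "base S = fst ` S" for S :: "('a \<times> nat) set"
  define level where "level S = the_elem (snd ` S)" for S :: "('a \<times> nat) set"
  have base_level: "base (A \<times> {j}) = A" "level (A \<times> {j}) = j" if "finite_submonoid A" for A j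
  proof -
    have "A \<noteq> {}" using finite_submonoidD(3)[OF that] by blast
    then show "base (A \<times> {j}) = A" "level (A \<times> {j}) = j" by (auto simp: base_def level_def)
  qed
  have base: "finite_submonoid (base S)" if "S \<in> I" for S
    using that base_level unfolding I_def by auto
  define less where "less S S' \<longleftrightarrow> im (base S) \<subseteq> base S' \<and> level S < level S'" for S S'
  define r where "r = {(S, S'). S \<in> I \<and> S' \<in> I \<and> (S = S' \<or> less S S')}"
  define f where "f S S' = (if S = S' then (\<lambda>x. x) else (\<lambda>x. \<iota> (base S') (\<psi> (base S) x)))" for S S'
  define N where "N S = B (base S)" for S
  \<comment> \<open>The inclusions chain because \<open>\<psi>\<close> after \<open>\<iota>\<close>
    is the identity on \<open>base S'\<close>, whence
    \<open>base S' \<subseteq> im (base S')\<close>.\<close>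
  have less_trans: "less S S''" if "less S S'" "less S' S''" "S' \<in> I" for S S' S''
    using that im(3)[OF base[OF that(3)]] unfolding less_def by (meson order.trans less_trans)
  have less_irrefl: "\<not> less S S" for S by (simp add: less_def)
  have above: "\<exists>S''\<in>I. less S S'' \<and> less S' S''" if S: "S \<in> I" "S' \<in> I" for S S'
  proof -
    have "finite (im (base S) \<union> im (base S'))" "im (base S) \<union> im (base S') \<subseteq> carrier G"
      using im(1,2) base S by blast+
    from finite_submonoid_extends[OF this] obtain A
      where A: "finite_submonoid A" "im (base S) \<union> im (base S') \<subseteq> A" by blast
    let ?T = "A \<times> {max (level S) (level S') + 1}"
    have "less S ?T" "less S' ?T" using A(2) base_level[OF A(1)] by (simp_all add: less_def)
    moreover have "?T \<in> I" using A(1) by (auto simp: I_def)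
    ultimately show ?thesis by blast
  qed
  have \<psi>_base: "\<psi> (base S) x \<in> base S'" if "less S S'" "x \<in> carrier (N S)" for S S' x
    using that unfolding less_def im_def N_def by blast
  have f_less: "f S S' x = \<iota> (base S') (\<psi> (base S) x)" if "less S S'" for S S' x
    using that less_irrefl by (auto simp: f_def)
  have \<psi>f: "\<psi> (base S') (f S S' x) = \<psi> (base S) x" if "(S, S') \<in> r" "x \<in> carrier (N S)" for S S' x
  proof (cases "S = S'")
    case False
    then have l: "less S S'" "S' \<in> I" using that(1) by (auto simp: r_def)
    then show ?thesis unfolding f_less[OF l(1)] using \<psi>\<iota>[OF base[OF l(2)] \<psi>_base[OF l(1) that(2)]] by simp
  qed (simp add: f_def)
  have sys: "directed_system I r N f"
  proof (rule directed_system.intro)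
    have "finite_submonoid {\<one>}" by (simp add: finite_submonoid_def)
    then show "I \<noteq> {}" by (auto simp: I_def)
    have "antisym r"
    proof (rule antisymI)
      fix S S' assume "(S, S') \<in> r" "(S', S) \<in> r"
      then show "S = S'" by (auto simp: r_def less_def)
    qed
    moreover have "trans r"
    proof (rule transI)
      fix S S' S'' assume "(S, S') \<in> r" "(S', S'') \<in> r"
      then show "(S, S'') \<in> r" using less_trans unfolding r_def by auto
    qed
    ultimately show "partial_order_on I r"
      unfolding partial_order_on_def preorder_on_def refl_on_def by (auto simp: r_def)
    show "\<exists>k\<in>I. (i, k) \<in> r \<and> (j, k) \<in> r" if "i \<in> I" "j \<in> I" for i j
      using above[OF that] that unfolding r_def by blast
    show "comm_monoid (N i)" if "i \<in> I" for i
      unfolding N_def by (rule B_monoid[OF base[OF that]])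
    show "f i j \<in> monoid_homs (N i) (N j)" if ij: "(i, j) \<in> r" for i j
    proof (cases "i = j")
      case True
      then show ?thesis by (simp add: f_def monoid_homs_def hom_def)
    next
      case False
      then have l: "less i j" "i \<in> I" "j \<in> I" using ij by (auto simp: r_def)
      note h = monoid_homsD[OF \<psi>[OF base[OF l(2)]], folded N_def]
      note g = monoid_homsD[OF \<iota>[OF base[OF l(3)]], folded N_def, simplified]
      show ?thesis
        unfolding monoid_homs_def
      proof (intro CollectI conjI homI)
        fix x assume x: "x \<in> carrier (N i)"
        show "f i j x \<in> carrier (N j)" unfolding f_less[OF l(1)] by (rule g(1)[OF \<psi>_base[OF l(1) x]])
        fix y assume y: "y \<in> carrier (N i)"
        show "f i j (x \<otimes>\<^bsub>N i\<^esub> y) = f i j x \<otimes>\<^bsub>N j\<^esub> f i j y"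
          unfolding f_less[OF l(1)] h(2)[OF x y] by (rule g(2)[OF \<psi>_base[OF l(1) x] \<psi>_base[OF l(1) y]])
      next
        show "f i j \<one>\<^bsub>N i\<^esub> = \<one>\<^bsub>N j\<^esub>" unfolding f_less[OF l(1)] h(3) by (rule g(3))
      qed
    qed
    show "f i i x = x" for i x by (simp add: f_def)
    show "f j k (f i j x) = f i k x" if ij: "(i, j) \<in> r" and jk: "(j, k) \<in> r" and x: "x \<in> carrier (N i)" for i j k x
    proof (cases "i = j \<or> j = k")
      case True
      then show ?thesis by (auto simp: f_def)
    next
      case False
      then have l: "less i j" "less j k" "j \<in> I" using ij jk by (auto simp: r_def)
      \<comment> \<open>The middle stage drops out because the transition maps commute with the maps
        \<open>\<psi>\<close> into \<open>G\<close>.\<close>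
      show ?thesis unfolding f_less[OF l(2)] \<psi>f[OF ij x] f_less[OF less_trans[OF l]] ..
    qed
  qed
  interpret directed_system I r N f by (rule sys)
  let ?L = "direct_limit I r N f" and ?l = "limit_map I r N f"
  have "\<exists>!h. h \<in> monoid_homs ?L G \<and> h \<in> extensional (carrier ?L) \<and>
      (\<forall>i\<in>I. \<forall>x\<in>carrier (N i). h (?l i x) = \<psi> (base i) x)"
    by (rule direct_limit_universal[OF comm_monoid_axioms])
      (use \<psi> base \<psi>f in \<open>auto simp: N_def\<close>)
  then obtain h where h: "h \<in> monoid_homs ?L G" and hl: "\<And>i x. i \<in> I \<Longrightarrow> x \<in> carrier (N i) \<Longrightarrow> h (?l i x) = \<psi> (base i) x"
    by blast
  have "inj_on h (carrier ?L)"
  proof (rule inj_onI)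
    fix a b assume ab: "a \<in> carrier ?L" "b \<in> carrier ?L" and eq: "h a = h b"
    obtain i x y where i: "i \<in> I" "x \<in> carrier (N i)" "y \<in> carrier (N i)" and a: "a = ?l i x" and b: "b = ?l i y"
      using limit_common[OF ab] by blast
    \<comment> \<open>A strict transition factors through \<open>\<psi>\<close>, so two elements
      with the same image in \<open>G\<close> become equal at the next stage.\<close>
    obtain j where j: "j \<in> I" "less i j" using above[OF i(1) i(1)] by blast
    then have ij: "(i, j) \<in> r" using i(1) by (simp add: r_def)
    have "f i j x = f i j y" unfolding f_less[OF j(2)] using eq hl[OF i(1,2)] hl[OF i(1,3)] a b by simp
    then show "a = b" unfolding a b limit_map_eq_iff[OF i(1,2) i(1,3)] using j(1) ij by blast
  qed
  moreover have "h ` carrier ?L = carrier G"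
  proof (intro equalityI subsetI)
    fix a assume "a \<in> h ` carrier ?L"
    then show "a \<in> carrier G" using monoid_homsD(1)[OF h] by blast
  next
    fix a assume "a \<in> carrier G"
    then have "finite {a}" "{a} \<subseteq> carrier G" by simp_all
    from finite_submonoid_extends[OF this] obtain A where A: "finite_submonoid A" "a \<in> A" by blast
    let ?S = "A \<times> {0}"
    have S: "?S \<in> I" using A(1) by (auto simp: I_def)
    have x: "\<iota> A a \<in> carrier (N ?S)"
      using monoid_homsD(1)[OF \<iota>[OF A(1)]] A(2) base_level[OF A(1)] by (simp add: N_def)
    have "h (?l ?S (\<iota> A a)) = a" using hl[OF S x] \<psi>\<iota>[OF A] base_level[OF A(1)] by simp
    then show "a \<in> h ` carrier ?L" using limit_map_closed[OF S x] by (metis imageI)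
  qed
  ultimately have bij: "bij_betw h (carrier ?L) (carrier G)" by (simp add: bij_betw_def)
  then have iso: "h \<in> iso ?L G" using h by (simp add: iso_def monoid_homs_def)
  have "inv_into (carrier ?L) h \<in> iso G ?L"
    using iso_monoid_homs(2)[OF comm_monoid_direct_limit comm_monoid_axioms iso] bij_betw_inv_into[OF bij]
    by (simp add: iso_def monoid_homs_def)
  then have "G \<cong> ?L" unfolding is_iso_def by blast
  moreover have "\<forall>i\<in>I. finite_sum_of_cyclic_with_identity (N i)"
    unfolding finite_sum_of_cyclic_with_identity_def
  proof
    fix i assume i: "i \<in> I"
    have "N i \<cong> product_group {..<k (base i)} (\<lambda>j. adjoin_identity (integer_mod_group (n (base i) j)))"
      unfolding N_def B_def P_def is_iso_def using iso_set_refl by blast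
    then show "\<exists>(k::nat) n. (\<forall>j<k. 0 < n j) \<and> N i \<cong> product_group {..<k} (\<lambda>j. adjoin_identity (integer_mod_group (n j)))"
      using n[OF base[OF i]] by blast
  qed
  ultimately show ?thesis unfolding is_direct_limit_of_def using sys by blast
qed

end

text \<open>Specific types are tied to the existence half: the equivalence uses those produced by
  the construction from finite submonoids, while the second conjunct derives (a) and (b) from a
  direct limit over arbitrary index and carrier types.\<close>

theorem theorem6p4:
  fixes M :: "('a, 'm) monoid_scheme"
  assumes "comm_monoid M"
  shows "(is_direct_limit_of TYPE(('a \<times> nat) set)
            (finite_sum_of_cyclic_with_identity :: (nat \<Rightarrow> int option) monoid \<Rightarrow> bool) M
          \<longleftrightarrow> (strongly_periodic M \<and> conical M \<and> refinement_monoid M) \<and> groups_embed_purely M)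
       \<and> (is_direct_limit_of TYPE('i)
            (finite_sum_of_cyclic_with_identity :: 'b monoid \<Rightarrow> bool) M
          \<longrightarrow> (strongly_periodic M \<and> conical M \<and> refinement_monoid M) \<and> groups_embed_purely M)"
proof -
  have "periodic_refinement_monoid M \<longleftrightarrow>
      (strongly_periodic M \<and> conical M \<and> refinement_monoid M) \<and> groups_embed_purely M"
    using assms by (auto simp: periodic_refinement_monoid_def periodic_refinement_monoid_axioms_def)
  moreover have "periodic_refinement_monoid M \<Longrightarrow> is_direct_limit_of TYPE(('a \<times> nat) set)
      (finite_sum_of_cyclic_with_identity :: (nat \<Rightarrow> int option) monoid \<Rightarrow> bool) M"
    by (rule periodic_refinement_monoid.is_direct_limit_of_cyclic_sums)
  moreover have "is_direct_limit_of TYPE(('a \<times> nat) set)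
      (finite_sum_of_cyclic_with_identity :: (nat \<Rightarrow> int option) monoid \<Rightarrow> bool) M \<Longrightarrow>
      periodic_refinement_monoid M"
    by (rule periodic_refinement_monoid_if_direct_limit[OF assms])
  moreover have "is_direct_limit_of TYPE('i)
      (finite_sum_of_cyclic_with_identity :: 'b monoid \<Rightarrow> bool) M \<Longrightarrow> periodic_refinement_monoid M"
    by (rule periodic_refinement_monoid_if_direct_limit[OF assms])
  ultimately show ?thesis by blast
qed

end
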